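(* Let $\sigma(\lambda)$, $\lambda\in\mathbb{R}$, be an increasing $n\times n$ matrix function satisfying: 1. If $g\in L^2_{\rm comp}(\mathbb{R}_+,\mathbb{C}^{2n})$ and if $\int_{\mathbb{R}}G_0(\lambda)^*\,d\sigma(\lambda)\,G_0(\lambda)=0$, where $G_0(\lambda)=\int_0^\infty e_0(x,\lambda)^*g(x)\,dx$, then $g=0$. 2. The function $$\tilde F(x,t):=\int_{\mathbb{R}}\tilde e_0(x,\lambda)\,d\Sigma(\lambda)\,\tilde e_0(t,\lambda)^*,\qquad \Sigma:=\sigma-\sigma_0,$$ exists and has a continuous mixed second derivative $F(x,t):=\frac{\partial^2}{\partial x\partial t}\tilde F(x,t)$ on $\mathbb{R}_+^2$. Then the Gelfand–Levitan equation $$F(x,t)+K(x,t)+\int_0^xK(x,s)F(s,t)\,ds=0,\qquad t<x,$$ has a unique continuous solution $K:\{(x,t)\in\mathbb{R}^2\mid 0\le t\le x\}\to \mathrm{M}(2n,\mathbb{C})$. Moreover, if $F(x,t)$ is continuously differentiable, then so is $K(x,t)$.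
   Context: Let $n\ge 1$, $\mathbb{R}_+=[0,\infty)$. Let $B=\mathrm{diag}(B_1,-B_2)$ with $B_1,B_2\in \mathrm{M}(n,\mathbb{C})$ self-adjoint positive definite (so $B$ is nonsingular self-adjoint of signature $0$), and let $H\in \mathrm{M}(n,\mathbb{C})$ satisfy $B_1=H^*B_2H$. Put $e_0(x,\lambda):=e^{i\lambda B^{-1}x}\binom{I}{H}$, $\tilde e_0(x,\lambda):=\int_0^xe_0(t,\lambda)\,dt$, and $\sigma_0(\lambda):=\frac1{2\pi}B_1^{-1}\lambda$. $L^2_{\rm comp}$ denotes $L^2$-functions with compact support in $[0,\infty)$. An $n\times n$ matrix function $\sigma$ is increasing if its values are self-adjoint and $\sigma(\lambda)-\sigma(\mu)\ge0$ for $\mu<\lambda$; such functions are taken right-continuous with $\sigma(0)=0$. Writing $d\sigma=\Phi\,d(\operatorname{tr}\sigma)$ with a nonnegative matrix density $\Phi$, $\int U\,d\sigma\,V$ means $\int U\Phi V\,d(\operatorname{tr}\sigma)$, and integrals against $d\Sigma$ are differences of those against $d\sigma$ and $d\sigma_0$. *)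

theory Defs
  imports "HOL-Analysis.Analysis"
begin

definition adj :: "complex^'n^'m \<Rightarrow> complex^'m^'n" where
  "adj A = (\<chi> i j. cnj (A $ j $ i))"

text \<open>The sesquilinear form \<open>v\<^sup>* A v\<close>; it is real when \<open>A\<close> is self-adjoint.\<close>

definition qform :: "complex^'n^'n \<Rightarrow> complex^'n \<Rightarrow> complex" where
  "qform A v = (\<Sum>i\<in>UNIV. cnj (v $ i) * (A *v v) $ i)"

definition nonneg_mat :: "complex^'n^'n \<Rightarrow> bool" where
  "nonneg_mat A \<longleftrightarrow> adj A = A \<and> (\<forall>v. 0 \<le> Re (qform A v))"

definition posdef_mat :: "complex^'n^'n \<Rightarrow> bool" where
  "posdef_mat A \<longleftrightarrow> adj A = A \<and> (\<forall>v. v \<noteq> 0 \<longrightarrow> 0 < Re (qform A v))"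

text \<open>
  The type \<open>'n + 'n\<close> indexes the \<open>2n\<close> coordinates: \<open>Inl\<close> gives the first block
  of \<open>n\<close> coordinates and \<open>Inr\<close> the second.
\<close>

definition block_diag :: "complex^'n^'n \<Rightarrow> complex^'n^'n \<Rightarrow> complex^('n + 'n)^('n + 'n)" where
  "block_diag P Q = (\<chi> r s. case (r, s) of
       (Inl i, Inl j) \<Rightarrow> P $ i $ j
     | (Inr i, Inr j) \<Rightarrow> Q $ i $ j
     | _ \<Rightarrow> 0)"

definition block_col :: "complex^'n^'n \<Rightarrow> complex^'n^'n \<Rightarrow> complex^'n^('n + 'n)" where
  "block_col P Q = (\<chi> r. case r of Inl i \<Rightarrow> P $ i | Inr i \<Rightarrow> Q $ i)"

text \<open>
  The exponential series for the matrix product \<open>**\<close>. The constant \<open>exp\<close> is not available here,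
  and \<open>*\<close> and \<open>^\<close> on vectors and matrices are componentwise operations.
\<close>

definition mexp :: "complex^'m^'m \<Rightarrow> complex^'m^'m" where
  "mexp A = (\<Sum>k. (((**) A ^^ k) (mat 1)) /\<^sub>R fact k)"

definition e0 :: "complex^('n + 'n)^('n + 'n) \<Rightarrow> complex^'n^'n \<Rightarrow> real \<Rightarrow> real
    \<Rightarrow> complex^'n^('n + 'n)" where
  "e0 B H x l = mexp (mat (\<i> * of_real (l * x)) ** matrix_inv B) ** block_col (mat 1) H"

definition te0 :: "complex^('n + 'n)^('n + 'n) \<Rightarrow> complex^'n^'n \<Rightarrow> real \<Rightarrow> real
    \<Rightarrow> complex^'n^('n + 'n)" where
  "te0 B H x l = integral {0..x} (\<lambda>t. e0 B H t l)"

definition sigma0 :: "complex^'n^'n \<Rightarrow> real \<Rightarrow> complex^'n^'n" where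
  "sigma0 B1 l = (l / (2 * pi)) *\<^sub>R matrix_inv B1"

definition L2_comp :: "(real \<Rightarrow> complex^'m) \<Rightarrow> bool" where
  "L2_comp g \<longleftrightarrow>
     g \<in> borel_measurable (lebesgue_on {0..}) \<and>
     integrable (lebesgue_on {0..}) (\<lambda>x. (norm (g x))\<^sup>2) \<and>
     (\<exists>R. AE x in lebesgue_on {0..}. R < x \<longrightarrow> g x = 0)"

definition G0 :: "complex^('n + 'n)^('n + 'n) \<Rightarrow> complex^'n^'n \<Rightarrow> (real \<Rightarrow> complex^('n + 'n))
    \<Rightarrow> real \<Rightarrow> complex^'n" where
  "G0 B H g l = (LINT x | lebesgue_on {0..}. adj (e0 B H x l) *v g x)"

definition increasing_mat :: "(real \<Rightarrow> complex^'n^'n) \<Rightarrow> bool" where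
  "increasing_mat \<sigma> \<longleftrightarrow>
     (\<forall>l. adj (\<sigma> l) = \<sigma> l) \<and>
     (\<forall>m l. m < l \<longrightarrow> nonneg_mat (\<sigma> l - \<sigma> m)) \<and>
     (\<forall>l. continuous (at_right l) \<sigma>) \<and>
     \<sigma> 0 = 0"

definition trace_measure :: "(real \<Rightarrow> complex^'n^'n) \<Rightarrow> real measure" where
  "trace_measure \<sigma> = interval_measure (\<lambda>l. Re (trace (\<sigma> l)))"

text \<open>\<open>\<Phi>\<close> is a nonnegative matrix density of \<open>d\<sigma>\<close> with respect to \<open>d(tr \<sigma>)\<close>.\<close>

definition matrix_density :: "(real \<Rightarrow> complex^'n^'n) \<Rightarrow> (real \<Rightarrow> complex^'n^'n) \<Rightarrow> bool" where
  "matrix_density \<sigma> \<Phi> \<longleftrightarrow>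
     \<Phi> \<in> borel_measurable borel \<and>
     (\<forall>l. nonneg_mat (\<Phi> l)) \<and>
     (\<forall>a b. a < b \<longrightarrow>
        set_integrable (trace_measure \<sigma>) {a<..b} \<Phi> \<and>
        (LINT l:{a<..b}|trace_measure \<sigma>. \<Phi> l) = \<sigma> b - \<sigma> a)"

text \<open>
  \<open>has_matrix_integral \<sigma> U V J\<close> says that \<open>\<integral> U d\<sigma> V\<close> exists (as a Lebesgue integral) and equals
  \<open>J\<close>. An increasing \<open>\<sigma>\<close> has a density by Radon--Nikodym, and two densities agree almost
  everywhere with respect to \<open>d(tr \<sigma>)\<close>, so the choice of \<open>\<Phi>\<close> does not matter.
\<close>

definition has_matrix_integral :: "(real \<Rightarrow> complex^'n^'n) \<Rightarrow> (real \<Rightarrow> complex^'n^'p)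
    \<Rightarrow> (real \<Rightarrow> complex^'q^'n) \<Rightarrow> complex^'q^'p \<Rightarrow> bool" where
  "has_matrix_integral \<sigma> U V J \<longleftrightarrow>
     (\<exists>\<Phi>. matrix_density \<sigma> \<Phi> \<and>
          has_bochner_integral (trace_measure \<sigma>) (\<lambda>l. U l ** \<Phi> l ** V l) J)"

definition has_matrix_integral_diff :: "(real \<Rightarrow> complex^'n^'n) \<Rightarrow> (real \<Rightarrow> complex^'n^'n)
    \<Rightarrow> (real \<Rightarrow> complex^'n^'p) \<Rightarrow> (real \<Rightarrow> complex^'q^'n) \<Rightarrow> complex^'q^'p \<Rightarrow> bool" where
  "has_matrix_integral_diff \<sigma> \<tau> U V J \<longleftrightarrow>
     (\<exists>J1 J2. has_matrix_integral \<sigma> U V J1 \<and> has_matrix_integral \<tau> U V J2 \<and> J = J1 - J2)"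

text \<open>
  \<open>F\<close> is the mixed derivative \<open>\<partial>\<^sup>2 f / \<partial>x \<partial>t\<close> of \<open>f\<close> on the closed quadrant; derivatives on the
  boundary are one-sided.
\<close>

definition mixed_deriv_on_quadrant ::
    "(real \<Rightarrow> real \<Rightarrow> 'a::real_normed_vector) \<Rightarrow> (real \<Rightarrow> real \<Rightarrow> 'a) \<Rightarrow> bool" where
  "mixed_deriv_on_quadrant f F \<longleftrightarrow>
     (\<exists>ft. \<forall>x\<ge>0. \<forall>t\<ge>0.
        ((\<lambda>t. f x t) has_vector_derivative ft x t) (at t within {0..}) \<and>
        ((\<lambda>x. ft x t) has_vector_derivative F x t) (at x within {0..}))"

definition quadrant :: "(real \<times> real) set" where
  "quadrant = {0..} \<times> {0..}"

definition lower_triangle :: "(real \<times> real) set" where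
  "lower_triangle = {(x, t). 0 \<le> t \<and> t \<le> x}"

text \<open>
  Continuous differentiability up to the boundary. It is used only for \<open>quadrant\<close> and \<open>lower_triangle\<close>,
  which are convex with nonempty interior, so the derivative within the set is unique.
\<close>

definition C1_on :: "(real \<times> real) set \<Rightarrow> (real \<Rightarrow> real \<Rightarrow> 'a::real_normed_vector) \<Rightarrow> bool" where
  "C1_on D f \<longleftrightarrow>
     (\<exists>f' :: real \<times> real \<Rightarrow> (real \<times> real) \<Rightarrow>\<^sub>L 'a.
        continuous_on D f' \<and>
        (\<forall>p\<in>D. ((\<lambda>(x, t). f x t) has_derivative blinfun_apply (f' p)) (at p within D)))"

text \<open>Values of \<open>K\<close> off \<open>lower_triangle\<close> are irrelevant.\<close>

definition GL_solution :: "(real \<Rightarrow> real \<Rightarrow> complex^'m^'m) \<Rightarrow> (real \<Rightarrow> real \<Rightarrow> complex^'m^'m)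
    \<Rightarrow> bool" where
  "GL_solution F K \<longleftrightarrow>
     continuous_on lower_triangle (\<lambda>(x, t). K x t) \<and>
     (\<forall>x t. 0 \<le> t \<and> t < x \<longrightarrow>
        F x t + K x t + integral {0..x} (\<lambda>s. K x s ** F s t) = 0)"

end

theory Submission
  imports Defs "HOL-Complex_Analysis.Great_Picard" "HOL-Probability.Sinc_Integral"
    "HOL-Real_Asymp.Real_Asymp"
begin

text \<open>
  For fixed \<open>x\<close> the equation is a Fredholm equation on \<open>[0, x]\<close>, and everything follows once the
  homogeneous equation \<open>\<rho>(t) + \<integral>\<^sub>0\<^sup>x \<rho>(s) F(s, t) ds = 0\<close> for a row \<open>\<rho>\<close> has only the zero solution: a compactness
  argument then bounds the inverse uniformly for \<open>x\<close> in a compact interval, the method of continuity in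
  \<open>x\<close> gives existence, and stability gives continuity and differentiability of \<open>K\<close>.

  For injectivity put \<open>g = \<rho>\<^sup>*\<close>. The free system satisfies
  \<open>\<integral> te0(x) d\<sigma>\<^sub>0 te0(t)\<^sup>* = min x t\<close>, which reduces to \<open>\<integral> (1 - cos \<lambda>) \<lambda>\<^sup>-\<^sup>2 d\<lambda> = \<pi>\<close> on eigenvectors of
  \<open>B\<close>. Hence \<open>\<integral> G\<^sup>* d\<sigma> G\<close> is \<open>\<parallel>g\<parallel>\<^sup>2 + \<langle>g, F g\<rangle>\<close> for step functions \<open>g\<close>. Approximating the solution \<open>g\<close> by step
  functions, the right-hand sides tend to \<open>0\<close>, so \<open>\<integral> G\<^sub>0\<^sup>* d\<sigma> G\<^sub>0 = 0\<close> by Fatou's lemma and \<open>g = 0\<close> by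
  the first assumption on \<open>\<sigma>\<close>.
\<close>

section \<open>Volterra--Fredholm equations on a triangle\<close>

lemma continuity_method:
  fixes A :: "real \<Rightarrow> 'a::{real_normed_vector,complete_space} \<Rightarrow> 'a"
  assumes lin: "\<And>x. x \<in> {0..X} \<Longrightarrow> linear (A x)"
    and lip: "\<And>x y k. x \<in> {0..X} \<Longrightarrow> y \<in> {0..X} \<Longrightarrow> norm (A x k - A y k) \<le> M * \<bar>x - y\<bar> * norm k"
    and bound: "\<And>x k. x \<in> {0..X} \<Longrightarrow> norm k \<le> C * norm (k + A x k)"
    and zero: "\<And>k. A 0 k = 0"
    and x: "x \<in> {0..X}"
  shows "\<exists>k. k + A x k = f"
proof -
  define D where "D = max 1 (2 * max C 1 * max M 1)"
  have D: "D > 0" by (simp add: D_def)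
  have C': "norm k \<le> max C 1 * norm (k + A y k)" if "y \<in> {0..X}" for y k
    using bound[OF that, of k] by (smt (verit) mult_right_mono norm_ge_zero)
  have M': "norm (A x k - A y k) \<le> max M 1 * \<bar>x - y\<bar> * norm k"
    if "x \<in> {0..X}" "y \<in> {0..X}" for x y k
  proof -
    have "M * \<bar>x - y\<bar> * norm k \<le> max M 1 * \<bar>x - y\<bar> * norm k"
      by (intro mult_right_mono) auto
    with lip[OF that, of k] show ?thesis by linarith
  qed
  \<comment> \<open>For \<open>z\<close> close to \<open>y\<close>, \<open>k + A y k = f\<close> is a fixed point equation for a contraction built from \<open>(1 + A z)\<^sup>-\<^sup>1\<close>.\<close>
  have step: "\<forall>f. \<exists>k. k + A y k = f"
    if xy: "z \<in> {0..X}" "y \<in> {0..X}" "\<bar>z - y\<bar> \<le> 1 / D" and sz: "\<forall>f. \<exists>k. k + A z k = f" for z y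
  proof
    fix f
    from sz obtain S where S: "\<And>f. S f + A z (S f) = f" by metis
    have Sd: "norm (S f - S g) \<le> max C 1 * norm (f - g)" for f g
    proof -
      have "(S f - S g) + A z (S f - S g) = (S f + A z (S f)) - (S g + A z (S g))"
        by (simp add: linear_diff[OF lin[OF xy(1)]])
      then have "(S f - S g) + A z (S f - S g) = f - g" by (simp only: S)
      then show ?thesis using C'[OF xy(1), of "S f - S g"] by simp
    qed
    define T where "T k = S (f + (A z k - A y k))" for k
    have "\<exists>!k. T k = k"
    proof (rule banach_fix_type[of "1/2"], simp, simp, intro allI)
      fix k k'
      have e: "f + (A z k - A y k) - (f + (A z k' - A y k')) = A z (k - k') - A y (k - k')"
        by (simp add: linear_diff[OF lin[OF xy(1)]] linear_diff[OF lin[OF xy(2)]])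
      have "dist (T k) (T k') \<le> max C 1 * norm (A z (k - k') - A y (k - k'))"
        unfolding dist_norm T_def using Sd e by metis
      also have "\<dots> \<le> max C 1 * (max M 1 * \<bar>z - y\<bar> * norm (k - k'))"
        by (intro mult_left_mono M' xy) auto
      also have "\<dots> = (max C 1 * max M 1) * \<bar>z - y\<bar> * norm (k - k')" by simp
      also have "\<dots> \<le> (max C 1 * max M 1) * (1 / D) * norm (k - k')"
        by (intro mult_right_mono mult_left_mono xy) auto
      also have "\<dots> \<le> 1/2 * norm (k - k')"
      proof (intro mult_right_mono)
        have "2 * (max C 1 * max M 1) \<le> D" by (simp add: D_def)
        then show "(max C 1 * max M 1) * (1 / D) \<le> 1/2" using D by (simp add: field_simps)
      qed auto
      finally show "dist (T k) (T k') \<le> 1/2 * dist k k'" by (simp add: dist_norm)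
    qed
    then obtain k where "T k = k" by blast
    then have "k + A z k = f + (A z k - A y k)" using S[of "f + (A z k - A y k)"] by (simp add: T_def)
    then show "\<exists>k. k + A y k = f" by (intro exI[of _ k]) (simp add: algebra_simps)
  qed
  have "0 \<le> X" using x by simp
  have "\<forall>y\<in>{0..X}. y \<le> real n / D \<longrightarrow> (\<forall>f. \<exists>k. k + A y k = f)" for n
  proof (induction n)
    case 0
    then show ?case using zero by auto
  next
    case (Suc n)
    show ?case
    proof (intro ballI impI)
      fix y assume y: "y \<in> {0..X}" "y \<le> real (Suc n) / D"
      define w where "w = 1 / D"
      have w: "0 < w" "y \<le> real n / D + w"
        using y D add_divide_distrib[of "real n" 1 D] by (auto simp: w_def add.commute)
      define z where "z = max 0 (y - w)"
      have z: "z \<in> {0..X}" "z \<le> real n / D" "\<bar>z - y\<bar> \<le> 1 / D"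
        using y(1) w D unfolding w_def[symmetric] z_def by auto
      show "\<forall>f. \<exists>k. k + A y k = f"
        by (rule step[OF z(1) y(1) z(3)]) (use Suc.IH z in blast)
    qed
  qed
  moreover obtain n :: nat where "x * D < real n" using reals_Archimedean2 by blast
  ultimately show ?thesis using x D by (metis less_imp_le pos_le_divide_eq)
qed

locale injective_kernel = bounded_bilinear mul
  for mul :: "'a::euclidean_space \<Rightarrow> 'b::real_normed_vector \<Rightarrow> 'a" +
  fixes F :: "real \<Rightarrow> real \<Rightarrow> 'b"
  assumes contF: "continuous_on quadrant (\<lambda>(x, t). F x t)"
    and inj: "\<And>x k. 0 \<le> x \<Longrightarrow> continuous_on {0..x} k \<Longrightarrow>
      (\<And>t. t \<in> {0..x} \<Longrightarrow> k t + integral {0..x} (\<lambda>s. mul (k s) (F s t)) = 0) \<Longrightarrow>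
      (\<And>t. t \<in> {0..x} \<Longrightarrow> k t = 0)"
begin

lemma contF_comp:
  assumes "continuous_on S f" "continuous_on S g" "\<And>s. s \<in> S \<Longrightarrow> 0 \<le> f s \<and> 0 \<le> g s"
  shows "continuous_on S (\<lambda>s. F (f s) (g s))"
  using continuous_on_compose2[OF contF continuous_on_Pair[OF assms(1,2)]] assms(3)
  by (auto simp: quadrant_def)

lemma F_bound:
  obtains m where "0 < m" "\<And>s t. s \<in> {0..X} \<Longrightarrow> t \<in> {0..X} \<Longrightarrow> norm (F s t) \<le> m"
proof -
  have "compact ((\<lambda>p. F (fst p) (snd p)) ` ({0..X} \<times> {0..X}))"
    by (intro compact_continuous_image compact_Times contF_comp continuous_intros) auto
  then obtain m where "0 < m" "\<And>p. p \<in> {0..X} \<times> {0..X} \<Longrightarrow> norm (F (fst p) (snd p)) \<le> m"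
    using bounded_pos compact_imp_bounded by (metis (no_types, lifting) imageI)
  then show ?thesis by (intro that[of m]) force+
qed

lemma F_unif:
  assumes "0 < e"
  obtains d where "0 < d" "\<And>s t s' t'. s \<in> {0..X} \<Longrightarrow> t \<in> {0..X} \<Longrightarrow> s' \<in> {0..X} \<Longrightarrow> t' \<in> {0..X} \<Longrightarrow>
     \<bar>s - s'\<bar> < d \<Longrightarrow> \<bar>t - t'\<bar> < d \<Longrightarrow> norm (F s t - F s' t') < e"
proof -
  have "uniformly_continuous_on ({0..X} \<times> {0..X}) (\<lambda>p. F (fst p) (snd p))"
    by (intro compact_uniformly_continuous compact_Times contF_comp continuous_intros) auto
  then obtain d where d: "d > 0" "\<And>p q. p \<in> {0..X} \<times> {0..X} \<Longrightarrow> q \<in> {0..X} \<times> {0..X} \<Longrightarrow> dist q p < d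
      \<Longrightarrow> dist (F (fst q) (snd q)) (F (fst p) (snd p)) < e"
    using assms unfolding uniformly_continuous_on_def by metis
  show ?thesis
  proof (rule that[of "d/2"])
    fix s t s' t' assume a: "s \<in> {0..X}" "t \<in> {0..X}" "s' \<in> {0..X}" "t' \<in> {0..X}"
      "\<bar>s - s'\<bar> < d/2" "\<bar>t - t'\<bar> < d/2"
    have "dist (s, t) (s', t') \<le> \<bar>s - s'\<bar> + \<bar>t - t'\<bar>"
      by (simp add: dist_Pair_Pair dist_real_def sqrt_sum_squares_le_sum_abs)
    then show "norm (F s t - F s' t') < e"
      using d(2)[of "(s',t')" "(s,t)"] a by (auto simp: dist_norm)
  qed (use d in auto)
qed

lemma cont_integrand:
  assumes "continuous_on {a..b} k" "0 \<le> a" "0 \<le> t"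
  shows "continuous_on {a..b} (\<lambda>s. mul (k s) (F s t))"
  by (intro continuous_on assms contF_comp continuous_intros) (use assms in auto)

lemma integrand_integrable:
  assumes "continuous_on {a..b} k" "0 \<le> a" "0 \<le> t"
  shows "(\<lambda>s. mul (k s) (F s t)) integrable_on {a..b}"
  by (intro integrable_continuous_real cont_integrand assms)

lemma norm_integral_le:
  assumes "continuous_on {a..b} k" "0 \<le> a" "a \<le> b" "b \<le> X" "t \<in> {0..X}" "\<And>s. s \<in> {a..b} \<Longrightarrow> norm (k s) \<le> m"
    "\<And>s. s \<in> {a..b} \<Longrightarrow> norm (F s t) \<le> mF" "\<And>a b. norm (mul a b) \<le> norm a * norm b * K" "0 < K"
  shows "norm (integral {a..b} (\<lambda>s. mul (k s) (F s t))) \<le> (K * m * mF) * (b - a)"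
proof (rule integral_bound)
  show "a \<le> b" by fact
  show "continuous_on {a..b} (\<lambda>s. mul (k s) (F s t))"
    by (rule cont_integrand) (use assms in auto)
  fix s assume s: "s \<in> {a..b}"
  have "norm (mul (k s) (F s t)) \<le> norm (k s) * norm (F s t) * K" by fact
  also have "\<dots> \<le> m * mF * K"
    using assms(6,7)[OF s] assms(9) by (intro mult_right_mono mult_mono) (auto intro: order_trans[OF norm_ge_zero])
  finally show "norm (mul (k s) (F s t)) \<le> K * m * mF" by (simp add: mult_ac)
qed

lemma integral_continuous_t:
  assumes "continuous_on {0..x} k"
  shows "continuous_on {0..} (\<lambda>t. integral {0..x} (\<lambda>s. mul (k s) (F s t)))"
proof -
  have "continuous_on ({0..} \<times> {0..x}) (\<lambda>p. mul (k (snd p)) (F (snd p) (fst p)))"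
    by (intro continuous_on contF_comp continuous_intros continuous_on_compose2[OF assms]) auto
  then show ?thesis
    using integral_continuous_on_param[of "{0..}" 0 x "\<lambda>t s. mul (k s) (F s t)"]
    by (simp add: case_prod_unfold)
qed

text \<open>
  Otherwise there are \<open>k\<^sub>n\<close> of sup norm \<open>1\<close> whose images tend to \<open>0\<close>. Their integral terms are
  equicontinuous, so a subsequence converges uniformly, to a nonzero solution of a homogeneous equation.
\<close>

lemma gl_lower_bound:
  assumes "0 \<le> X"
  shows "\<exists>C>0. \<forall>x\<in>{0..X}. \<forall>k M. continuous_on {0..X} k \<longrightarrow>
    (\<forall>t\<in>{0..X}. norm (k t + integral {0..x} (\<lambda>s. mul (k s) (F s t))) \<le> M) \<longrightarrow>
    (\<forall>t\<in>{0..X}. norm (k t) \<le> C * M)"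
proof (rule ccontr)
  assume neg: "\<not> ?thesis"
  obtain K where K: "0 < K" "\<And>a b. norm (mul a b) \<le> norm a * norm b * K" using pos_bounded by blast
  obtain mF where mF: "0 < mF" "\<And>s t. s \<in> {0..X} \<Longrightarrow> t \<in> {0..X} \<Longrightarrow> norm (F s t) \<le> mF"
    using F_bound[of X] by blast
  define P where "P n x k \<longleftrightarrow> x \<in> {0..X} \<and> continuous_on {0..X} k \<and> (\<forall>t\<in>{0..X}. norm (k t) \<le> 1) \<and>
      (\<exists>t\<in>{0..X}. norm (k t) = 1) \<and>
      (\<forall>t\<in>{0..X}. norm (k t + integral {0..x} (\<lambda>s. mul (k s) (F s t))) \<le> 1 / real (Suc n))" for n x k
  have "\<exists>x k. P n x k" for n
  proof -
    have "0 < real (Suc n)" by simp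
    with neg obtain x k M t1 where a: "x \<in> {0..X}" "continuous_on {0..X} k"
      "\<And>t. t \<in> {0..X} \<Longrightarrow> norm (k t + integral {0..x} (\<lambda>s. mul (k s) (F s t))) \<le> M"
      "t1 \<in> {0..X}" "\<not> norm (k t1) \<le> real (Suc n) * M" by blast
    obtain t0 where t0: "t0 \<in> {0..X}" "\<And>t. t \<in> {0..X} \<Longrightarrow> norm (k t) \<le> norm (k t0)"
      using continuous_attains_sup[OF compact_Icc _ continuous_on_norm[OF a(2)]] assms
      by (metis atLeastAtMost_iff empty_iff order_refl)
    define c where "c = norm (k t0)"
    have "0 \<le> M" using a(3)[OF a(4)] norm_ge_zero order_trans by blast
    have "real (Suc n) * M < c" using a(5) t0(2)[OF a(4)] unfolding c_def by linarith
    moreover have "0 \<le> real (Suc n) * M" using \<open>0 \<le> M\<close> by simp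
    ultimately have c: "0 < c" "M / c \<le> 1 / real (Suc n)" by (auto simp: field_simps)
    define k' where "k' t = k t /\<^sub>R c" for t
    have i: "k' t + integral {0..x} (\<lambda>s. mul (k' s) (F s t))
        = (k t + integral {0..x} (\<lambda>s. mul (k s) (F s t))) /\<^sub>R c" for t
      by (simp add: k'_def scaleR_left scaleR_add_right)
    show ?thesis unfolding P_def
    proof (intro exI conjI)
      show "x \<in> {0..X}" by fact
      show "continuous_on {0..X} k'" unfolding k'_def by (intro continuous_intros a)
      have nk': "norm (k' t) = norm (k t) / c" for t
        using c(1) by (simp add: k'_def divide_inverse)
      show "\<forall>t\<in>{0..X}. norm (k' t) \<le> 1"
        unfolding nk' using t0(2) c(1) by (simp add: c_def)
      show "\<exists>t\<in>{0..X}. norm (k' t) = 1"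
        unfolding nk' using t0(1) c(1) by (intro bexI[of _ t0]) (simp_all add: c_def)
      show "\<forall>t\<in>{0..X}. norm (k' t + integral {0..x} (\<lambda>s. mul (k' s) (F s t))) \<le> 1 / real (Suc n)"
      proof
        fix t assume "t \<in> {0..X}"
        then have "norm (k' t + integral {0..x} (\<lambda>s. mul (k' s) (F s t))) \<le> M / c"
          using divide_right_mono[OF a(3)[of t], of c] c(1) unfolding i by (simp add: divide_inverse mult.commute)
        with c show "norm (k' t + integral {0..x} (\<lambda>s. mul (k' s) (F s t))) \<le> 1 / real (Suc n)"
          by linarith
      qed
    qed
  qed
  then obtain x k where "\<And>n. P n (x n) (k n)" by metis
  then have x: "\<And>n. x n \<in> {0..X}" and k: "\<And>n. continuous_on {0..X} (k n)"
    and k1: "\<And>n t. t \<in> {0..X} \<Longrightarrow> norm (k n t) \<le> 1" and k2: "\<And>n. \<exists>t\<in>{0..X}. norm (k n t) = 1"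
    and small: "\<And>n t. t \<in> {0..X} \<Longrightarrow>
       norm (k n t + integral {0..x n} (\<lambda>s. mul (k n s) (F s t))) \<le> 1 / real (Suc n)"
    unfolding P_def by blast+
  obtain x0 r where r: "x0 \<in> {0..X}" "strict_mono r" "(x \<circ> r) \<longlonglongrightarrow> x0"
    using compact_Icc[of 0 X, THEN compact_imp_seq_compact] x unfolding seq_compact_def by blast
  define a where "a n t = integral {0..x n} (\<lambda>s. mul (k n s) (F s t))" for n t
  have ksub: "continuous_on {0..y} (k n)" if "y \<in> {0..X}" for n y
    using continuous_on_subset[OF k] that by auto
  have a_bd: "norm (a n t) \<le> K * 1 * mF * X" if "t \<in> {0..X}" for n t
  proof -
    have "norm (a n t) \<le> (K * 1 * mF) * (x n - 0)" unfolding a_def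
      by (rule norm_integral_le[where X = X]) (use that x[of n] ksub k1 mF K in auto)
    also have "\<dots> \<le> (K * 1 * mF) * X" using K(1) mF(1) x[of n] by (intro mult_left_mono) auto
    finally show ?thesis by simp
  qed
  have a_eq: "\<exists>d>0. \<forall>n t'. t' \<in> {0..X} \<and> norm (t - t') < d \<longrightarrow> norm (a n t - a n t') < e"
    if t: "t \<in> {0..X}" and e: "0 < e" for t e
  proof -
    define e' where "e' = e / (2 * (K * X + 1))"
    have KX: "0 \<le> K * X" using K(1) assms by simp
    then have "e' > 0" unfolding e'_def using e by (intro divide_pos_pos) auto
    obtain d where d: "d > 0" "\<And>s t s' t'. s \<in> {0..X} \<Longrightarrow> t \<in> {0..X} \<Longrightarrow> s' \<in> {0..X} \<Longrightarrow> t' \<in> {0..X} \<Longrightarrow>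
     \<bar>s - s'\<bar> < d \<Longrightarrow> \<bar>t - t'\<bar> < d \<Longrightarrow> norm (F s t - F s' t') < e'"
      using F_unif[OF \<open>e' > 0\<close>, of X] by blast
    have "norm (a n t - a n t') < e" if t': "t' \<in> {0..X}" "\<bar>t - t'\<bar> < d" for n t'
    proof -
      have "a n t - a n t' = integral {0..x n} (\<lambda>s. mul (k n s) (F s t) - mul (k n s) (F s t'))"
        unfolding a_def using t t'(1) x[of n]
        by (intro integral_diff[symmetric] integrand_integrable ksub) auto
      also have "norm \<dots> \<le> (K * 1 * e') * (x n - 0)"
      proof (rule integral_bound)
        show "continuous_on {0..x n} (\<lambda>s. mul (k n s) (F s t) - mul (k n s) (F s t'))"
          using t t' x[of n] by (intro continuous_intros cont_integrand ksub) auto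
        fix s assume s: "s \<in> {0..x n}"
        then have s': "s \<in> {0..X}" using x[of n] by auto
        have "norm (mul (k n s) (F s t) - mul (k n s) (F s t')) = norm (mul (k n s) (F s t - F s t'))"
          by (simp add: diff_right)
        also have "\<dots> \<le> norm (k n s) * norm (F s t - F s t') * K" by (rule K)
        also have "\<dots> \<le> 1 * e' * K"
          using k1[OF s', of n] d(2)[OF s' t s' t'(1)] t'(2) d(1) K(1)
          by (intro mult_right_mono mult_mono) auto
        finally show "norm (mul (k n s) (F s t) - mul (k n s) (F s t')) \<le> K * 1 * e'" by (simp add: mult.commute)
      qed (use x[of n] in auto)
      also have "\<dots> \<le> (K * 1 * e') * X" using K(1) \<open>e' > 0\<close> x[of n] by (intro mult_left_mono) auto
      also have "\<dots> = K * X * e'" by simp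
      also have "\<dots> \<le> (K * X + 1) * e'" using \<open>e' > 0\<close> by (intro mult_right_mono) auto
      also have "\<dots> = e / 2" using KX by (simp add: e'_def field_simps)
      finally show ?thesis using e by simp
    qed
    then show ?thesis using d(1) by (intro exI[of _ d]) auto
  qed
  obtain g and q :: "nat \<Rightarrow> nat" where g: "continuous_on {0..X} g" "strict_mono q"
    "\<And>e. 0 < e \<Longrightarrow> \<exists>N. \<forall>n t. n \<ge> N \<and> t \<in> {0..X} \<longrightarrow> norm ((a \<circ> r) (q n) t - g t) < e"
  proof (rule Arzela_Ascoli[of "{0..X}" "a \<circ> r" "K * 1 * mF * X"])
    fix t e :: real assume "t \<in> {0..X}" "0 < e"
    from a_eq[OF this] show "\<exists>d>0. \<forall>n t'. t' \<in> {0..X} \<and> norm (t - t') < d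
        \<longrightarrow> norm ((a \<circ> r) n t - (a \<circ> r) n t') < e" by (simp add: o_def) metis
  next
    fix g :: "real \<Rightarrow> 'a" and q :: "nat \<Rightarrow> nat"
    assume gq: "continuous_on {0..X} g" "strict_mono q" "\<And>e. 0 < e \<Longrightarrow> \<exists>N. \<forall>n t. n \<ge> N \<and> t \<in> {0..X} \<longrightarrow> norm ((a \<circ> r) (q n) t - g t) < e"
    show thesis
    proof (rule that[of g q])
      fix e :: real assume "0 < e"
      then show "\<exists>N. \<forall>n t. n \<ge> N \<and> t \<in> {0..X} \<longrightarrow> norm ((a \<circ> r) (q n) t - g t) < e" by (rule gq(3))
    qed (fact gq)+
  qed (use a_bd in auto)
  define h where "h = r \<circ> q"
  have h: "strict_mono h" using r(2) g(2) by (simp add: h_def strict_mono_o)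
  have xh: "(\<lambda>n. x (h n)) \<longlonglongrightarrow> x0"
    using LIMSEQ_subseq_LIMSEQ[OF r(3) g(2)] by (simp add: h_def o_def)
  have kh: "\<exists>N. \<forall>n\<ge>N. \<forall>t\<in>{0..X}. norm (k (h n) t + g t) \<le> e" if e: "0 < e" for e
  proof -
    obtain N where N: "\<And>n t. n \<ge> N \<Longrightarrow> t \<in> {0..X} \<Longrightarrow> norm (a (h n) t - g t) < e/2"
      using g(3)[of "e/2"] e by (auto simp: h_def)
    obtain N' where N': "1 / real (Suc N') < e / 2" using e by (meson half_gt_zero nat_approx_posE)
    have "norm (k (h n) t + g t) \<le> e" if n: "n \<ge> max N N'" and t: "t \<in> {0..X}" for n t
    proof -
      have "Suc N' \<le> Suc (h n)" using n seq_suble[OF h, of n] by auto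
      then have "1 / real (Suc (h n)) \<le> 1 / real (Suc N')" by (intro divide_left_mono) auto
      then have "norm (k (h n) t + a (h n) t) \<le> e/2"
        using small[OF t, of "h n"] N' unfolding a_def by linarith
      moreover have "norm (a (h n) t - g t) < e/2" using N n t by auto
      moreover have "k (h n) t + g t = (k (h n) t + a (h n) t) - (a (h n) t - g t)" by simp
      then have "norm (k (h n) t + g t) \<le> norm (k (h n) t + a (h n) t) + norm (a (h n) t - g t)"
        by (metis norm_triangle_ineq4)
      ultimately show ?thesis by linarith
    qed
    then show ?thesis by blast
  qed
  obtain mg where mg: "0 < mg" "\<And>t. t \<in> {0..X} \<Longrightarrow> norm (g t) \<le> mg"
  proof -
    have "compact (g ` {0..X})" using g(1) by (intro compact_continuous_image) auto
    then show ?thesis using that bounded_pos compact_imp_bounded by (metis imageI)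
  qed
  have eqn: "g t = integral {0..x0} (\<lambda>s. mul (- g s) (F s t))" if t: "t \<in> {0..X}" for t
  proof -
    have gs: "continuous_on {c..d} g" if "0 \<le> c" "d \<le> X" for c d
      using continuous_on_subset[OF g(1)] that by auto
    define G where "G y = integral {0..y} (\<lambda>s. mul (- g s) (F s t))" for y
    have gi: "continuous_on {0..X} (\<lambda>s. mul (- g s) (F s t))"
      using t g(1) by (intro cont_integrand continuous_intros) auto
    have "continuous_on {0..X} G" unfolding G_def
      by (rule indefinite_integral_continuous_1) (use gi integrable_continuous_real in blast)
    then have "(\<lambda>n. G (x (h n))) \<longlonglongrightarrow> G x0"
      using xh r(1) x unfolding continuous_on_sequentially by (auto simp: o_def)
    moreover have "(\<lambda>n. a (h n) t - G (x (h n))) \<longlonglongrightarrow> 0"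
    proof (rule LIMSEQ_I)
      fix e :: real assume e: "e > 0"
      define e' where "e' = e / (2 * (K * mF * X + 1))"
      have pos: "0 \<le> K * mF * X" using K(1) mF(1) assms by simp
      then have e': "e' > 0" unfolding e'_def using e by (intro divide_pos_pos) auto
      obtain N where N: "\<And>n t. n \<ge> N \<Longrightarrow> t \<in> {0..X} \<Longrightarrow> norm (k (h n) t + g t) \<le> e'" using kh[OF e'] by blast
      have "norm (a (h n) t - G (x (h n)) - 0) < e" if n: "n \<ge> N" for n
      proof -
        have xn: "x (h n) \<in> {0..X}" by (rule x)
        have "a (h n) t - G (x (h n)) = integral {0..x (h n)} (\<lambda>s. mul (k (h n) s + g s) (F s t))"
          unfolding a_def G_def using t xn
          by (subst integral_diff[symmetric])
             (auto simp: minus_left add_left intro!: integrable_neg integrand_integrable ksub gs continuous_intros)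
        also have "norm \<dots> \<le> (K * e' * mF) * (x (h n) - 0)"
        proof (rule norm_integral_le[where X = X, OF _ _ _ _ t _ _ K(2,1)])
          show "continuous_on {0..x (h n)} (\<lambda>s. k (h n) s + g s)"
            using xn by (intro continuous_intros ksub gs) auto
          show "norm (k (h n) s + g s) \<le> e'" if "s \<in> {0..x (h n)}" for s
            using N[OF n, of s] that xn by auto
          show "norm (F s t) \<le> mF" if "s \<in> {0..x (h n)}" for s
            using mF(2)[of s t] that xn t by auto
        qed (use xn in auto)
        also have "\<dots> \<le> (K * e' * mF) * X" using K(1) e' mF(1) xn by (intro mult_left_mono) auto
        also have "\<dots> \<le> (K * mF * X + 1) * e'" using e' by (simp add: algebra_simps)
        also have "\<dots> = e / 2" using pos by (simp add: e'_def field_simps)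
        finally show ?thesis using e by simp
      qed
      then show "\<exists>N. \<forall>n\<ge>N. norm (a (h n) t - G (x (h n)) - 0) < e" by blast
    qed
    ultimately have "(\<lambda>n. a (h n) t) \<longlonglongrightarrow> G x0" using tendsto_add by fastforce
    moreover have "(\<lambda>n. a (h n) t) \<longlonglongrightarrow> g t"
    proof (rule LIMSEQ_I)
      fix e :: real assume "e > 0"
      then show "\<exists>N. \<forall>n\<ge>N. norm (a (h n) t - g t) < e" using g(3)[of e] t by (auto simp: h_def)
    qed
    ultimately show ?thesis unfolding G_def using LIMSEQ_unique by blast
  qed
  have g0: "g t = 0" if "t \<in> {0..x0}" for t
  proof -
    have "- g t = 0"
    proof (rule inj[where k = "\<lambda>t. - g t", of x0])
      show "continuous_on {0..x0} (\<lambda>t. - g t)"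
        using continuous_on_subset[OF g(1)] r(1) by (intro continuous_intros) auto
      fix t assume "t \<in> {0..x0}"
      then show "- g t + integral {0..x0} (\<lambda>s. mul (- g s) (F s t)) = 0" using eqn[of t] r(1) by auto
    qed (use that r(1) in auto)
    then show ?thesis by simp
  qed
  have "g t = 0" if "t \<in> {0..X}" for t
  proof -
    have "integral {0..x0} (\<lambda>s. mul (- g s) (F s t)) = integral {0..x0} (\<lambda>s. 0)"
      by (rule integral_cong) (simp add: g0 zero_left)
    then show ?thesis using eqn[OF that] by simp
  qed
  then obtain N where N: "\<And>n t. n \<ge> N \<Longrightarrow> t \<in> {0..X} \<Longrightarrow> norm (k (h n) t) \<le> 1/2"
    using kh[of "1/2"] by fastforce
  obtain t where "t \<in> {0..X}" "norm (k (h N) t) = 1" using k2 by blast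
  with N[of N t] show False by simp
qed

end

lemma integral_increment_bound:
  fixes h :: "real \<Rightarrow> 'a::banach"
  assumes h: "continuous_on {0..X} h" and xy: "x \<in> {0..X}" "y \<in> {0..X}"
    and e: "\<And>s. s \<in> {min x y..max x y} \<Longrightarrow> norm (h s - c) \<le> e"
  shows "norm (integral {0..x} h - integral {0..y} h - (x - y) *\<^sub>R c) \<le> e * \<bar>x - y\<bar>"
proof -
  have *: "norm (integral {0..b} h - integral {0..a} h - (b - a) *\<^sub>R c) \<le> e * (b - a)"
    if ab: "a \<in> {0..X}" "b \<in> {0..X}" "a \<le> b" and e: "\<And>s. s \<in> {a..b} \<Longrightarrow> norm (h s - c) \<le> e" for a b
  proof -
    have cont: "continuous_on {0..b} h" "continuous_on {a..b} h"
      using continuous_on_subset[OF h] ab by auto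
    have "integral {0..a} h + integral {a..b} h = integral {0..b} h"
      by (rule Henstock_Kurzweil_Integration.integral_combine)
         (use ab cont in \<open>auto intro: integrable_continuous_real\<close>)
    moreover have "integral {a..b} (\<lambda>s. h s - c) = integral {a..b} h - (b - a) *\<^sub>R c"
      using ab by (subst integral_diff) (auto intro: integrable_continuous_real cont)
    ultimately have "integral {0..b} h - integral {0..a} h - (b - a) *\<^sub>R c = integral {a..b} (\<lambda>s. h s - c)"
      by (metis add_diff_cancel_left')
    also have "norm \<dots> \<le> e * (b - a)"
      by (rule integral_bound) (use ab e in \<open>auto intro!: continuous_intros cont\<close>)
    finally show ?thesis .
  qed
  show ?thesis
  proof (cases "y \<le> x")
    case True
    then show ?thesis using *[of y x] xy e by (auto simp: min_def max_def)
  next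
    case False
    have "integral {0..x} h - integral {0..y} h - (x - y) *\<^sub>R c
        = - (integral {0..y} h - integral {0..x} h - (y - x) *\<^sub>R c)" by (simp add: algebra_simps)
    then show ?thesis using *[of x y] xy e False by (metis abs_minus_commute abs_of_nonneg diff_ge_0_iff_ge linear
          max.absorb2 min.absorb1 norm_minus_cancel)
  qed
qed

lemma at_within_quadrant:
  assumes "p \<in> quadrant" "fst p < X" "snd p < X"
  shows "at p within quadrant = at p within ({0..X} \<times> {0..X})"
  by (rule at_within_nhd[of _ "{..<X} \<times> {..<X}"])
     (use assms in \<open>auto simp: quadrant_def mem_Times_iff intro!: open_Times\<close>)

lemma continuous_on_quadrant_iff_squares:
  "continuous_on quadrant f \<longleftrightarrow> (\<forall>X. continuous_on ({0..X} \<times> {0..X}) f)" for f :: "real \<times> real \<Rightarrow> 'a::topological_space"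
proof
  assume "continuous_on quadrant f"
  then show "\<forall>X. continuous_on ({0..X} \<times> {0..X}) f"
    by (auto elim!: continuous_on_subset simp: quadrant_def)
next
  assume sq: "\<forall>X. continuous_on ({0..X} \<times> {0..X}) f"
  show "continuous_on quadrant f" unfolding continuous_on_eq_continuous_within
  proof
    fix p :: "real \<times> real" assume p: "p \<in> quadrant"
    define X where "X = max (fst p) (snd p) + 1"
    have "continuous (at p within ({0..X} \<times> {0..X})) f"
      using sq p unfolding continuous_on_eq_continuous_within
      by (cases p) (auto simp: X_def quadrant_def)
    then show "continuous (at p within quadrant) f"
      using at_within_quadrant[OF p, of X] by (simp add: X_def)
  qed
qed

lemma continuous_on_variable_integral:
  fixes h :: "real \<Rightarrow> real \<Rightarrow> real \<Rightarrow> 'a::banach"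
  assumes "continuous_on ({0..} \<times> {0..} \<times> {0..}) (\<lambda>(x, s, t). h x s t)"
  shows "continuous_on quadrant (\<lambda>(x, t). integral {0..x} (\<lambda>s. h x s t))"
proof -
  have "continuous_on (quadrant \<times> cbox 0 1) (\<lambda>q. (\<lambda>(x, s, t). h x s t) (fst (fst q), fst (fst q) * snd q, snd (fst q)))"
    by (rule continuous_on_compose2[OF assms]) (auto intro!: continuous_intros simp: quadrant_def)
  then have "continuous_on quadrant (\<lambda>p. integral (cbox 0 1) (\<lambda>u. h (fst p) (fst p * u) (snd p)))"
    by (intro integral_continuous_on_param) (simp add: case_prod_unfold)
  then have c: "continuous_on quadrant (\<lambda>p. fst p *\<^sub>R integral {0..1} (\<lambda>u. h (fst p) (fst p * u) (snd p)))"
    by (auto intro!: continuous_intros)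
  have eq: "fst p *\<^sub>R integral {0..1} (\<lambda>u. h (fst p) (fst p * u) (snd p)) = (\<lambda>(x, t). integral {0..x} (\<lambda>s. h x s t)) p"
    if "p \<in> quadrant" for p
  proof (cases "fst p = 0")
    case True
    then show ?thesis by (auto simp: case_prod_unfold)
  next
    case False
    then have x: "fst p > 0" "0 \<le> snd p" using that by (auto simp: quadrant_def)
    have "continuous_on {0..fst p} (\<lambda>s. (\<lambda>(x, s, t). h x s t) (fst p, s, snd p))"
      by (rule continuous_on_compose2[OF assms]) (use x in \<open>auto intro!: continuous_intros\<close>)
    then have "((\<lambda>s. h (fst p) s (snd p)) has_integral integral {0..fst p} (\<lambda>s. h (fst p) s (snd p))) {0..fst p}"
      by (intro integrable_integral integrable_continuous_real) simp
    from has_integral_stretch_real[OF this False]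
    have "((\<lambda>u. h (fst p) (fst p * u) (snd p)) has_integral
       (1 / \<bar>fst p\<bar>) *\<^sub>R integral {0..fst p} (\<lambda>s. h (fst p) s (snd p))) {0..1}"
      using x by (simp add: image_divide_atLeastAtMost)
    then have "integral {0..1} (\<lambda>u. h (fst p) (fst p * u) (snd p)) = (1 / \<bar>fst p\<bar>) *\<^sub>R integral {0..fst p} (\<lambda>s. h (fst p) s (snd p))"
      by (rule integral_unique)
    then show ?thesis using x by (simp add: case_prod_unfold)
  qed
  show ?thesis
    using c by (rule continuous_on_eq) (rule eq)
qed

lemma C1_on_quadrant_partials:
  assumes "C1_on quadrant f"
  obtains fx ft where "continuous_on quadrant (\<lambda>(x, t). fx x t)" "continuous_on quadrant (\<lambda>(x, t). ft x t)"
    "\<And>x t. 0 \<le> x \<Longrightarrow> 0 \<le> t \<Longrightarrow> ((\<lambda>x. f x t) has_vector_derivative fx x t) (at x within {0..})"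
    "\<And>x t. 0 \<le> x \<Longrightarrow> 0 \<le> t \<Longrightarrow> ((\<lambda>t. f x t) has_vector_derivative ft x t) (at t within {0..})"
proof -
  obtain f' where f': "continuous_on quadrant f'"
    "\<And>p. p \<in> quadrant \<Longrightarrow> ((\<lambda>(x, t). f x t) has_derivative blinfun_apply (f' p)) (at p within quadrant)"
    using assms unfolding C1_on_def by blast
  show ?thesis
  proof (rule that)
    show "continuous_on quadrant (\<lambda>(x, t). blinfun_apply (f' (x, t)) (1, 0))"
      "continuous_on quadrant (\<lambda>(x, t). blinfun_apply (f' (x, t)) (0, 1))"
      using f'(1) by (auto simp: case_prod_unfold intro!: continuous_intros)
    fix x t :: real assume xt: "0 \<le> x" "0 \<le> t"
    then have p: "(x, t) \<in> quadrant" by (simp add: quadrant_def)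
    have "((\<lambda>x. (\<lambda>(x, t). f x t) (x, t)) has_derivative (\<lambda>h. blinfun_apply (f' (x, t)) (h, 0))) (at x within {0..})"
    proof (rule has_derivative_in_compose2[where t = quadrant and g = "\<lambda>(x, t). f x t"
          and g' = "\<lambda>p. blinfun_apply (f' p)" and f = "\<lambda>x. (x, t)" and f' = "\<lambda>h. (h, 0)"])
      show "((\<lambda>(x, t). f x t) has_derivative blinfun_apply (f' p)) (at p within quadrant)"
        if "p \<in> quadrant" for p using f'(2)[OF that] .
      show "(\<lambda>x. (x, t)) ` {0..} \<subseteq> quadrant" using xt by (auto simp: quadrant_def)
      show "((\<lambda>x. (x, t)) has_derivative (\<lambda>h. (h, 0))) (at x within {0..})"
        by (auto intro!: derivative_eq_intros)
    qed (use xt in auto)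
    moreover have "(\<lambda>h. blinfun_apply (f' (x, t)) (h, 0)) = (\<lambda>h. h *\<^sub>R blinfun_apply (f' (x, t)) (1, 0))"
      by (rule ext) (simp flip: blinfun.scaleR_right)
    ultimately show "((\<lambda>x. f x t) has_vector_derivative blinfun_apply (f' (x, t)) (1, 0)) (at x within {0..})"
      unfolding has_vector_derivative_def by auto
    have "((\<lambda>t. (\<lambda>(x, t). f x t) (x, t)) has_derivative (\<lambda>h. blinfun_apply (f' (x, t)) (0, h))) (at t within {0..})"
    proof (rule has_derivative_in_compose2[where t = quadrant and g = "\<lambda>(x, t). f x t"
          and g' = "\<lambda>p. blinfun_apply (f' p)" and f = "\<lambda>t. (x, t)" and f' = "\<lambda>h. (0, h)"])
      show "((\<lambda>(x, t). f x t) has_derivative blinfun_apply (f' p)) (at p within quadrant)"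
        if "p \<in> quadrant" for p using f'(2)[OF that] .
      show "(\<lambda>t. (x, t)) ` {0..} \<subseteq> quadrant" using xt by (auto simp: quadrant_def)
      show "((\<lambda>t. (x, t)) has_derivative (\<lambda>h. (0, h))) (at t within {0..})"
        by (auto intro!: derivative_eq_intros)
    qed (use xt in auto)
    moreover have "(\<lambda>h. blinfun_apply (f' (x, t)) (0, h)) = (\<lambda>h. h *\<^sub>R blinfun_apply (f' (x, t)) (0, 1))"
      by (rule ext) (simp flip: blinfun.scaleR_right)
    ultimately show "((\<lambda>t. f x t) has_vector_derivative blinfun_apply (f' (x, t)) (0, 1)) (at t within {0..})"
      unfolding has_vector_derivative_def by auto
  qed
qed

lemma C1_on_lower_triangleI:
  fixes k kx kt :: "real \<Rightarrow> real \<Rightarrow> 'a::real_normed_vector"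
  assumes cont: "continuous_on quadrant (\<lambda>(x, t). kx x t)" "continuous_on quadrant (\<lambda>(x, t). kt x t)"
    and dx: "\<And>x t. 0 \<le> x \<Longrightarrow> 0 \<le> t \<Longrightarrow> ((\<lambda>x. k x t) has_vector_derivative kx x t) (at x within {0..})"
    and dt: "\<And>x t. 0 \<le> x \<Longrightarrow> 0 \<le> t \<Longrightarrow> ((\<lambda>t. k x t) has_vector_derivative kt x t) (at t within {0..})"
  shows "C1_on lower_triangle k"
proof -
  have sub: "lower_triangle \<subseteq> quadrant" by (auto simp: lower_triangle_def quadrant_def)
  define k' :: "real \<times> real \<Rightarrow> (real \<times> real) \<Rightarrow>\<^sub>L 'a" where
    "k' p = Blinfun (\<lambda>(h, j). h *\<^sub>R kx (fst p) (snd p) + j *\<^sub>R kt (fst p) (snd p))" for p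
  have "bounded_linear (\<lambda>(h, j). h *\<^sub>R a + j *\<^sub>R b)" for a b :: 'a
    unfolding case_prod_unfold
    by (intro bounded_linear_add bounded_linear_scaleR_const bounded_linear_fst bounded_linear_snd)
  then have k': "blinfun_apply (k' p) = (\<lambda>(h, j). h *\<^sub>R kx (fst p) (snd p) + j *\<^sub>R kt (fst p) (snd p))" for p
    unfolding k'_def by (subst bounded_linear_Blinfun_apply) auto
  have "continuous_on quadrant k'"
  proof (rule continuous_on_blinfun_componentwise)
    fix i :: "real \<times> real"
    show "continuous_on quadrant (\<lambda>p. blinfun_apply (k' p) i)"
      using cont by (auto simp: k' case_prod_unfold intro!: continuous_intros)
  qed
  moreover have "((\<lambda>(x, t). k x t) has_derivative blinfun_apply (k' p)) (at p within quadrant)"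
    if p: "p \<in> quadrant" for p
  proof -
    obtain x t where xt: "p = (x, t)" "0 \<le> x" "0 \<le> t" using p by (auto simp: quadrant_def)
    have kt': "continuous_on quadrant (\<lambda>(x, t). blinfun_scaleR_left (kt x t))"
      using bounded_linear.continuous_on[OF bounded_linear_blinfun_scaleR_left cont(2)]
      by (simp add: case_prod_unfold)
    have "((\<lambda>(x, t). k x t) has_derivative (\<lambda>(h, j). h *\<^sub>R kx x t + blinfun_apply (blinfun_scaleR_left (kt x t)) j))
        (at (x, t) within {0..} \<times> {0..})"
    proof (rule has_derivative_partialsI)
      show "((\<lambda>x. k x t) has_derivative (\<lambda>h. h *\<^sub>R kx x t)) (at x within {0..})"
        using dx[OF xt(2,3)] by (simp add: has_vector_derivative_def)
      show "((\<lambda>t. k x t) has_derivative blinfun_apply (blinfun_scaleR_left (kt x t))) (at t within {0..})"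
        if "x \<in> {0..}" "t \<in> {0..}" for x t
        using dt[of x t] that by (simp add: has_vector_derivative_def)
      show "continuous (at (x, t) within {0..} \<times> {0..}) (\<lambda>(x, t). blinfun_scaleR_left (kt x t))"
        using kt' p xt unfolding continuous_on_eq_continuous_within quadrant_def by auto
    qed (use xt in auto)
    then show ?thesis by (simp add: xt k' quadrant_def case_prod_unfold)
  qed
  ultimately show ?thesis
    unfolding C1_on_def using sub continuous_on_subset has_derivative_subset by (metis subsetD)
qed

context injective_kernel
begin

lemma gl_exists:
  assumes x: "x \<in> {0..X}" and f: "continuous_on {0..X} f"
  shows "\<exists>k. continuous_on {0..X} k \<and> (\<forall>t\<in>{0..X}. k t + integral {0..x} (\<lambda>s. mul (k s) (F s t)) = f t)"
proof -
  have X: "0 \<le> X" using x by auto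
  define pr where "pr t = max 0 (min X t)" for t
  have pr: "pr t \<in> {0..X}" "0 \<le> pr t" for t using X by (auto simp: pr_def)
  have pr_id: "pr t = t" if "t \<in> {0..X}" for t using that by (auto simp: pr_def)
  have cpr: "continuous_on S pr" for S unfolding pr_def by (intro continuous_intros)
  have ext: "(\<lambda>t. g (pr t)) \<in> bcontfun" if "continuous_on {0..X} g" for g :: "real \<Rightarrow> 'a"
  proof -
    have "continuous_on UNIV (\<lambda>t. g (pr t))"
      by (rule continuous_on_compose2[OF that cpr]) (use pr in auto)
    moreover have "bounded (g ` {0..X})"
      using that by (intro compact_imp_bounded compact_continuous_image) auto
    then have "bounded (range (\<lambda>t. g (pr t)))" by (rule bounded_subset) (use pr in auto)
    ultimately show ?thesis by (simp add: bcontfun_def)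
  qed
  define J where "J x k t = integral {0..x} (\<lambda>s. mul (apply_bcontfun k s) (F s t))" for x t and k :: "real \<Rightarrow>\<^sub>C 'a"
  define A where "A x k = Bcontfun (\<lambda>t. J x k (pr t))" for x and k :: "real \<Rightarrow>\<^sub>C 'a"
  have A: "apply_bcontfun (A x k) t = J x k (pr t)" for x k t
  proof -
    have "continuous_on {0..X} (J x k)" unfolding J_def
      by (rule continuous_on_subset[OF integral_continuous_t]) auto
    then show ?thesis unfolding A_def by (subst Bcontfun_inverse) (auto intro: ext)
  qed
  obtain K where K: "0 < K" "\<And>a b. norm (mul a b) \<le> norm a * norm b * K" using pos_bounded by blast
  obtain mF where mF: "0 < mF" "\<And>s t. s \<in> {0..X} \<Longrightarrow> t \<in> {0..X} \<Longrightarrow> norm (F s t) \<le> mF"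
    using F_bound[of X] by blast
  obtain C where C: "0 < C" "\<And>x k M t. x \<in> {0..X} \<Longrightarrow> continuous_on {0..X} k \<Longrightarrow>
    (\<And>t. t \<in> {0..X} \<Longrightarrow> norm (k t + integral {0..x} (\<lambda>s. mul (k s) (F s t))) \<le> M) \<Longrightarrow>
    t \<in> {0..X} \<Longrightarrow> norm (k t) \<le> C * M" using gl_lower_bound[OF X] by blast
  have int: "(\<lambda>s. mul (apply_bcontfun k s) (F s (pr t))) integrable_on {0..y}" for k t y
    using pr by (intro integrand_integrable) auto
  have "\<exists>k. k + A x k = Bcontfun (\<lambda>t. f (pr t))"
  proof (rule continuity_method[where A = A and x = x and X = X and M = "K * mF" and C = "2 + C"])
    fix y assume y: "y \<in> {0..X}"
    show "linear (A y)"
    proof (rule linearI)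
      show "A y (k + k') = A y k + A y k'" for k k'
        by (rule bcontfun_eqI) (simp add: A J_def plus_bcontfun.rep_eq add_left integral_add int)
      show "A y (r *\<^sub>R k) = r *\<^sub>R A y k" for r k
        by (rule bcontfun_eqI) (simp add: A J_def scaleR_bcontfun.rep_eq scaleR_left)
    qed
    show "norm k \<le> (2 + C) * norm (k + A y k)" for k
    proof (rule norm_bound)
      fix t
      have 1: "norm (apply_bcontfun k t) \<le> C * norm (k + A y k)" if "t \<in> {0..X}" for t
      proof (rule C(2)[OF y])
        fix t assume "t \<in> {0..X}"
        then have "apply_bcontfun k t + integral {0..y} (\<lambda>s. mul (apply_bcontfun k s) (F s t))
            = apply_bcontfun (k + A y k) t" by (simp add: plus_bcontfun.rep_eq A J_def pr_id)
        then show "norm (apply_bcontfun k t + integral {0..y} (\<lambda>s. mul (apply_bcontfun k s) (F s t)))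
            \<le> norm (k + A y k)" by (metis norm_bounded)
      qed (use that in auto)
      have 2: "apply_bcontfun k t = apply_bcontfun (k + A y k) t
          - (apply_bcontfun (k + A y k) (pr t) - apply_bcontfun k (pr t))"
        using pr_id[OF pr(1), of t] by (simp add: plus_bcontfun.rep_eq A)
      have "norm (apply_bcontfun k t) \<le> norm (apply_bcontfun (k + A y k) t) +
          (norm (apply_bcontfun (k + A y k) (pr t)) + norm (apply_bcontfun k (pr t)))"
        by (subst 2) (meson norm_triangle_ineq4 order_trans add_left_mono)
      also have "\<dots> \<le> norm (k + A y k) + (norm (k + A y k) + C * norm (k + A y k))"
        by (intro add_mono norm_bounded 1 pr)
      finally show "norm (apply_bcontfun k t) \<le> (2 + C) * norm (k + A y k)" by (simp add: algebra_simps)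
    qed
    show "norm (A y k - A z k) \<le> K * mF * \<bar>y - z\<bar> * norm k" if z: "z \<in> {0..X}" for z k
    proof (rule norm_bound)
      fix t
      have "norm (integral {0..y} (\<lambda>s. mul (apply_bcontfun k s) (F s (pr t)))
          - integral {0..z} (\<lambda>s. mul (apply_bcontfun k s) (F s (pr t))) - (y - z) *\<^sub>R 0) \<le> (norm k * mF * K) * \<bar>y - z\<bar>"
      proof (rule integral_increment_bound[OF _ y z])
        show "continuous_on {0..X} (\<lambda>s. mul (apply_bcontfun k s) (F s (pr t)))"
          using pr by (intro cont_integrand) auto
        fix s assume "s \<in> {min y z..max y z}"
        then have s: "s \<in> {0..X}" using y z by auto
        have "norm (mul (apply_bcontfun k s) (F s (pr t))) \<le> norm (apply_bcontfun k s) * norm (F s (pr t)) * K"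
          by (rule K)
        also have "\<dots> \<le> norm k * mF * K"
          using K(1) mF(1) mF(2)[OF s pr(1), of t] by (intro mult_right_mono mult_mono norm_bounded) auto
        finally show "norm (mul (apply_bcontfun k s) (F s (pr t)) - 0) \<le> norm k * mF * K" by simp
      qed
      then show "norm (apply_bcontfun (A y k - A z k) t) \<le> K * mF * \<bar>y - z\<bar> * norm k"
        by (simp add: minus_bcontfun.rep_eq A J_def mult_ac)
    qed
  next
    show "A 0 k = 0" for k by (rule bcontfun_eqI) (simp add: A J_def)
  qed fact
  then obtain k where k: "k + A x k = Bcontfun (\<lambda>t. f (pr t))" by blast
  have "apply_bcontfun k t + integral {0..x} (\<lambda>s. mul (apply_bcontfun k s) (F s t)) = f t" if "t \<in> {0..X}" for t
  proof -
    have "apply_bcontfun (k + A x k) t = f (pr t)" unfolding k by (subst Bcontfun_inverse) (auto intro: ext f)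
    then show ?thesis using that by (simp add: plus_bcontfun.rep_eq A J_def pr_id)
  qed
  then show ?thesis by (intro exI[of _ "apply_bcontfun k"]) auto
qed

text \<open>
  The equation is imposed for all \<open>t \<ge> 0\<close>, also beyond \<open>t = x\<close>, where it just defines \<open>k x t\<close>. On the quadrant
  the partial derivatives can be treated separately, without a special role of the diagonal.
\<close>

definition solves :: "(real \<Rightarrow> real \<Rightarrow> 'a) \<Rightarrow> (real \<Rightarrow> real \<Rightarrow> 'a) \<Rightarrow> bool" where
  "solves f k \<longleftrightarrow> (\<forall>x\<ge>0. continuous_on {0..} (k x) \<and>
     (\<forall>t\<ge>0. k x t + integral {0..x} (\<lambda>s. mul (k x s) (F s t)) = f x t))"

lemma solves_exists:
  assumes f: "continuous_on quadrant (\<lambda>(x, t). f x t)"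
  obtains k where "solves f k"
proof -
  have fx: "continuous_on {0..} (f x)" if "0 \<le> x" for x
  proof -
    have "continuous_on {0..} (\<lambda>t. (\<lambda>(x, t). f x t) (x, t))"
      by (rule continuous_on_compose2[OF f]) (use that in \<open>auto simp: quadrant_def intro!: continuous_intros\<close>)
    then show ?thesis by simp
  qed
  have "\<exists>k. continuous_on {0..} k \<and> (\<forall>t\<ge>0. k t + integral {0..x} (\<lambda>s. mul (k s) (F s t)) = f x t)"
    if x: "0 \<le> x" for x
  proof -
    obtain k where k: "continuous_on {0..x} k"
      "\<And>t. t \<in> {0..x} \<Longrightarrow> k t + integral {0..x} (\<lambda>s. mul (k s) (F s t)) = f x t"
      using gl_exists[of x x "f x"] continuous_on_subset[OF fx[OF x], of "{0..x}"] x by auto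
    define k' where "k' t = f x t - integral {0..x} (\<lambda>s. mul (k s) (F s t))" for t
    have eq: "k' s = k s" if "s \<in> {0..x}" for s using k(2)[OF that] by (simp add: k'_def algebra_simps)
    have "integral {0..x} (\<lambda>s. mul (k' s) (F s t)) = integral {0..x} (\<lambda>s. mul (k s) (F s t))" for t
      by (rule integral_cong) (simp add: eq)
    moreover have "continuous_on {0..} k'" unfolding k'_def
      by (intro continuous_on_diff fx x integral_continuous_t k)
    ultimately show ?thesis by (intro exI[of _ k']) (simp add: k'_def)
  qed
  then obtain k where "\<And>x. 0 \<le> x \<Longrightarrow> continuous_on {0..} (k x) \<and> (\<forall>t\<ge>0. k x t + integral {0..x} (\<lambda>s. mul (k x s) (F s t)) = f x t)"
    by metis
  then show ?thesis using that[of k] unfolding solves_def by blast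
qed

text \<open>
  The second bound is used with \<open>c = 0\<close> for continuity and with \<open>c = x - y\<close> for differentiability, where \<open>j\<close> is the
  candidate for the derivative.
\<close>

lemma solves_bounds:
  assumes k: "solves f k" and X: "0 \<le> X"
  obtains C where "0 < C"
    "\<And>x m t. x \<in> {0..X} \<Longrightarrow> (\<And>t. t \<in> {0..X} \<Longrightarrow> norm (f x t) \<le> m) \<Longrightarrow> t \<in> {0..X} \<Longrightarrow> norm (k x t) \<le> C * m"
    "\<And>x y c j e t. x \<in> {0..X} \<Longrightarrow> y \<in> {0..X} \<Longrightarrow> continuous_on {0..X} j \<Longrightarrow>
      (\<And>t. t \<in> {0..X} \<Longrightarrow> norm (f x t - f y t - (integral {0..x} (\<lambda>s. mul (k x s) (F s t)) - integral {0..y} (\<lambda>s. mul (k x s) (F s t)))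
         - c *\<^sub>R (j t + integral {0..y} (\<lambda>s. mul (j s) (F s t)))) \<le> e) \<Longrightarrow>
      t \<in> {0..X} \<Longrightarrow> norm (k x t - k y t - c *\<^sub>R j t) \<le> C * e"
proof -
  obtain C where C: "0 < C" "\<And>x k M t. x \<in> {0..X} \<Longrightarrow> continuous_on {0..X} k \<Longrightarrow>
    (\<And>t. t \<in> {0..X} \<Longrightarrow> norm (k t + integral {0..x} (\<lambda>s. mul (k s) (F s t))) \<le> M) \<Longrightarrow>
    t \<in> {0..X} \<Longrightarrow> norm (k t) \<le> C * M" using gl_lower_bound[OF X] by blast
  have kc: "continuous_on {0..y} (k x)" if "0 \<le> x" for x y
    using k that continuous_on_subset[of "{0..}" "k x" "{0..y}"] unfolding solves_def by auto
  have ke: "k x t + integral {0..x} (\<lambda>s. mul (k x s) (F s t)) = f x t" if "0 \<le> x" "0 \<le> t" for x t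
    using k that unfolding solves_def by blast
  show ?thesis
  proof (rule that[OF C(1)])
    fix x m t assume "x \<in> {0..X}" "\<And>t. t \<in> {0..X} \<Longrightarrow> norm (f x t) \<le> m" "t \<in> {0..X}"
    then show "norm (k x t) \<le> C * m" by (intro C(2)[of x "k x"] kc) (auto simp: ke)
  next
    fix x y c j e t
    assume x: "x \<in> {0..X}" and y: "y \<in> {0..X}" and j: "continuous_on {0..X} j" and t: "t \<in> {0..X}"
      and b: "\<And>t. t \<in> {0..X} \<Longrightarrow> norm (f x t - f y t - (integral {0..x} (\<lambda>s. mul (k x s) (F s t)) - integral {0..y} (\<lambda>s. mul (k x s) (F s t)))
         - c *\<^sub>R (j t + integral {0..y} (\<lambda>s. mul (j s) (F s t)))) \<le> e"
    show "norm (k x t - k y t - c *\<^sub>R j t) \<le> C * e"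
    proof (rule C(2)[OF y, of "\<lambda>t. k x t - k y t - c *\<^sub>R j t"])
      show "continuous_on {0..X} (\<lambda>t. k x t - k y t - c *\<^sub>R j t)"
        using x y by (intro continuous_intros kc j) auto
      fix t assume t: "t \<in> {0..X}"
      have jy: "continuous_on {0..y} j" using continuous_on_subset[OF j] y by auto
      have i: "(\<lambda>s. mul (g s) (F s t)) integrable_on {0..y}" if "continuous_on {0..y} g" for g
        using t y that by (intro integrand_integrable) auto
      have "integral {0..y} (\<lambda>s. mul (k x s - k y s - c *\<^sub>R j s) (F s t))
        = integral {0..y} (\<lambda>s. mul (k x s) (F s t)) - integral {0..y} (\<lambda>s. mul (k y s) (F s t))
          - c *\<^sub>R integral {0..y} (\<lambda>s. mul (j s) (F s t))"
        using x y i[OF kc, of x] i[OF kc, of y] i[OF jy]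
        by (simp add: diff_left scaleR_left integral_diff integrable_diff integrable_cmul)
      then have id: "k x t - k y t - c *\<^sub>R j t + integral {0..y} (\<lambda>s. mul (k x s - k y s - c *\<^sub>R j s) (F s t))
         = (k x t + integral {0..x} (\<lambda>s. mul (k x s) (F s t))) - (k y t + integral {0..y} (\<lambda>s. mul (k y s) (F s t)))
           - (integral {0..x} (\<lambda>s. mul (k x s) (F s t)) - integral {0..y} (\<lambda>s. mul (k x s) (F s t)))
           - c *\<^sub>R (j t + integral {0..y} (\<lambda>s. mul (j s) (F s t)))"
        by (simp only: scaleR_add_right) simp
      then have "k x t - k y t - c *\<^sub>R j t + integral {0..y} (\<lambda>s. mul (k x s - k y s - c *\<^sub>R j s) (F s t))
         = f x t - f y t - (integral {0..x} (\<lambda>s. mul (k x s) (F s t)) - integral {0..y} (\<lambda>s. mul (k x s) (F s t)))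
         - c *\<^sub>R (j t + integral {0..y} (\<lambda>s. mul (j s) (F s t)))"
        using ke[of x t] ke[of y t] x y t by (simp only: id atLeastAtMost_iff)
      then show "norm (k x t - k y t - c *\<^sub>R j t + integral {0..y} (\<lambda>s. mul (k x s - k y s - c *\<^sub>R j s) (F s t))) \<le> e"
        using b[OF t] by simp
    qed fact
  qed
qed

lemma solves_continuous:
  assumes f: "continuous_on quadrant (\<lambda>(x, t). f x t)" and k: "solves f k"
  shows "continuous_on quadrant (\<lambda>(x, t). k x t)"
  unfolding continuous_on_quadrant_iff_squares
proof
  fix X :: real
  show "continuous_on ({0..X} \<times> {0..X}) (\<lambda>(x, t). k x t)"
  proof (cases "0 \<le> X")
    case False
    then show ?thesis by simp
  next
    case X: True
    obtain K where K: "0 < K" "\<And>a b. norm (mul a b) \<le> norm a * norm b * K" using pos_bounded by blast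
    obtain mF where mF: "0 < mF" "\<And>s t. s \<in> {0..X} \<Longrightarrow> t \<in> {0..X} \<Longrightarrow> norm (F s t) \<le> mF"
      using F_bound[of X] by blast
    have fsq: "continuous_on ({0..X} \<times> {0..X}) (\<lambda>(x, t). f x t)"
      using f continuous_on_quadrant_iff_squares by blast
    then have "bounded ((\<lambda>(x, t). f x t) ` ({0..X} \<times> {0..X}))"
      by (intro compact_imp_bounded compact_continuous_image compact_Times) auto
    then obtain mf where mf: "0 < mf" "\<And>x t. x \<in> {0..X} \<Longrightarrow> t \<in> {0..X} \<Longrightarrow> norm (f x t) \<le> mf"
      unfolding bounded_pos by fastforce
    obtain C where C: "0 < C"
     "\<And>x m t. x \<in> {0..X} \<Longrightarrow> (\<And>t. t \<in> {0..X} \<Longrightarrow> norm (f x t) \<le> m) \<Longrightarrow> t \<in> {0..X} \<Longrightarrow> norm (k x t) \<le> C * m"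
     "\<And>x y c j e t. x \<in> {0..X} \<Longrightarrow> y \<in> {0..X} \<Longrightarrow> continuous_on {0..X} j \<Longrightarrow>
      (\<And>t. t \<in> {0..X} \<Longrightarrow> norm (f x t - f y t - (integral {0..x} (\<lambda>s. mul (k x s) (F s t)) - integral {0..y} (\<lambda>s. mul (k x s) (F s t)))
         - c *\<^sub>R (j t + integral {0..y} (\<lambda>s. mul (j s) (F s t)))) \<le> e) \<Longrightarrow>
      t \<in> {0..X} \<Longrightarrow> norm (k x t - k y t - c *\<^sub>R j t) \<le> C * e"
      using solves_bounds[OF k X] by blast
    have kb: "norm (k x t) \<le> C * mf" if "x \<in> {0..X}" "t \<in> {0..X}" for x t
      by (rule C(2)) (use that mf in auto)
    define L where "L = C * mf * mF * K"
    have L: "0 < L" unfolding L_def using C(1) mf(1) mF(1) K(1) by simp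
    have diff: "norm (k x t - k y t) \<le> C * (e + L * \<bar>x - y\<bar>)"
      if x: "x \<in> {0..X}" and y: "y \<in> {0..X}" and t: "t \<in> {0..X}"
        and e: "\<And>t. t \<in> {0..X} \<Longrightarrow> norm (f x t - f y t) \<le> e" for x y t e
    proof -
      have kx: "continuous_on {0..X} (k x)"
        using k x continuous_on_subset[of "{0..}" "k x" "{0..X}"] unfolding solves_def by auto
      have "norm (k x t - k y t - 0 *\<^sub>R (0::'a)) \<le> C * (e + L * \<bar>x - y\<bar>)"
      proof (rule C(3)[OF x y _ _ t])
        fix t assume t: "t \<in> {0..X}"
        have "norm (integral {0..x} (\<lambda>s. mul (k x s) (F s t)) - integral {0..y} (\<lambda>s. mul (k x s) (F s t)) - (x - y) *\<^sub>R 0) \<le> L * \<bar>x - y\<bar>"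
        proof (rule integral_increment_bound[OF _ x y])
          show "continuous_on {0..X} (\<lambda>s. mul (k x s) (F s t))"
            using t kx by (intro cont_integrand) auto
          fix s assume "s \<in> {min x y..max x y}"
          then have s: "s \<in> {0..X}" using x y by auto
          have "norm (mul (k x s) (F s t)) \<le> norm (k x s) * norm (F s t) * K" by (rule K)
          also have "\<dots> \<le> (C * mf) * mF * K"
            using kb[OF x s] K(1) C(1) mf(1) mF(1) mF(2)[OF s t] by (intro mult_right_mono mult_mono) auto
          finally show "norm (mul (k x s) (F s t) - 0) \<le> L" by (simp add: L_def)
        qed
        then show "norm (f x t - f y t - (integral {0..x} (\<lambda>s. mul (k x s) (F s t)) - integral {0..y} (\<lambda>s. mul (k x s) (F s t)))
         - 0 *\<^sub>R (0 + integral {0..y} (\<lambda>s. mul 0 (F s t)))) \<le> e + L * \<bar>x - y\<bar>"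
          using e[OF t] norm_triangle_le_diff[of "f x t - f y t" "integral {0..x} (\<lambda>s. mul (k x s) (F s t)) - integral {0..y} (\<lambda>s. mul (k x s) (F s t))" "e + L * \<bar>x - y\<bar>"]
          by simp
      qed auto
      then show ?thesis by simp
    qed
    show ?thesis unfolding continuous_on_iff
    proof (intro ballI allI impI)
      fix p e assume p: "p \<in> {0..X} \<times> {0..X}" and e: "0 < (e::real)"
      obtain y u where pu: "p = (y, u)" "y \<in> {0..X}" "u \<in> {0..X}" using p by auto
      have "uniformly_continuous_on ({0..X} \<times> {0..X}) (\<lambda>(x, t). f x t)"
        by (intro compact_uniformly_continuous fsq compact_Times) auto
      moreover have "0 < e / (4 * C)" using e C(1) by simp
      ultimately obtain d1 where d1: "d1 > 0"
        "\<And>p q. p \<in> {0..X} \<times> {0..X} \<Longrightarrow> q \<in> {0..X} \<times> {0..X} \<Longrightarrow> dist q p < d1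
          \<Longrightarrow> dist ((\<lambda>(x, t). f x t) q) ((\<lambda>(x, t). f x t) p) < e / (4 * C)"
        unfolding uniformly_continuous_on_def by metis
      have "continuous_on {0..X} (k y)"
        using k pu continuous_on_subset[of "{0..}" "k y" "{0..X}"] unfolding solves_def by auto
      then obtain d2 where d2: "d2 > 0" "\<And>t. t \<in> {0..X} \<Longrightarrow> dist t u < d2 \<Longrightarrow> dist (k y t) (k y u) < e / 4"
        unfolding continuous_on_iff using e pu(3) by (metis zero_less_divide_iff zero_less_numeral)
      define d where "d = min (min d1 d2) (e / (4 * C * L))"
      have d: "d > 0" using d1 d2 e C(1) L by (simp add: d_def)
      have "dist (k x t) (k y u) < e" if x: "x \<in> {0..X}" and t: "t \<in> {0..X}" and D: "dist (x, t) p < d" for x t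
      proof -
        have D1: "\<bar>x - y\<bar> < d" using dist_fst_le[of "(x, t)" p] D pu(1) by (simp add: dist_real_def)
        have D2: "dist t u < d" using dist_snd_le[of "(x, t)" p] D pu(1) by simp
        have "norm (k x t - k y t) \<le> C * (e / (4 * C) + L * \<bar>x - y\<bar>)"
        proof (rule diff[OF x pu(2) t])
          fix t assume "t \<in> {0..X}"
          then show "norm (f x t - f y t) \<le> e / (4 * C)"
            using d1(2)[of "(y, t)" "(x, t)"] x pu(2) D1 by (simp add: dist_Pair_Pair dist_norm d_def less_imp_le)
        qed
        also have "\<dots> = e / 4 + C * L * \<bar>x - y\<bar>" using C(1) by (simp add: field_simps)
        also have "\<dots> \<le> e / 4 + C * L * (e / (4 * C * L))"
          using D1 C(1) L by (intro add_left_mono mult_left_mono) (auto simp: d_def)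
        also have "\<dots> = e / 2" using C(1) L by simp
        finally have "dist (k x t) (k y t) \<le> e / 2" by (simp add: dist_norm)
        moreover have "dist (k y t) (k y u) < e / 4" using d2(2)[OF t] D2 by (simp add: d_def)
        ultimately show ?thesis using dist_triangle[of "k x t" "k y u" "k y t"] e by linarith
      qed
      then show "\<exists>d>0. \<forall>q\<in>{0..X} \<times> {0..X}. dist q p < d \<longrightarrow> dist ((\<lambda>(x, t). k x t) q) ((\<lambda>(x, t). k x t) p) < e"
        using d pu(1) by (intro exI[of _ d]) auto
    qed
  qed
qed

lemma solves_derivative_x:
  assumes f: "\<And>x t. 0 \<le> x \<Longrightarrow> 0 \<le> t \<Longrightarrow> ((\<lambda>x. f x t) has_vector_derivative fx x t) (at x within {0..})"
    and fc: "continuous_on quadrant (\<lambda>(x, t). f x t)"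
    and fx: "continuous_on quadrant (\<lambda>(x, t). fx x t)"
    and k: "solves f k" and j: "solves (\<lambda>x t. fx x t - mul (k x x) (F x t)) j"
    and x: "0 \<le> y" and t: "0 \<le> u"
  shows "((\<lambda>x. k x u) has_vector_derivative j y u) (at y within {0..})"
  unfolding has_vector_derivative_def has_derivative_within_alt
proof (intro conjI allI impI)
  show "bounded_linear (\<lambda>x. x *\<^sub>R j y u)" by (rule bounded_linear_scaleR_left)
  fix e :: real assume e: "0 < e"
  define X where "X = max y u + 1"
  have X: "0 \<le> X" "y \<in> {0..X}" "u \<in> {0..X}" using x t by (auto simp: X_def)
  have kc: "continuous_on quadrant (\<lambda>(x, t). k x t)" by (rule solves_continuous[OF fc k])
  obtain C where C: "0 < C"
     "\<And>x m t. x \<in> {0..X} \<Longrightarrow> (\<And>t. t \<in> {0..X} \<Longrightarrow> norm (f x t) \<le> m) \<Longrightarrow> t \<in> {0..X} \<Longrightarrow> norm (k x t) \<le> C * m"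
     "\<And>x y c j e t. x \<in> {0..X} \<Longrightarrow> y \<in> {0..X} \<Longrightarrow> continuous_on {0..X} j \<Longrightarrow>
      (\<And>t. t \<in> {0..X} \<Longrightarrow> norm (f x t - f y t - (integral {0..x} (\<lambda>s. mul (k x s) (F s t)) - integral {0..y} (\<lambda>s. mul (k x s) (F s t)))
         - c *\<^sub>R (j t + integral {0..y} (\<lambda>s. mul (j s) (F s t)))) \<le> e) \<Longrightarrow>
      t \<in> {0..X} \<Longrightarrow> norm (k x t - k y t - c *\<^sub>R j t) \<le> C * e"
    using solves_bounds[OF k X(1)] by blast
  have cc: "continuous_on S (\<lambda>p. g (a p) (b p))"
    if "continuous_on quadrant (\<lambda>(x, t). g x t)" "continuous_on S a" "continuous_on S b" "\<And>p. p \<in> S \<Longrightarrow> 0 \<le> a p \<and> 0 \<le> b p"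
    for g :: "real \<Rightarrow> real \<Rightarrow> 'a" and S :: "'c::topological_space set" and a b
    using continuous_on_compose2[OF that(1) continuous_on_Pair[OF that(2,3)]] that(4) by (auto simp: quadrant_def)
  define \<psi> where "\<psi> p = fx (fst (snd p)) (snd (snd p)) - mul (k (fst p) (fst (snd p))) (F (fst (snd p)) (snd (snd p)))"
    for p :: "real \<times> real \<times> real"
  have "uniformly_continuous_on ({0..X} \<times> {0..X} \<times> {0..X}) \<psi>" unfolding \<psi>_def
    by (intro compact_uniformly_continuous continuous_on_diff cc[OF fx] cc[OF kc] continuous_on contF_comp compact_Times
         continuous_intros) auto
  moreover have "0 < e / C" using e C(1) by simp
  ultimately obtain d where d: "d > 0"
    "\<And>p q. p \<in> {0..X} \<times> {0..X} \<times> {0..X} \<Longrightarrow> q \<in> {0..X} \<times> {0..X} \<times> {0..X} \<Longrightarrow> dist q p < d \<Longrightarrow> dist (\<psi> q) (\<psi> p) < e / C"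
    unfolding uniformly_continuous_on_def by metis
  have main: "norm (k x u - k y u - (x - y) *\<^sub>R j y u) \<le> e * norm (x - y)"
    if x0: "x \<in> {0..}" and xd: "norm (x - y) < min (d / 2) 1" for x
  proof -
    have xX: "x \<in> {0..X}" using x0 xd x by (auto simp: X_def)
    have "norm (k x u - k y u - (x - y) *\<^sub>R j y u) \<le> C * (e / C * \<bar>x - y\<bar>)"
    proof (rule C(3)[OF xX X(2) _ _ X(3)])
      show "continuous_on {0..X} (j y)"
        using j x continuous_on_subset[of "{0..}" "j y" "{0..X}"] unfolding solves_def by auto
      fix t assume t: "t \<in> {0..X}"
      define h where "h s = fx s t - mul (k x s) (F s t)" for s
      have fxc: "continuous_on {0..z} (\<lambda>s. fx s t)" for z
        using t by (intro cc[OF fx] continuous_intros) auto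
      have kx: "continuous_on {0..z} (k x)" for z
        using x0 by (intro cc[OF kc] continuous_intros) auto
      have increment: "norm (integral {0..x} h - integral {0..y} h - (x - y) *\<^sub>R (fx y t - mul (k y y) (F y t))) \<le> e / C * \<bar>x - y\<bar>"
      proof (rule integral_increment_bound[OF _ xX X(2)])
        show "continuous_on {0..X} h" unfolding h_def
          using t by (intro continuous_on_diff fxc cont_integrand kx) auto
        fix s assume s: "s \<in> {min x y..max x y}"
        then have sX: "s \<in> {0..X}" using xX X(2) by auto
        have "dist (x, s, t) (y, y, t) \<le> \<bar>x - y\<bar> + \<bar>s - y\<bar>"
          by (simp add: dist_Pair_Pair dist_real_def sqrt_sum_squares_le_sum_abs)
        also have "\<dots> < d" using s xd by (auto simp: min_def max_def split: if_splits)
        finally have "dist (\<psi> (x, s, t)) (\<psi> (y, y, t)) < e / C"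
          by (intro d(2)) (use sX t xX X in auto)
        then show "norm (h s - (fx y t - mul (k y y) (F y t))) \<le> e / C"
          by (simp add: \<psi>_def h_def dist_norm)
      qed
      have hz: "integral {0..z} h = f z t - f 0 t - integral {0..z} (\<lambda>s. mul (k x s) (F s t))" if z: "0 \<le> z" for z
      proof -
        have "((\<lambda>s. fx s t) has_integral f z t - f 0 t) {0..z}"
          by (rule fundamental_theorem_of_calculus[OF z], rule has_vector_derivative_within_subset[OF f])
             (use t in auto)
        then have "integral {0..z} (\<lambda>s. fx s t) = f z t - f 0 t" by (rule integral_unique)
        moreover have "integral {0..z} h = integral {0..z} (\<lambda>s. fx s t) - integral {0..z} (\<lambda>s. mul (k x s) (F s t))"
          unfolding h_def by (rule integral_diff) (use t in \<open>auto intro!: integrable_continuous_real fxc cont_integrand kx\<close>)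
        ultimately show ?thesis by simp
      qed
      have "f x t - f y t - (integral {0..x} (\<lambda>s. mul (k x s) (F s t)) - integral {0..y} (\<lambda>s. mul (k x s) (F s t)))
          = integral {0..x} h - integral {0..y} h" using hz[of x] hz[of y] x x0 by simp
      moreover have "j y t + integral {0..y} (\<lambda>s. mul (j y s) (F s t)) = fx y t - mul (k y y) (F y t)"
        using j x t unfolding solves_def by auto
      ultimately show "norm (f x t - f y t - (integral {0..x} (\<lambda>s. mul (k x s) (F s t)) - integral {0..y} (\<lambda>s. mul (k x s) (F s t)))
         - (x - y) *\<^sub>R (j y t + integral {0..y} (\<lambda>s. mul (j y s) (F s t)))) \<le> e / C * \<bar>x - y\<bar>"
        using increment by (simp only:)
    qed
    then show ?thesis using C(1) by simp
  qed
  show "\<exists>d>0. \<forall>x\<in>{0..}. norm (x - y) < d \<longrightarrow> norm (k x u - k y u - (x - y) *\<^sub>R j y u) \<le> e * norm (x - y)"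
    using d(1) main by (intro exI[of _ "min (d / 2) 1"]) auto
qed

lemma solves_derivative_t:
  assumes f: "\<And>x t. 0 \<le> x \<Longrightarrow> 0 \<le> t \<Longrightarrow> ((\<lambda>t. f x t) has_vector_derivative ft x t) (at t within {0..})"
    and dF: "\<And>s t. 0 \<le> s \<Longrightarrow> 0 \<le> t \<Longrightarrow> ((\<lambda>t. F s t) has_vector_derivative Ft s t) (at t within {0..})"
    and Ft: "continuous_on quadrant (\<lambda>(s, t). Ft s t)"
    and k: "solves f k" and x: "0 \<le> x" and t: "0 \<le> t"
  shows "((\<lambda>t. k x t) has_vector_derivative ft x t - integral {0..x} (\<lambda>s. mul (k x s) (Ft s t))) (at t within {0..})"
proof -
  have kx: "continuous_on {0..} (k x)" using k x unfolding solves_def by auto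
  have "((\<lambda>t. integral (cbox 0 x) (\<lambda>s. mul (k x s) (F s t))) has_vector_derivative
      integral (cbox 0 x) (\<lambda>s. mul (k x s) (Ft s t))) (at t within {0..})"
  proof (rule leibniz_rule_vector_derivative)
    fix t s :: real assume "t \<in> {0..}" "s \<in> cbox 0 x"
    then show "((\<lambda>t. mul (k x s) (F s t)) has_vector_derivative mul (k x s) (Ft s t)) (at t within {0..})"
      by (intro bounded_linear.has_vector_derivative[OF bounded_linear_right] dF) auto
  next
    fix t :: real assume "t \<in> {0..}"
    then show "(\<lambda>s. mul (k x s) (F s t)) integrable_on cbox 0 x"
      using continuous_on_subset[OF kx] by (auto intro!: integrand_integrable)
  next
    have "continuous_on ({0..} \<times> cbox 0 x) (\<lambda>p. (\<lambda>(s, t). Ft s t) (snd p, fst p))"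
      by (rule continuous_on_compose2[OF Ft]) (auto simp: quadrant_def intro!: continuous_intros)
    then show "continuous_on ({0..} \<times> cbox 0 x) (\<lambda>(t, s). mul (k x s) (Ft s t))"
      by (auto simp: case_prod_unfold intro!: continuous_on continuous_on_compose2[OF kx] continuous_intros)
  qed (use t in auto)
  then have "((\<lambda>t. f x t - integral {0..x} (\<lambda>s. mul (k x s) (F s t))) has_vector_derivative
      ft x t - integral {0..x} (\<lambda>s. mul (k x s) (Ft s t))) (at t within {0..})"
    using f[OF x t] by (auto intro!: derivative_intros)
  then show ?thesis
  proof (rule has_vector_derivative_transform[rotated 2])
    fix t :: real assume "t \<in> {0..}"
    then show "k x t = f x t - integral {0..x} (\<lambda>s. mul (k x s) (F s t))"
      using k x unfolding solves_def by (simp add: eq_diff_eq)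
  qed (use t in auto)
qed

lemma solves_unique:
  assumes k: "solves f k" and x: "0 < x" and g: "continuous_on {0..x} g"
    and eq: "\<And>t. 0 \<le> t \<Longrightarrow> t < x \<Longrightarrow> g t + integral {0..x} (\<lambda>s. mul (g s) (F s t)) = f x t"
    and t: "t \<in> {0..x}"
  shows "g t = k x t"
proof -
  have kx: "continuous_on {0..x} (k x)"
    using k x continuous_on_subset[of "{0..}" "k x" "{0..x}"] unfolding solves_def by auto
  define d where "d t = g t - k x t" for t
  have d: "continuous_on {0..x} d" unfolding d_def by (intro continuous_on_diff g kx)
  define r where "r t = d t + integral {0..x} (\<lambda>s. mul (d s) (F s t))" for t
  have r: "r t = 0" if "t \<in> {0..<x}" for t
  proof -
    have i: "integral {0..x} (\<lambda>s. mul (d s) (F s t)) = integral {0..x} (\<lambda>s. mul (g s) (F s t)) - integral {0..x} (\<lambda>s. mul (k x s) (F s t))"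
      unfolding d_def diff_left by (rule integral_diff) (use that in \<open>auto intro!: integrand_integrable g kx\<close>)
    have "r t = (g t + integral {0..x} (\<lambda>s. mul (g s) (F s t))) - (k x t + integral {0..x} (\<lambda>s. mul (k x s) (F s t)))"
      unfolding r_def i by (simp add: d_def)
    moreover have "k x t + integral {0..x} (\<lambda>s. mul (k x s) (F s t)) = f x t"
      using k x that unfolding solves_def by auto
    ultimately show ?thesis using eq[of t] that by auto
  qed
  have "continuous_on {0..x} r" unfolding r_def
    by (intro continuous_on_add d continuous_on_subset[OF integral_continuous_t[OF d]]) auto
  then have "continuous_on (closure {0..<x}) r" using x by simp
  then have "r t = 0" if "t \<in> {0..x}" for t
    by (rule continuous_constant_on_closure) (use r that x in auto)
  then have "d t = 0" if "t \<in> {0..x}" for t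
    using inj[of x d t] d x that unfolding r_def by auto
  from this[OF t] show ?thesis by (simp add: d_def)
qed

theorem triangle_solution:
  assumes f: "continuous_on quadrant (\<lambda>(x, t). f x t)"
  obtains k where "continuous_on lower_triangle (\<lambda>(x, t). k x t)"
    "\<And>x t. 0 \<le> t \<Longrightarrow> t < x \<Longrightarrow> k x t + integral {0..x} (\<lambda>s. mul (k x s) (F s t)) = f x t"
    "\<And>g x t. continuous_on lower_triangle (\<lambda>(x, t). g x t) \<Longrightarrow>
      (\<And>x t. 0 \<le> t \<Longrightarrow> t < x \<Longrightarrow> g x t + integral {0..x} (\<lambda>s. mul (g x s) (F s t)) = f x t) \<Longrightarrow>
      (x, t) \<in> lower_triangle \<Longrightarrow> g x t = k x t"
    "C1_on quadrant F \<Longrightarrow> C1_on quadrant f \<Longrightarrow> C1_on lower_triangle k"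
proof -
  obtain k where k: "solves f k" using solves_exists[OF f] .
  have kc: "continuous_on quadrant (\<lambda>(x, t). k x t)" by (rule solves_continuous[OF f k])
  have sub: "lower_triangle \<subseteq> quadrant" by (auto simp: lower_triangle_def quadrant_def)
  show ?thesis
  proof (rule that)
    show kt: "continuous_on lower_triangle (\<lambda>(x, t). k x t)" by (rule continuous_on_subset[OF kc sub])
    show "k x t + integral {0..x} (\<lambda>s. mul (k x s) (F s t)) = f x t" if "0 \<le> t" "t < x" for x t
      using k that unfolding solves_def by auto
    fix g x t
    assume g: "continuous_on lower_triangle (\<lambda>(x, t). g x t)"
      and eq: "\<And>x t. 0 \<le> t \<Longrightarrow> t < x \<Longrightarrow> g x t + integral {0..x} (\<lambda>s. mul (g x s) (F s t)) = f x t"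
      and xt: "(x, t) \<in> lower_triangle"
    have pos: "g x t = k x t" if "(x, t) \<in> lower_triangle" "0 < x" for x t
    proof (rule solves_unique[OF k \<open>0 < x\<close>])
      have "continuous_on {0..x} (\<lambda>s. (\<lambda>(x, t). g x t) (x, s))"
        by (rule continuous_on_compose2[OF g]) (auto simp: lower_triangle_def intro!: continuous_intros)
      then show "continuous_on {0..x} (g x)" by simp
    qed (use eq that in \<open>auto simp: lower_triangle_def\<close>)
    show "g x t = k x t"
    proof (cases "0 < x")
      case True
      then show ?thesis using pos xt by blast
    next
      case False
      then have 0: "x = 0" "t = 0" using xt by (auto simp: lower_triangle_def)
      have "continuous_on {0..1} (\<lambda>x. (\<lambda>(x, t). g x t) (x, 0) - (\<lambda>(x, t). k x t) (x, 0))"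
        by (intro continuous_on_diff continuous_on_compose2[OF g] continuous_on_compose2[OF kt])
           (auto simp: lower_triangle_def intro!: continuous_intros)
      then have "continuous_on (closure {0<..<1}) (\<lambda>x. g x 0 - k x 0)" by simp
      then have "g 0 0 - k 0 0 = 0"
        by (rule continuous_constant_on_closure) (use pos in \<open>auto simp: lower_triangle_def\<close>)
      then show ?thesis by (simp add: 0)
    qed
  next
    assume F1: "C1_on quadrant F" and f1: "C1_on quadrant f"
    obtain fx ft where fx: "continuous_on quadrant (\<lambda>(x, t). fx x t)" "continuous_on quadrant (\<lambda>(x, t). ft x t)"
      "\<And>x t. 0 \<le> x \<Longrightarrow> 0 \<le> t \<Longrightarrow> ((\<lambda>x. f x t) has_vector_derivative fx x t) (at x within {0..})"
      "\<And>x t. 0 \<le> x \<Longrightarrow> 0 \<le> t \<Longrightarrow> ((\<lambda>t. f x t) has_vector_derivative ft x t) (at t within {0..})"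
      using C1_on_quadrant_partials[OF f1] by blast
    obtain Fx Ft where "continuous_on quadrant (\<lambda>(x, t). Fx x t)" and Ft: "continuous_on quadrant (\<lambda>(x, t). Ft x t)"
      and "\<And>x t. 0 \<le> x \<Longrightarrow> 0 \<le> t \<Longrightarrow> ((\<lambda>x. F x t) has_vector_derivative Fx x t) (at x within {0..})"
      and dF:
      "\<And>x t. 0 \<le> x \<Longrightarrow> 0 \<le> t \<Longrightarrow> ((\<lambda>t. F x t) has_vector_derivative Ft x t) (at t within {0..})"
      using C1_on_quadrant_partials[OF F1] by blast
    have "continuous_on quadrant (\<lambda>p. (\<lambda>(x, t). k x t) (fst p, fst p))"
      by (rule continuous_on_compose2[OF kc]) (auto simp: quadrant_def intro!: continuous_intros)
    then have rc: "continuous_on quadrant (\<lambda>(x, t). fx x t - mul (k x x) (F x t))"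
      using fx(1) contF by (auto simp: case_prod_unfold intro!: continuous_on_diff continuous_on)
    obtain j where j: "solves (\<lambda>x t. fx x t - mul (k x x) (F x t)) j" using solves_exists[OF rc] .
    have "continuous_on ({0..} \<times> {0..} \<times> {0..}) (\<lambda>p. mul ((\<lambda>(x, t). k x t) (fst p, fst (snd p)))
        ((\<lambda>(x, t). Ft x t) (fst (snd p), snd (snd p))))"
      by (intro continuous_on continuous_on_compose2[OF kc] continuous_on_compose2[OF Ft] continuous_intros)
         (auto simp: quadrant_def)
    then have "continuous_on quadrant (\<lambda>(x, t). integral {0..x} (\<lambda>s. mul (k x s) (Ft s t)))"
      by (intro continuous_on_variable_integral) (simp add: case_prod_unfold)
    then have "continuous_on quadrant (\<lambda>(x, t). ft x t - integral {0..x} (\<lambda>s. mul (k x s) (Ft s t)))"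
      using fx(2) by (auto simp: case_prod_unfold intro!: continuous_on_diff)
    then show "C1_on lower_triangle k"
      by (rule C1_on_lower_triangleI[OF solves_continuous[OF rc j]])
         (intro solves_derivative_x[OF fx(3) f fx(1) k j] solves_derivative_t[OF fx(4) dF Ft k]; assumption)+
  qed
qed

end

section \<open>Fourier integrals and eigenrows\<close>

lemma has_bochner_integral_one_minus_cos:
  "has_bochner_integral lborel (\<lambda>l. (1 - cos (a * l)) / l\<^sup>2) (pi * \<bar>a\<bar>)"
proof (cases "a = 0")
  case True
  then show ?thesis by (simp add: has_bochner_integral_zero)
next
  case a: False
  define f where "f x = (1 - cos x) / x\<^sup>2" for x :: real
  \<comment> \<open>an antiderivative of \<open>f\<close>, obtained by integrating by parts\<close>
  define G where "G x = Si x - (1 - cos x) / x" for x :: real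
  have dG: "(G has_real_derivative f x) (at x)" if "0 < x" for x
  proof -
    have "((\<lambda>x. Si x - (1 - cos x) / x) has_real_derivative sinc x - (sin x * x - (1 - cos x)) / x\<^sup>2) (at x)"
      using that by (auto intro!: derivative_eq_intros DERIV_Si simp: power2_eq_square)
    moreover have "sinc x - (sin x * x - (1 - cos x)) / x\<^sup>2 = f x"
      using that by (simp add: f_def field_simps power2_eq_square)
    ultimately show ?thesis by (simp add: G_def[abs_def])
  qed
  have lim0: "(G \<longlongrightarrow> 0) (at_right 0)"
  proof -
    have "((\<lambda>x. (1 - cos x) / x) \<longlongrightarrow> (0::real)) (at_right 0)" by real_asymp
    moreover have "(Si \<longlongrightarrow> Si 0) (at_right 0)"
      using isCont_Si[of 0] by (meson filterlim_at_split isCont_def)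
    moreover have "Si 0 = 0" by (simp add: Si_def flip: zero_ereal_def)
    ultimately show ?thesis unfolding G_def[abs_def] using tendsto_diff[of Si 0 _ "\<lambda>x. (1 - cos x) / x" 0] by simp
  qed
  have limI: "(G \<longlongrightarrow> pi / 2) at_top"
  proof -
    have "((\<lambda>x. (1 - cos x) / x) \<longlongrightarrow> (0::real)) at_top"
    proof (rule Lim_null_comparison)
      show "eventually (\<lambda>x. norm ((1 - cos x) / x) \<le> 2 / x) at_top"
        using eventually_gt_at_top[of "0::real"]
      proof eventually_elim
        case (elim x)
        have "1 - cos x \<le> 2" "0 \<le> 1 - cos x" using cos_ge_minus_one[of x] cos_le_one[of x] by linarith+
        then show ?case using elim by (simp add: divide_right_mono)
      qed
      show "((\<lambda>x. 2 / x) \<longlongrightarrow> (0::real)) at_top" by real_asymp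
    qed
    then show ?thesis unfolding G_def[abs_def] using tendsto_diff[OF Si_at_top] by fastforce
  qed
  have ftc: "set_integrable lborel (einterval 0 \<infinity>) f \<and> (LBINT x=0..\<infinity>. f x) = pi / 2 - 0"
  proof (intro conjI interval_integral_FTC_nonneg[where F = G and a = 0 and b = \<infinity>])
    show "(G has_real_derivative f x) (at x)" if "0 < ereal x" for x using dG that by simp
    show "isCont f x" if "0 < ereal x" for x using that unfolding f_def by (auto intro!: continuous_intros)
    show "AE x in lborel. 0 < ereal x \<longrightarrow> ereal x < \<infinity> \<longrightarrow> 0 \<le> f x" by (simp add: f_def)
    show "((G \<circ> real_of_ereal) \<longlongrightarrow> 0) (at_right 0)"
      using lim0 unfolding zero_ereal_def ereal_tendsto_simps .
    show "((G \<circ> real_of_ereal) \<longlongrightarrow> pi / 2) (at_left \<infinity>)"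
      using limI unfolding ereal_tendsto_simps .
    then show "((G \<circ> real_of_ereal) \<longlongrightarrow> pi / 2) (at_left \<infinity>)" .
  qed (use dG lim0 in \<open>auto simp: f_def zero_ereal_def ereal_tendsto_simps intro!: continuous_intros\<close>)
  define g where "g x = indicator {0<..} x *\<^sub>R f x" for x :: real
  have "einterval 0 \<infinity> = {0::real<..}" by (auto simp: einterval_def)
  then have g: "has_bochner_integral lborel g (pi / 2)"
    using ftc unfolding g_def has_bochner_integral_iff set_integrable_def
    by (simp add: interval_lebesgue_integral_def set_lebesgue_integral_def)
  have "has_bochner_integral lborel (\<lambda>x. g (0 + -1 * x)) (pi / 2 /\<^sub>R \<bar>-1\<bar>)"
    using g lborel_has_bochner_integral_real_affine_iff[of "-1" g "pi/2" 0] by simp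
  then have "has_bochner_integral lborel (\<lambda>x. g x + g (- x)) (pi / 2 + pi / 2)"
    by (intro has_bochner_integral_add g) simp
  moreover have "(\<lambda>x. g x + g (- x)) = f"
    by (rule ext) (auto simp: g_def f_def indicator_def)
  ultimately have "has_bochner_integral lborel f pi" by simp
  then have "has_bochner_integral lborel (\<lambda>l. f (0 + a * l)) (pi /\<^sub>R \<bar>a\<bar>)"
    using lborel_has_bochner_integral_real_affine_iff[OF a, of f pi 0] by simp
  from has_bochner_integral_scaleR_right[OF this, of "a\<^sup>2"]
  have "has_bochner_integral lborel (\<lambda>l. a\<^sup>2 *\<^sub>R f (0 + a * l)) (a\<^sup>2 *\<^sub>R (pi /\<^sub>R \<bar>a\<bar>))" by simp
  moreover have "a\<^sup>2 *\<^sub>R (pi /\<^sub>R \<bar>a\<bar>) = pi * \<bar>a\<bar>"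
    using a by (simp add: field_simps power2_eq_square abs_if)
  moreover have "(\<lambda>l. a\<^sup>2 *\<^sub>R f (0 + a * l)) = (\<lambda>l. (1 - cos (a * l)) / l\<^sup>2)"
    using a by (simp add: f_def power_mult_distrib)
  ultimately show ?thesis by (simp only:)
qed

lemma has_bochner_integral_cis_product:
  "has_bochner_integral lborel (\<lambda>l. (cis (a * l) - 1) * (cis (- (b * l)) - 1) / of_real (l\<^sup>2))
     (of_real (pi * (\<bar>a\<bar> + \<bar>b\<bar> - \<bar>a - b\<bar>)))"
proof -
  define f where "f l = (cis (a * l) - 1) * (cis (- (b * l)) - 1) / complex_of_real (l\<^sup>2)" for l :: real
  have nc: "(cmod (cis t - 1))\<^sup>2 = 2 * (1 - cos t)" for t
    unfolding cmod_power2 using sin_cos_squared_add[of t] by (simp add: power2_eq_square algebra_simps)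
  have bd: "norm (f l) \<le> (1 - cos (a * l)) / l\<^sup>2 + (1 - cos (b * l)) / l\<^sup>2" for l
  proof -
    have "2 * (cmod (cis (a * l) - 1) * cmod (cis (- (b * l)) - 1))
       \<le> (cmod (cis (a * l) - 1))\<^sup>2 + (cmod (cis (- (b * l)) - 1))\<^sup>2"
      using sum_squares_bound by (metis mult.assoc)
    then have "cmod (cis (a * l) - 1) * cmod (cis (- (b * l)) - 1) \<le> (1 - cos (a * l)) + (1 - cos (b * l))"
      unfolding nc by simp
    then show ?thesis unfolding f_def norm_divide norm_mult add_divide_distrib[symmetric]
      by (simp add: divide_right_mono norm_power)
  qed
  have [measurable]: "f \<in> borel_measurable borel"
  proof -
    have "(\<lambda>l. cis (c * l)) \<in> borel_measurable borel" for c :: real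
      by (intro borel_measurable_continuous_onI) (auto intro!: continuous_intros)
    from this[of a] this[of "-b"] show ?thesis unfolding f_def by simp
  qed
  have int: "integrable lborel f"
  proof (rule Bochner_Integration.integrable_bound)
    show "integrable lborel (\<lambda>l. (1 - cos (a * l)) / l\<^sup>2 + (1 - cos (b * l)) / l\<^sup>2)"
      using has_bochner_integral_one_minus_cos by (intro Bochner_Integration.integrable_add) (auto simp: has_bochner_integral_iff)
    show "AE l in lborel. norm (f l) \<le> norm ((1 - cos (a * l)) / l\<^sup>2 + (1 - cos (b * l)) / l\<^sup>2)"
      using bd by (intro AE_I2) (metis abs_ge_self order_trans real_norm_def)
  qed simp
  have re: "Re (f l) = (1 - cos (a * l)) / l\<^sup>2 + (1 - cos (b * l)) / l\<^sup>2 - (1 - cos ((a - b) * l)) / l\<^sup>2" for l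
  proof -
    have "Re ((cis (a * l) - 1) * (cis (- (b * l)) - 1)) = (1 - cos (a * l)) + (1 - cos (b * l)) - (1 - cos ((a - b) * l))"
      by (simp add: left_diff_distrib cos_diff algebra_simps)
    then show ?thesis unfolding f_def Re_divide_of_real
      by (simp add: add_divide_distrib diff_divide_distrib)
  qed
  have "has_bochner_integral lborel (\<lambda>l. Re (f l)) (pi * \<bar>a\<bar> + pi * \<bar>b\<bar> - pi * \<bar>a - b\<bar>)"
    unfolding re by (intro has_bochner_integral_add has_bochner_integral_diff has_bochner_integral_one_minus_cos)
  then have Re: "Re (LINT l|lborel. f l) = pi * (\<bar>a\<bar> + \<bar>b\<bar> - \<bar>a - b\<bar>)"
    using int by (simp add: has_bochner_integral_iff algebra_simps)
  have "(LINT l|lborel. f l) = (LINT l|lborel. f (0 + -1 * l))"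
    using lborel_integral_real_affine[of "-1" f 0] by simp
  also have "\<dots> = (LINT l|lborel. cnj (f l))"
    by (rule Bochner_Integration.integral_cong) (simp_all add: f_def cis_cnj)
  also have "\<dots> = cnj (LINT l|lborel. f l)" by simp
  finally have "Im (LINT l|lborel. f l) = 0" by (metis complex_cnj_cancel_iff cnj.sel(2) neg_equal_zero)
  with Re have "(LINT l|lborel. f l) = of_real (pi * (\<bar>a\<bar> + \<bar>b\<bar> - \<bar>a - b\<bar>))" by (simp add: complex_eq_iff)
  with int show ?thesis unfolding f_def by (simp add: has_bochner_integral_iff)
qed

lemma span_eigenvectors_self_adjoint:
  fixes f :: "'a::euclidean_space \<Rightarrow> 'a"
  assumes lin: "linear f" and sa: "\<And>x y. f x \<bullet> y = x \<bullet> f y"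
  shows "span {v. \<exists>c. f v = c *\<^sub>R v} = UNIV"
proof (rule ccontr)
  define E where "E = {v. \<exists>c. f v = c *\<^sub>R v}"
  assume "span {v. \<exists>c. f v = c *\<^sub>R v} \<noteq> UNIV"
  then have "span E \<subset> span UNIV" by (auto simp: E_def)
  then obtain u where u: "u \<noteq> 0" "\<And>y. y \<in> span E \<Longrightarrow> orthogonal u y"
    using orthogonal_to_subspace_exists_gen by metis
  define W where "W = {y. \<forall>x\<in>span E. x \<bullet> y = 0}"
  have W: "subspace W" by (auto simp: W_def subspace_def inner_add_right)
  have fE: "f x \<in> span E" if "x \<in> span E" for x
    using that
  proof (induction rule: span_induct_alt)
    case base
    then show ?case by (simp add: linear_0[OF lin] span_zero)
  next
    case (step c v y)
    then obtain d where "f v = d *\<^sub>R v" by (auto simp: E_def)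
    then show ?case using step
      by (simp add: linear_add[OF lin] linear_scale[OF lin] span_add span_scale span_base)
  qed
  have fW: "f y \<in> W" if "y \<in> W" for y
    using that fE unfolding W_def by (auto simp flip: sa)
  define S where "S = W \<inter> sphere 0 1"
  have "closed W" using W by (rule closed_subspace)
  then have S: "compact S" unfolding S_def by (intro closed_Int_compact) auto
  have "(1 / norm u) *\<^sub>R u \<in> S"
    using u unfolding S_def W_def orthogonal_def by (auto simp: inner_commute)
  then have ne: "S \<noteq> {}" by blast
  have "continuous_on S (\<lambda>y. f y \<bullet> y)"
    by (intro continuous_intros linear_continuous_on) (use lin linear_conv_bounded_linear in blast)
  from continuous_attains_sup[OF S ne this]
  obtain v where v: "v \<in> S" "\<And>y. y \<in> S \<Longrightarrow> f y \<bullet> y \<le> f v \<bullet> v" by blast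
  define c where "c = f v \<bullet> v"
  have vW: "v \<in> W" and vv: "v \<bullet> v = 1" using v(1) by (auto simp: S_def norm_eq_1)
  have le: "f y \<bullet> y \<le> c * (y \<bullet> y)" if y: "y \<in> W" for y
  proof (cases "y = 0")
    case True
    then show ?thesis by (simp add: linear_0[OF lin])
  next
    case False
    have "(1 / norm y) *\<^sub>R y \<in> S" using y False W by (auto simp: S_def subspace_scale)
    from v(2)[OF this] have "f y \<bullet> y / (norm y)\<^sup>2 \<le> c"
      using False by (simp add: linear_scale[OF lin] c_def power2_eq_square)
    then show ?thesis using False by (simp add: field_simps power2_norm_eq_inner)
  qed
  define w where "w = f v - c *\<^sub>R v"
  have wW: "w \<in> W" unfolding w_def by (intro subspace_diff subspace_scale W fW vW)
  define M where "M = c * (w \<bullet> w) - f w \<bullet> w"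
  have step: "2 * (w \<bullet> w) \<le> t * M" if "0 < t" for t
  proof -
    have "v + t *\<^sub>R w \<in> W" by (intro subspace_add subspace_scale W vW wW)
    from le[OF this]
    have "f v \<bullet> v + 2 * t * (f v \<bullet> w) + t\<^sup>2 * (f w \<bullet> w) \<le> c * (v \<bullet> v + 2 * t * (v \<bullet> w) + t\<^sup>2 * (w \<bullet> w))"
      using sa[of w v]
      by (simp add: linear_add[OF lin] linear_scale[OF lin] inner_add_left inner_add_right inner_commute
          power2_eq_square algebra_simps)
    then have "t * (2 * (f v \<bullet> w - c * (v \<bullet> w))) \<le> t * (t * M)"
      using vv by (simp add: c_def[symmetric] M_def power2_eq_square algebra_simps)
    then have "2 * (f v \<bullet> w - c * (v \<bullet> w)) \<le> t * M" using that by simp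
    moreover have "f v \<bullet> w - c * (v \<bullet> w) = w \<bullet> w" by (simp add: w_def inner_diff_left)
    ultimately show ?thesis by simp
  qed
  have "w \<bullet> w \<le> 0"
  proof (rule field_le_epsilon)
    fix e :: real assume "0 < e"
    define t where "t = e / (\<bar>M\<bar> + 1)"
    have t: "0 < t" using \<open>0 < e\<close> by (simp add: t_def)
    have "t * M \<le> t * (\<bar>M\<bar> + 1)" using t by (intro mult_left_mono) auto
    also have "\<dots> = e" by (simp add: t_def)
    finally show "w \<bullet> w \<le> 0 + e" using step[OF t] inner_ge_zero[of w] by linarith
  qed
  then have "w = 0" using inner_gt_zero_iff[of w] by linarith
  then have "v \<in> span E" by (intro span_base) (auto simp: E_def w_def)
  then show False using vW vv by (auto simp: W_def)
qed

text \<open>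
  Column vectors \<open>v\<close> are represented by the rows \<open>r = v\<^sup>*\<close>, on which matrices act from the right;
  \<open>v\<^sup>* M w\<close> becomes \<open>cdot (r v* M) s\<close> with \<open>s = w\<^sup>*\<close>.
\<close>

definition cdot :: "complex^'n \<Rightarrow> complex^'n \<Rightarrow> complex" where
  "cdot a b = (\<Sum>i\<in>UNIV. a $ i * cnj (b $ i))"

lemma bounded_bilinear_cdot: "bounded_bilinear (cdot :: complex^'n \<Rightarrow> _)"
  unfolding bilinear_conv_bounded_bilinear[symmetric] bilinear_def
  by (auto intro!: linearI simp: cdot_def distrib_right distrib_left sum.distrib scaleR_sum_right)

lemma bounded_bilinear_vector_matrix_mult:
  "bounded_bilinear ((v*) :: complex^'n \<Rightarrow> complex^'m^'n \<Rightarrow> _)"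
  unfolding bilinear_conv_bounded_bilinear[symmetric] bilinear_def
  by (auto intro!: linearI simp: vec_eq_iff vector_matrix_mult_def distrib_right distrib_left sum.distrib scaleR_sum_right)

lemma bounded_bilinear_matrix_matrix_mult:
  "bounded_bilinear ((**) :: complex^'n^'m \<Rightarrow> complex^'p^'n \<Rightarrow> _)"
  unfolding bilinear_conv_bounded_bilinear[symmetric] bilinear_def
  by (auto intro!: linearI simp: vec_eq_iff matrix_matrix_mult_def distrib_right distrib_left sum.distrib scaleR_sum_right)

interpretation cdot: bounded_bilinear "cdot :: complex^'n \<Rightarrow> _"
  by (rule bounded_bilinear_cdot)

interpretation vmult: bounded_bilinear "(v*) :: complex^'n \<Rightarrow> complex^'m^'n \<Rightarrow> _"
  by (rule bounded_bilinear_vector_matrix_mult)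

interpretation mmult: bounded_bilinear "(**) :: complex^'n^'m \<Rightarrow> complex^'p^'n \<Rightarrow> _"
  by (rule bounded_bilinear_matrix_matrix_mult)

lemma cnj_cdot: "cnj (cdot a b) = cdot b a"
  by (simp add: cdot_def mult.commute)

lemma inner_eq_Re_cdot: "a \<bullet> b = Re (cdot a b)"
  by (simp add: cdot_def inner_vec_def inner_complex_def)

lemma cdot_self: "cdot a a = of_real ((norm a)\<^sup>2)"
proof -
  have "Im (cdot a a) = 0" using cnj_cdot[of a a] by (metis complex_cnj_cancel_iff cnj.sel(2) neg_equal_zero)
  then show ?thesis
    using inner_eq_Re_cdot[of a a] by (simp add: complex_eq_iff power2_norm_eq_inner)
qed

lemma cdot_scale: "cdot (c *s a) b = c * cdot a b" "cdot a (c *s b) = cnj c * cdot a b"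
  by (simp_all add: cdot_def sum_distrib_left mult_ac)

lemma cdot_adj: "cdot (a v* M) b = cdot a (b v* adj M)"
proof -
  have "cdot (a v* M) b = (\<Sum>j\<in>UNIV. \<Sum>i\<in>UNIV. a $ i * (M $ i $ j * cnj (b $ j)))"
    unfolding cdot_def vector_matrix_mult_def vec_lambda_beta sum_distrib_right
    by (intro sum.cong refl) (simp add: mult_ac)
  also have "\<dots> = (\<Sum>i\<in>UNIV. \<Sum>j\<in>UNIV. a $ i * (M $ i $ j * cnj (b $ j)))" by (rule sum.swap)
  also have "\<dots> = cdot a (b v* adj M)"
    by (simp add: cdot_def vector_matrix_mult_def adj_def sum_distrib_left mult_ac)
  finally show ?thesis .
qed

lemma adj_adj: "adj (adj M) = M"
  by (simp add: adj_def)

lemma cdot_sandwich: "cdot (a v* (U ** M ** adj V)) b = cdot ((a v* U) v* M) (b v* V)"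
  by (simp add: cdot_adj[of _ V, symmetric] cdot_adj adj_adj flip: vector_matrix_mul_assoc)

lemma scaleC_vmult: "(c *s a) v* M = c *s (a v* M)" for M :: "complex^'n^'m"
  by (simp add: vec_eq_iff vector_matrix_mult_def sum_distrib_left mult_ac)

lemma scaleR_eq_scaleC: "x *\<^sub>R a = complex_of_real x *s a" for a :: "complex^'n"
  unfolding vec_eq_iff vector_scaleR_component vector_smult_component by (simp add: scaleR_conv_of_real)

lemma qform_eq_cdot: "qform M v = cdot ((\<chi> i. cnj (v $ i)) v* M) (\<chi> i. cnj (v $ i))"
proof -
  have "qform M v = (\<Sum>i\<in>UNIV. \<Sum>j\<in>UNIV. cnj (v $ i) * (M $ i $ j * v $ j))"
    by (simp add: qform_def matrix_vector_mult_def sum_distrib_left)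
  also have "\<dots> = (\<Sum>j\<in>UNIV. \<Sum>i\<in>UNIV. cnj (v $ i) * (M $ i $ j * v $ j))" by (rule sum.swap)
  also have "\<dots> = cdot ((\<chi> i. cnj (v $ i)) v* M) (\<chi> i. cnj (v $ i))"
    unfolding cdot_def vector_matrix_mult_def vec_lambda_beta sum_distrib_right
    by (intro sum.cong refl) (simp add: mult_ac)
  finally show ?thesis .
qed

lemma cdot_eq_qform: "cdot (r v* M) r = qform M (\<chi> i. cnj (r $ i))"
  by (simp add: qform_eq_cdot)

lemma cdot_real: "adj M = M \<Longrightarrow> cdot (r v* M) r = of_real (Re (cdot (r v* M) r))"
  by (metis cdot_adj cnj_cdot Reals_cnj_iff of_real_Re)

lemma posdef_cdot: "posdef_mat M \<Longrightarrow> r \<noteq> 0 \<Longrightarrow> 0 < Re (cdot (r v* M) r)"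
  unfolding posdef_mat_def cdot_eq_qform by (auto simp: vec_eq_iff)

lemma nonneg_cdot: "nonneg_mat M \<Longrightarrow> 0 \<le> Re (cdot (r v* M) r)"
  unfolding nonneg_mat_def cdot_eq_qform by auto

lemma span_eigenrows:
  fixes B :: "complex^'m^'m"
  assumes "adj B = B"
  shows "span {r. \<exists>b. r v* B = b *\<^sub>R r} = UNIV"
proof (rule span_eigenvectors_self_adjoint)
  show "linear (\<lambda>r. r v* B)"
    using vmult.bounded_linear_left by (rule bounded_linear.linear)
  show "(x v* B) \<bullet> y = x \<bullet> (y v* B)" for x y
    by (simp add: inner_eq_Re_cdot cdot_adj assms)
qed

lemma vmult_mexp:
  fixes A :: "complex^'m^'m"
  assumes "r v* A = a *s r"
  shows "r v* mexp A = exp a *s r"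
proof -
  obtain K where K: "0 < K" "\<And>X Y. norm ((X :: complex^'m^'m) ** (Y :: complex^'m^'m)) \<le> norm X * norm Y * K"
    using mmult.pos_bounded by blast
  define P where "P k = ((**) A ^^ k) (mat 1)" for k
  have nP: "norm (P k) \<le> (norm A * K) ^ k * norm (mat 1 :: complex^'m^'m)" for k
  proof (induction k)
    case (Suc k)
    have "norm (P (Suc k)) \<le> norm A * norm (P k) * K" using K(2) by (simp add: P_def)
    also have "\<dots> = (norm A * K) * norm (P k)" by simp
    also have "\<dots> \<le> (norm A * K) * ((norm A * K) ^ k * norm (mat 1 :: complex^'m^'m))"
      using Suc K(1) by (intro mult_left_mono) auto
    finally show ?case by (simp add: mult_ac)
  qed (simp add: P_def)
  have "summable (\<lambda>k. P k /\<^sub>R fact k)"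
  proof (rule summable_comparison_test)
    show "\<exists>N. \<forall>k\<ge>N. norm (P k /\<^sub>R fact k) \<le> ((norm A * K) ^ k /\<^sub>R fact k) * norm (mat 1 :: complex^'m^'m)"
    proof (intro exI allI impI)
      fix k
      have "norm (P k /\<^sub>R fact k) = norm (P k) * inverse (fact k)" by simp
      also have "\<dots> \<le> ((norm A * K) ^ k * norm (mat 1 :: complex^'m^'m)) * inverse (fact k)"
        by (intro mult_right_mono nP) auto
      finally show "norm (P k /\<^sub>R fact k) \<le> ((norm A * K) ^ k /\<^sub>R fact k) * norm (mat 1 :: complex^'m^'m)"
        by (simp add: mult_ac)
    qed
    show "summable (\<lambda>k. ((norm A * K) ^ k /\<^sub>R fact k) * norm (mat 1 :: complex^'m^'m))"
      by (intro summable_mult2 summable_exp_generic)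
  qed
  then have "(\<lambda>k. P k /\<^sub>R fact k) sums mexp A" unfolding mexp_def P_def by (rule summable_sums)
  then have "(\<lambda>k. r v* (P k /\<^sub>R fact k)) sums (r v* mexp A)"
    by (rule bounded_linear.sums[OF vmult.bounded_linear_right])
  moreover have "r v* P k = a ^ k *s r" for k
  proof (induction k)
    case (Suc k)
    have "r v* P (Suc k) = (r v* A) v* P k" by (simp add: P_def vector_matrix_mul_assoc)
    then show ?case using Suc by (simp add: assms scaleC_vmult vec.scale_scale)
  qed (simp add: P_def vec_eq_iff)
  then have "r v* (P k /\<^sub>R fact k) = (a ^ k /\<^sub>R fact k) *s r" for k
    by (simp add: vmult.scaleR_right vec_eq_iff)
  moreover have "(\<lambda>k. (a ^ k /\<^sub>R fact k) *s r) sums (exp a *s r)"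
  proof -
    have "bounded_linear (\<lambda>c. c *s r)"
      unfolding linear_conv_bounded_linear[symmetric]
      by (rule linearI) (auto simp: vec_eq_iff distrib_right)
    then show ?thesis by (rule bounded_linear.sums) (rule exp_converges)
  qed
  ultimately show ?thesis using sums_unique2 by simp
qed

lemma posdef_invertible:
  assumes "posdef_mat M"
  shows "invertible M"
proof -
  have "v = 0" if "M *v v = 0" for v
    using assms that unfolding posdef_mat_def qform_def by fastforce
  then show ?thesis using invertible_left_inverse matrix_left_invertible_ker by blast
qed

lemma matrix_inv_mult:
  fixes M :: "complex^'m^'m"
  assumes "invertible M"
  shows "M ** matrix_inv M = mat 1" "matrix_inv M ** M = mat 1"
  using someI_ex[OF assms[unfolded invertible_def]] unfolding matrix_inv_def by auto

section \<open>Uniqueness of matrix densities\<close>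

lemma interval_measure_unique:
  assumes F: "\<And>x y. x \<le> y \<Longrightarrow> F x \<le> F y" "\<And>a. continuous (at_right a) F"
    and sets: "sets M = sets borel"
    and eq: "\<And>a b. a \<le> b \<Longrightarrow> emeasure M {a<..b} = ennreal (F b - F a)"
  shows "interval_measure F = M"
proof (rule measure_eqI_generator_eq)
  let ?E = "range (\<lambda>(a, b). {a<..b::real})"
  show "Int_stable ?E"
    by (auto simp: Int_stable_def)
  show "?E \<subseteq> Pow UNIV" by simp
  show "emeasure (interval_measure F) X = emeasure M X" if X: "X \<in> ?E" for X
  proof -
    obtain a b where "X = {a<..b}" using X by auto
    then show ?thesis
      by (cases "a \<le> b") (auto simp: emeasure_interval_measure_Ioc F eq)
  qed
  show "sets (interval_measure F) = sigma_sets UNIV ?E" "sets M = sigma_sets UNIV ?E"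
    by (simp_all add: sets borel_sigma_sets_Ioc)
  show "range (\<lambda>n. {- real n<..real n}) \<subseteq> ?E" by auto
  show "(\<Union>n. {- real n<..real n}) = UNIV"
  proof (intro set_eqI iffI UNIV_I)
    fix x :: real
    obtain n where "\<bar>x\<bar> < real n" using reals_Archimedean2 by blast
    then show "x \<in> (\<Union>n. {- real n<..real n})" by (intro UN_I[of n]) auto
  qed
  show "emeasure (interval_measure F) {- real n<..real n} \<noteq> \<infinity>" for n
    by (subst emeasure_interval_measure_Ioc) (auto simp: F)
qed

lemma interval_density_zero:
  fixes D :: "real \<Rightarrow> 'b::{banach, second_countable_topology}"
  assumes F: "\<And>x y. x \<le> y \<Longrightarrow> F x \<le> F y" "\<And>a. continuous (at_right a) F"
    and int: "\<And>a b. a < b \<Longrightarrow> set_integrable (interval_measure F) {a<..b} D"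
    and zero: "\<And>a b. a < b \<Longrightarrow> (LINT x:{a<..b}|interval_measure F. D x) = 0"
  shows "AE x in interval_measure F. D x = 0"
proof -
  let ?M = "interval_measure F"
  interpret sigma_finite_measure ?M by (rule sigma_finite_interval_measure[OF F])
  have "AE x in ?M. indicator {- real n<..real n} x *\<^sub>R D x = 0" for n
  proof (cases "n = 0")
    case False
    define h where "h x = indicator {- real n<..real n} x *\<^sub>R D x" for x
    have h: "integrable ?M h"
      using int[of "- real n" "real n"] False by (simp add: set_integrable_def h_def[abs_def])
    have hS: "set_integrable ?M A h" if "A \<in> sets ?M" for A
      using integrable_mult_indicator[OF that h] by (simp add: set_integrable_def)
    show ?thesis unfolding h_def[symmetric]
    proof (rule density_zero[OF h])
      fix A assume "A \<in> sets ?M"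
      then have A: "A \<in> sigma_sets UNIV (range (\<lambda>(a, b). {a<..b::real}))" by (simp add: borel_sigma_sets_Ioc)
      have borel: "A \<in> sets ?M" if "A \<in> sigma_sets UNIV (range (\<lambda>(a, b). {a<..b::real}))" for A
        using that by (simp add: borel_sigma_sets_Ioc)
      have Ioc: "set_lebesgue_integral ?M {a<..b} h = 0" for a b
      proof -
        have "set_lebesgue_integral ?M {a<..b} h
          = (LINT x:{max a (- real n)<..min b (real n)}|?M. D x)"
          unfolding set_lebesgue_integral_def
          by (rule Bochner_Integration.integral_cong) (auto simp: h_def indicator_def)
        then show ?thesis
          using zero[of "max a (- real n)" "min b (real n)"]
          by (cases "max a (- real n) < min b (real n)") (auto simp: set_lebesgue_integral_def)
      qed
      have hU: "set_lebesgue_integral ?M UNIV h = 0"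
      proof -
        have "set_lebesgue_integral ?M UNIV h = set_lebesgue_integral ?M {- real n<..real n} h"
          unfolding set_lebesgue_integral_def
          by (rule Bochner_Integration.integral_cong) (auto simp: h_def indicator_def)
        then show ?thesis by (simp only: Ioc)
      qed
      have stable: "Int_stable (range (\<lambda>(a, b). {a<..b::real}))"
        by (auto simp: Int_stable_def)
      have "range (\<lambda>(a, b). {a<..b::real}) \<subseteq> Pow UNIV" by simp
      from stable this A show "set_lebesgue_integral ?M A h = 0"
      proof (induction rule: sigma_sets_induct_disjoint)
        case (basic A)
        then show ?case using Ioc by auto
      next
        case (compl A)
        have "set_lebesgue_integral ?M (A \<union> (UNIV - A)) h
            = set_lebesgue_integral ?M A h + set_lebesgue_integral ?M (UNIV - A) h"
          using borel[OF compl.hyps] by (intro set_integral_Un hS) auto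
        then show ?case using compl.IH hU by simp
      next
        case (union A)
        have A: "A i \<in> sets ?M" for i using union.hyps(2) by (intro borel) auto
        have "set_lebesgue_integral ?M (\<Union>i. A i) h = (\<Sum>i. set_lebesgue_integral ?M (A i) h)"
          using A union.hyps(1)
          by (intro lebesgue_integral_countable_add hS sets.countable_UN) (auto simp: disjoint_family_on_def)
        then show ?case using union by simp
      qed (auto simp: set_lebesgue_integral_def)
    qed
  qed auto
  then have "AE x in ?M. \<forall>n. indicator {- real n<..real n} x *\<^sub>R D x = 0"
    by (simp only: AE_all_countable simp_thms)
  then show ?thesis
  proof eventually_elim
    case (elim x)
    obtain n where "\<bar>x\<bar> < real n" using reals_Archimedean2 by blast
    then show ?case using elim[rule_format, of n] by (auto simp: indicator_def split: if_splits)
  qed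
qed

lemma trace_increasing:
  assumes "increasing_mat \<sigma>"
  shows "x \<le> y \<Longrightarrow> Re (trace (\<sigma> x)) \<le> Re (trace (\<sigma> y))" "continuous (at_right a) (\<lambda>l. Re (trace (\<sigma> l)))"
proof -
  have diag: "0 \<le> Re (M $ i $ i)" if "nonneg_mat M" for M :: "complex^'n^'n" and i
  proof -
    have "qform M (axis i 1) = M $ i $ i"
      by (simp add: qform_def axis_def matrix_vector_mult_def if_distrib[of cnj] if_distrib[of "(*) _"] if_distrib[of "\<lambda>x. x * _"] cong: if_cong)
    then show ?thesis using that unfolding nonneg_mat_def by metis
  qed
  show "Re (trace (\<sigma> x)) \<le> Re (trace (\<sigma> y))" if "x \<le> y"
  proof (cases "x = y")
    case False
    then have "nonneg_mat (\<sigma> y - \<sigma> x)" using assms that unfolding increasing_mat_def by auto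
    from diag[OF this] show ?thesis by (auto simp: trace_def intro!: sum_mono)
  qed simp
  have "continuous (at_right a) \<sigma>" using assms unfolding increasing_mat_def by auto
  moreover have "bounded_linear (\<lambda>M :: complex^'n^'n. Re (trace M))"
    unfolding linear_conv_bounded_linear[symmetric] trace_def
    by (rule linearI) (auto simp: sum.distrib sum_distrib_left)
  ultimately show "continuous (at_right a) (\<lambda>l. Re (trace (\<sigma> l)))"
    using bounded_linear.continuous by blast
qed

lemma matrix_density_unique:
  assumes "increasing_mat \<sigma>" "matrix_density \<sigma> \<Phi>" "matrix_density \<sigma> \<Psi>"
  shows "AE l in trace_measure \<sigma>. \<Phi> l = \<Psi> l"
proof -
  have "AE l in trace_measure \<sigma>. \<Phi> l - \<Psi> l = 0"
    unfolding trace_measure_def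
  proof (rule interval_density_zero[OF trace_increasing[OF assms(1)]])
    fix a b :: real assume "a < b"
    then have i: "set_integrable (trace_measure \<sigma>) {a<..b} \<Phi>" "set_integrable (trace_measure \<sigma>) {a<..b} \<Psi>"
      "(LINT l:{a<..b}|trace_measure \<sigma>. \<Phi> l) = (LINT l:{a<..b}|trace_measure \<sigma>. \<Psi> l)"
      using assms(2,3) unfolding matrix_density_def by auto
    show "set_integrable (interval_measure (\<lambda>l. Re (trace (\<sigma> l)))) {a<..b} (\<lambda>l. \<Phi> l - \<Psi> l)"
      using set_integral_diff(1)[OF i(1,2)] by (simp add: trace_measure_def)
    show "(LINT l:{a<..b}|interval_measure (\<lambda>l. Re (trace (\<sigma> l))). \<Phi> l - \<Psi> l) = 0"
      using set_integral_diff(2)[OF i(1,2)] i(3) by (simp add: trace_measure_def)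
  qed
  then show ?thesis by simp
qed

lemma cdot_ext:
  fixes M N :: "complex^'n^'m"
  assumes "\<And>r s. cdot (r v* M) s = cdot (r v* N) s"
  shows "M = N"
proof -
  have "cdot (axis i 1 v* M) (axis j 1) = M $ i $ j" for M :: "complex^'n^'m" and i j
    by (simp add: cdot_def axis_def vector_matrix_mult_def if_distrib[of cnj] if_distrib[of "(*) _"] if_distrib[of "\<lambda>x. x * _"] cong: if_cong)
  then show ?thesis using assms by (metis vec_eq_iff)
qed

section \<open>Parseval for the free system\<close>

lemma sum_UNIV_Plus: "(\<Sum>k\<in>UNIV. f k) = (\<Sum>i\<in>UNIV. f (Inl i)) + (\<Sum>i\<in>UNIV. f (Inr i))"
  for f :: "'a::finite + 'b::finite \<Rightarrow> 'c::comm_monoid_add"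
  using sum.Plus[of UNIV UNIV f] by simp

definition upper :: "complex^('n + 'n) \<Rightarrow> complex^'n" where
  "upper r = (\<chi> i. r $ Inl i)"

definition lower :: "complex^('n + 'n) \<Rightarrow> complex^'n" where
  "lower r = (\<chi> i. r $ Inr i)"

lemma row_eq_iff: "r = s \<longleftrightarrow> upper r = upper s \<and> lower r = lower s"
  by (auto simp: vec_eq_iff upper_def lower_def split_sum_all)

lemma upper_lower_scaleR: "upper (c *\<^sub>R r) = c *\<^sub>R upper r" "lower (c *\<^sub>R r) = c *\<^sub>R lower r"
  by (simp_all add: vec_eq_iff upper_def lower_def)

lemma upper_lower_zero: "upper 0 = 0" "lower 0 = 0"
  by (simp_all add: vec_eq_iff upper_def lower_def)

lemma cdot_blocks: "cdot r s = cdot (upper r) (upper s) + cdot (lower r) (lower s)"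
  by (simp add: cdot_def sum_UNIV_Plus upper_def lower_def)

lemma vmult_block_diag:
  "upper (r v* block_diag M N) = upper r v* M" "lower (r v* block_diag M N) = lower r v* N"
  by (simp_all add: vec_eq_iff vector_matrix_mult_def sum_UNIV_Plus upper_def lower_def block_diag_def)

lemma vmult_block_col: "r v* block_col M N = upper r v* M + lower r v* N"
  by (simp add: vec_eq_iff vector_matrix_mult_def sum_UNIV_Plus upper_def lower_def block_col_def)

lemma adj_block_diag: "adj (block_diag M N) = block_diag (adj M) (adj N)"
  by (simp add: vec_eq_iff adj_def block_diag_def split: sum.split)

lemma block_diag_mult: "block_diag M N ** block_diag M' N' = block_diag (M ** M') (N ** N')"
  by (auto simp: vec_eq_iff matrix_matrix_mult_def sum_UNIV_Plus block_diag_def split: sum.split)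

lemma block_diag_one: "block_diag (mat 1) (mat 1) = mat 1"
  by (auto simp: vec_eq_iff mat_def block_diag_def split: sum.split)

lemma scaleR_eq_imp_eq_scaleR: "x = c *\<^sub>R y \<Longrightarrow> c \<noteq> 0 \<Longrightarrow> y = (1 / c) *\<^sub>R x"
  for x y :: "'a::real_vector"
  by simp

locale gl_coefficients =
  fixes B1 B2 H :: "complex^'n^'n" and B :: "complex^('n + 'n)^('n + 'n)"
  assumes B1: "posdef_mat B1" and B2: "posdef_mat B2" and B: "B = block_diag B1 (- B2)"
    and H: "B1 = adj H ** B2 ** H"
begin

abbreviation "P \<equiv> matrix_inv B1"
abbreviation "C \<equiv> block_col (mat 1) H"

lemma adj_B: "adj B = B"
proof -
  have "adj (- B2) = - B2" using B2 by (simp add: posdef_mat_def adj_def vec_eq_iff)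
  then show ?thesis using B1 by (simp add: B adj_block_diag posdef_mat_def)
qed

lemma B1_inv: "B1 ** P = mat 1" "P ** B1 = mat 1"
  using matrix_inv_mult[OF posdef_invertible[OF B1]] by auto

lemma B2_inv: "B2 ** matrix_inv B2 = mat 1" "matrix_inv B2 ** B2 = mat 1"
  using matrix_inv_mult[OF posdef_invertible[OF B2]] by auto

lemma B_inv: "B ** matrix_inv B = mat 1" "matrix_inv B ** B = mat 1"
proof -
  have "B ** block_diag P (- matrix_inv B2) = mat 1" "block_diag P (- matrix_inv B2) ** B = mat 1"
    by (simp_all add: B block_diag_mult B1_inv B2_inv mmult.minus_left mmult.minus_right block_diag_one)
  then have "invertible B" unfolding invertible_def by blast
  from matrix_inv_mult[OF this] show "B ** matrix_inv B = mat 1" "matrix_inv B ** B = mat 1" by auto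
qed

lemma H_sandwich: "B2 ** (H ** P ** adj H) = mat 1"
proof -
  have "adj H ** B2 ** H ** P = mat 1" using B1_inv(1) by (simp only: H[symmetric])
  then have "P ** (adj H ** B2) ** H = mat 1"
    using B1_inv(2) by (simp only: matrix_mul_assoc H[symmetric]) (simp add: H matrix_mul_assoc)
  then have "H ** (P ** (adj H ** B2)) = mat 1" by (simp only: matrix_left_right_inverse)
  then have "(H ** P ** adj H) ** B2 = mat 1" by (simp only: matrix_mul_assoc)
  then show ?thesis by (simp only: matrix_left_right_inverse)
qed

lemma eigenrow_cases:
  assumes r: "r v* B = b *\<^sub>R r" "r \<noteq> 0"
  obtains "0 < b" "lower r = 0" "upper r v* B1 = b *\<^sub>R upper r"
    | "b < 0" "upper r = 0" "lower r v* B2 = (- b) *\<^sub>R lower r"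
proof -
  have u: "upper r v* B1 = b *\<^sub>R upper r" and "- (lower r v* B2) = b *\<^sub>R lower r"
    using arg_cong[OF r(1), of upper] arg_cong[OF r(1), of lower]
    by (simp_all add: B vmult_block_diag upper_lower_scaleR vmult.minus_right)
  then have l: "lower r v* B2 = (- b) *\<^sub>R lower r" by (metis add.inverse_inverse scaleR_minus_left)
  have "0 < b" if "upper r \<noteq> 0"
    using posdef_cdot[OF B1 that] that by (simp add: u cdot.scaleR_left cdot_self zero_less_mult_iff)
  moreover have "b < 0" if "lower r \<noteq> 0"
    using posdef_cdot[OF B2 that] that by (simp add: l cdot.scaleR_left cdot.minus_left cdot_self mult_less_0_iff)
  moreover have "upper r \<noteq> 0 \<or> lower r \<noteq> 0" using r(2) row_eq_iff[of r 0] by (auto simp: upper_lower_zero)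
  ultimately show ?thesis using that u l by force
qed

lemma eigenrow_inv:
  assumes "r v* B = b *\<^sub>R r" "b \<noteq> 0"
  shows "r v* matrix_inv B = (1 / b) *\<^sub>R r"
proof -
  have "r = (r v* B) v* matrix_inv B" by (simp add: vector_matrix_mul_assoc B_inv)
  also have "\<dots> = b *\<^sub>R (r v* matrix_inv B)" by (simp add: assms vmult.scaleR_left)
  finally show ?thesis using assms(2) by (rule scaleR_eq_imp_eq_scaleR)
qed

lemma eigenrow_orthogonal:
  assumes "r v* B = b *\<^sub>R r" "s v* B = c *\<^sub>R s" "b \<noteq> c"
  shows "cdot r s = 0"
proof -
  have "b *\<^sub>R cdot r s = c *\<^sub>R cdot r s"
    using cdot_adj[of r B s] by (simp only: adj_B assms cdot.scaleR_left cdot.scaleR_right)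
  then show ?thesis using assms(3) by simp
qed

lemma eigenrow_weight:
  assumes r: "r v* B = b *\<^sub>R r" "r \<noteq> 0" and s: "s v* B = c *\<^sub>R s" "s \<noteq> 0" and bc: "0 < b * c"
  shows "cdot ((r v* C) v* P) (s v* C) = (1 / \<bar>b\<bar>) *\<^sub>R cdot r s"
  using r
proof (cases rule: eigenrow_cases)
  case 1
  then have c: "lower s = 0" using s bc eigenrow_cases[OF s] by (metis mult_pos_neg not_less_iff_gr_or_eq)
  have "upper r = (upper r v* B1) v* P" by (simp add: vector_matrix_mul_assoc B1_inv)
  also have "\<dots> = b *\<^sub>R (upper r v* P)" by (simp add: 1 vmult.scaleR_left)
  finally have "upper r v* P = (1 / b) *\<^sub>R upper r"
    by (rule scaleR_eq_imp_eq_scaleR) (use 1(1) in simp)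
  then show ?thesis using 1 c
    by (simp add: vmult_block_col cdot_blocks[of r s] cdot.zero_left cdot.scaleR_left)
next
  case 2
  then have c: "upper s = 0" using s bc eigenrow_cases[OF s] by (metis mult_neg_pos not_less_iff_gr_or_eq)
  have "lower r = (lower r v* B2) v* (H ** P ** adj H)"
    by (simp add: vector_matrix_mul_assoc H_sandwich)
  also have "\<dots> = (- b) *\<^sub>R (lower r v* (H ** P ** adj H))" unfolding 2(3) by (rule vmult.scaleR_left)
  finally have l: "lower r v* (H ** P ** adj H) = (1 / - b) *\<^sub>R lower r"
    by (rule scaleR_eq_imp_eq_scaleR) (use 2(1) in simp)
  have "cdot ((r v* C) v* P) (s v* C) = cdot (lower r v* (H ** P ** adj H)) (lower s)"
    using 2 c by (simp add: vmult_block_col cdot_sandwich)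
  then show ?thesis using 2 c
    by (simp only: l cdot_blocks[of r s] cdot.zero_left cdot.scaleR_left) simp
qed

lemma eigenrow_e0:
  assumes "r v* B = b *\<^sub>R r" "b \<noteq> 0"
  shows "r v* e0 B H x l = cis (l * x / b) *s (r v* C)"
proof -
  have m: "r v* mat c = c *s r" for c
    by (simp add: vec_eq_iff vector_matrix_mult_def mat_def if_distrib[of "(*) _"] if_distrib[of "\<lambda>x. x * _"] mult.commute cong: if_cong)
  have "r v* (mat (\<i> * of_real (l * x)) ** matrix_inv B) = (\<i> * of_real (l * x / b)) *s r"
    unfolding vector_matrix_mul_assoc[symmetric] m scaleC_vmult eigenrow_inv[OF assms] scaleR_eq_scaleC vec.scale_scale
    by (simp add: field_simps)
  from vmult_mexp[OF this] show ?thesis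
    by (simp add: e0_def scaleC_vmult cis_conv_exp flip: vector_matrix_mul_assoc)
qed

lemma eigenrow_nonzero:
  assumes "r v* B = b *\<^sub>R r" "r \<noteq> 0"
  shows "b \<noteq> 0"
  by (rule eigenrow_cases[OF assms]) auto

lemma row_induct:
  assumes sub: "subspace {r. Q r}" and eigen: "\<And>r b. r \<noteq> 0 \<Longrightarrow> r v* B = b *\<^sub>R r \<Longrightarrow> b \<noteq> 0 \<Longrightarrow> Q r"
  shows "Q r"
proof -
  have "r \<in> span {r. \<exists>b. r v* B = b *\<^sub>R r}" by (simp add: span_eigenrows[OF adj_B])
  then show ?thesis
  proof (rule span_induct[OF _ sub])
    fix r assume "r \<in> {r. \<exists>b. r v* B = b *\<^sub>R r}"
    then show "Q r" using eigen eigenrow_nonzero subspace_0[OF sub] by (cases "r = 0") auto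
  qed
qed

lemma continuous_e0:
  "continuous_on UNIV (\<lambda>p. e0 B H (fst p) (snd p))"
proof -
  have row: "continuous_on UNIV (\<lambda>p. r v* e0 B H (fst p) (snd p))" for r
  proof (rule row_induct)
    show "subspace {r. continuous_on UNIV (\<lambda>p. r v* e0 B H (fst p) (snd p))}"
      unfolding subspace_def
      by (auto simp: vmult.zero_left vmult.add_left vmult.scaleR_left intro!: continuous_intros)
    fix r b assume r: "r v* B = b *\<^sub>R r" "b \<noteq> 0"
    show "continuous_on UNIV (\<lambda>p. r v* e0 B H (fst p) (snd p))"
      unfolding eigenrow_e0[OF r] vector_scalar_mult_def
      by (intro continuous_on_vec_lambda continuous_intros) (use r in auto)
  qed
  have "axis i 1 v* M = M $ i" for i and M :: "complex^'n^('n + 'n)"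
    by (simp add: vec_eq_iff axis_def vector_matrix_mult_def if_distrib[of "(*) _"] if_distrib[of "\<lambda>x. x * _"] cong: if_cong)
  then have "continuous_on UNIV (\<lambda>p. e0 B H (fst p) (snd p) $ i)" for i
    using row[of "axis i 1"] by simp
  then have "continuous_on UNIV (\<lambda>p. \<chi> i. e0 B H (fst p) (snd p) $ i)"
    by (intro continuous_on_vec_lambda)
  then show ?thesis by simp
qed

lemma continuous_e0_comp:
  "continuous_on S f \<Longrightarrow> continuous_on S g \<Longrightarrow> continuous_on S (\<lambda>p. e0 B H (f p) (g p))"
  using continuous_on_compose2[OF continuous_e0 continuous_on_Pair[of S f g]] by simp

lemma continuous_te0: "continuous_on UNIV (\<lambda>l. te0 B H x l)"
  unfolding te0_def cbox_interval[symmetric]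
  by (rule integral_continuous_on_param) (auto simp: case_prod_unfold intro!: continuous_e0_comp continuous_intros)

lemma vmult_te0: "r v* te0 B H x l = integral {0..x} (\<lambda>t. r v* e0 B H t l)"
  unfolding te0_def
  by (rule integral_linear[OF _ vmult.bounded_linear_right, unfolded o_def, symmetric])
     (intro integrable_continuous_real continuous_e0_comp continuous_intros)

lemma eigenrow_te0:
  assumes r: "r v* B = b *\<^sub>R r" "b \<noteq> 0" and l: "l \<noteq> 0" and x: "0 \<le> x"
  shows "r v* te0 B H x l = ((cis (l * x / b) - 1) * (of_real b / (\<i> * of_real l))) *s (r v* C)"
proof -
  define a where "a = of_real b / (\<i> * complex_of_real l)"
  have "((\<lambda>t. cis (l * t / b)) has_integral (cis (l * x / b) * a - cis (l * 0 / b) * a)) {0..x}"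
  proof (rule fundamental_theorem_of_calculus[OF x])
    fix t assume "t \<in> {0..x}"
    have "((\<lambda>t. cis (l * t / b)) has_vector_derivative (l / b) *\<^sub>R (\<i> * cis (l * t / b))) (at t within {0..x})"
      unfolding has_vector_derivative_def
      using r(2) by (auto intro!: derivative_eq_intros has_derivative_cis simp: scaleR_conv_of_real field_simps)
    then have "((\<lambda>t. cis (l * t / b) * a) has_vector_derivative (l / b) *\<^sub>R (\<i> * cis (l * t / b)) * a) (at t within {0..x})"
      by (intro derivative_intros)
    moreover have "(l / b) *\<^sub>R (\<i> * cis (l * t / b)) * a = cis (l * t / b)"
      using r(2) l by (simp add: a_def scaleR_conv_of_real)
    ultimately show "((\<lambda>t. cis (l * t / b) * a) has_vector_derivative cis (l * t / b)) (at t within {0..x})" by simp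
  qed
  then have "((\<lambda>t. cis (l * t / b)) has_integral ((cis (l * x / b) - 1) * a)) {0..x}"
    by (simp add: algebra_simps)
  moreover have "bounded_linear (\<lambda>c. c *s (r v* C))"
    unfolding linear_conv_bounded_linear[symmetric] by (rule linearI) (auto simp: vec_eq_iff distrib_right)
  ultimately have "((\<lambda>t. cis (l * t / b) *s (r v* C)) has_integral (((cis (l * x / b) - 1) * a) *s (r v* C))) {0..x}"
    using has_integral_linear[of _ _ _ "\<lambda>c. c *s (r v* C)"] by (simp add: o_def)
  then show ?thesis unfolding vmult_te0 eigenrow_e0[OF r] a_def by (rule integral_unique)
qed

lemma free_parseval:
  assumes x: "0 \<le> x" and t: "0 \<le> t"
  shows "has_bochner_integral lborel (\<lambda>l. cdot ((r v* te0 B H x l) v* P) (s v* te0 B H t l))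
    (of_real (2 * pi * min x t) * cdot r s)"
proof (rule row_induct[where Q = "\<lambda>r. has_bochner_integral lborel
   (\<lambda>l. cdot ((r v* te0 B H x l) v* P) (s v* te0 B H t l)) (of_real (2 * pi * min x t) * cdot r s)"])
  show "subspace {r. has_bochner_integral lborel
    (\<lambda>l. cdot ((r v* te0 B H x l) v* P) (s v* te0 B H t l)) (of_real (2 * pi * min x t) * cdot r s)}"
    unfolding subspace_def
  proof (safe, goal_cases)
    case 1
    then show ?case by (simp add: vmult.zero_left cdot.zero_left has_bochner_integral_zero)
  next
    case (2 r r')
    then show ?case using has_bochner_integral_add[OF 2]
      by (simp add: vmult.add_left cdot.add_left distrib_left)
  next
    case (3 c r)
    then show ?case using has_bochner_integral_scaleR_right[OF 3, of c]
      by (simp add: vmult.scaleR_left cdot.scaleR_left)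
  qed
next
  fix r b assume r: "r \<noteq> 0" "r v* B = b *\<^sub>R r" "b \<noteq> 0"
  show "has_bochner_integral lborel (\<lambda>l. cdot ((r v* te0 B H x l) v* P) (s v* te0 B H t l))
    (of_real (2 * pi * min x t) * cdot r s)"
  proof (rule row_induct[where Q = "\<lambda>s. has_bochner_integral lborel
     (\<lambda>l. cdot ((r v* te0 B H x l) v* P) (s v* te0 B H t l)) (of_real (2 * pi * min x t) * cdot r s)"])
    show "subspace {s. has_bochner_integral lborel
      (\<lambda>l. cdot ((r v* te0 B H x l) v* P) (s v* te0 B H t l)) (of_real (2 * pi * min x t) * cdot r s)}"
      unfolding subspace_def
    proof (safe, goal_cases)
      case 1
      then show ?case by (simp add: vmult.zero_left cdot.zero_right has_bochner_integral_zero)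
    next
      case (2 s s')
      then show ?case using has_bochner_integral_add[OF 2]
        by (simp add: vmult.add_left cdot.add_right distrib_left)
    next
      case (3 c s)
      then show ?case using has_bochner_integral_scaleR_right[OF 3, of c]
        by (simp add: vmult.scaleR_left cdot.scaleR_right)
    qed
  next
    fix s c assume s: "s \<noteq> 0" "s v* B = c *\<^sub>R s" "c \<noteq> 0"
    define w where "w = cdot ((r v* C) v* P) (s v* C)"
    have eq: "cdot ((r v* te0 B H x l) v* P) (s v* te0 B H t l)
      = ((cis (x / b * l) - 1) * (cis (- (t / c * l)) - 1) / of_real (l\<^sup>2)) * (of_real (b * c) * w)" if "l \<noteq> 0" for l
      unfolding eigenrow_te0[OF r(2,3) that x] eigenrow_te0[OF s(2,3) that t] scaleC_vmult cdot_scale w_def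
      by (simp add: cis_cnj field_simps power2_eq_square)
    have ae: "AE l in lborel. l \<noteq> (0::real)" by (rule AE_lborel_singleton)
    have "has_bochner_integral lborel
      (\<lambda>l. ((cis (x / b * l) - 1) * (cis (- (t / c * l)) - 1) / of_real (l\<^sup>2)) * (of_real (b * c) * w))
      (of_real (pi * (\<bar>x / b\<bar> + \<bar>t / c\<bar> - \<bar>x / b - t / c\<bar>)) * (of_real (b * c) * w))"
      by (rule has_bochner_integral_mult_left) (use has_bochner_integral_cis_product in blast)
    moreover have "of_real (pi * (\<bar>x / b\<bar> + \<bar>t / c\<bar> - \<bar>x / b - t / c\<bar>)) * (of_real (b * c) * w)
        = of_real (2 * pi * min x t) * cdot r s"
    proof (cases "0 < b * c")
      case True
      then have w: "w = (1 / \<bar>b\<bar>) *\<^sub>R cdot r s"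
        unfolding w_def using eigenrow_weight r s by blast
      show ?thesis
      proof (cases "b = c")
        case True
        have "pi * (\<bar>x / b\<bar> + \<bar>t / b\<bar> - \<bar>x / b - t / b\<bar>) * (b * b) * (1 / \<bar>b\<bar>) = 2 * pi * min x t"
        proof -
          have e: "\<bar>x / b\<bar> + \<bar>t / b\<bar> - \<bar>x / b - t / b\<bar> = 2 * min x t / \<bar>b\<bar>"
            using x t r(3) by (simp add: abs_divide min_def diff_divide_distrib[symmetric] add_divide_distrib[symmetric])
          have bb: "b * b = \<bar>b\<bar> * \<bar>b\<bar>" by simp
          show ?thesis unfolding e bb using r(3) by (simp del: abs_mult_self_eq)
        qed
        then show ?thesis unfolding w scaleR_conv_of_real True[symmetric]
          by (metis (no_types, lifting) mult.assoc of_real_mult)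
      next
        case False
        then show ?thesis using eigenrow_orthogonal[OF r(2) s(2)] by (simp add: w)
      qed
    next
      case False
      then have bc: "b * c < 0" using r(3) s(3) by (simp add: less_le)
      then have "b \<noteq> c" by (metis not_square_less_zero)
      then have "cdot r s = 0" by (rule eigenrow_orthogonal[OF r(2) s(2)])
      moreover have "\<bar>x / b\<bar> + \<bar>t / c\<bar> - \<bar>x / b - t / c\<bar> = 0"
      proof (cases "0 < b")
        case True
        then have "c < 0" using bc by (simp add: mult_less_0_iff)
        with True x t have "0 \<le> x / b" "t / c \<le> 0" by (auto simp: divide_nonneg_neg)
        then show ?thesis by linarith
      next
        case False
        then have "b < 0" "0 < c" using bc by (auto simp: mult_less_0_iff)
        with x t have "x / b \<le> 0" "0 \<le> t / c" by (auto simp: divide_nonneg_neg)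
        then show ?thesis by linarith
      qed
      ultimately show ?thesis by simp
    qed
    ultimately have G: "has_bochner_integral lborel
      (\<lambda>l. ((cis (x / b * l) - 1) * (cis (- (t / c * l)) - 1) / of_real (l\<^sup>2)) * (of_real (b * c) * w))
      (of_real (2 * pi * min x t) * cdot r s)" by (simp only:)
    have m: "(\<lambda>l. cdot ((r v* te0 B H x l) v* P) (s v* te0 B H t l)) \<in> borel_measurable lborel"
      unfolding measurable_lborel2
      by (intro borel_measurable_continuous_onI cdot.continuous_on vmult.continuous_on continuous_te0 continuous_intros)
    have "AE l in lborel. cdot ((r v* te0 B H x l) v* P) (s v* te0 B H t l)
      = ((cis (x / b * l) - 1) * (cis (- (t / c * l)) - 1) / of_real (l\<^sup>2)) * (of_real (b * c) * w)"
      using ae by eventually_elim (rule eq)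
    from has_bochner_integral_cong_AE[OF m borel_measurable_has_bochner_integral[OF G] this, THEN iffD2, OF G]
    show "has_bochner_integral lborel (\<lambda>l. cdot ((r v* te0 B H x l) v* P) (s v* te0 B H t l))
       (of_real (2 * pi * min x t) * cdot r s)" .
  qed
qed

lemma adj_P: "adj P = P"
proof -
  have "adj (B1 ** P) = adj P ** adj B1"
    by (simp add: vec_eq_iff adj_def matrix_matrix_mult_def mult.commute)
  moreover have "adj (mat 1) = (mat 1 :: complex^'n^'n)" by (simp add: adj_def mat_def vec_eq_iff)
  ultimately have "adj P ** B1 = mat 1" using B1 by (simp add: B1_inv posdef_mat_def)
  then have "(adj P ** B1) ** P = P" by simp
  then show ?thesis by (simp only: matrix_mul_assoc[symmetric] B1_inv matrix_mul_rid)
qed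

lemma P_pos: "r \<noteq> 0 \<Longrightarrow> 0 < Re (cdot (r v* P) r)"
proof -
  assume r: "r \<noteq> 0"
  define s where "s = r v* P"
  have rs: "r = s v* B1" by (simp add: s_def vector_matrix_mul_assoc B1_inv)
  then have "s \<noteq> 0" using r by (auto simp: vmult.zero_left)
  then have "0 < Re (cdot (s v* B1) s)" by (rule posdef_cdot[OF B1])
  then have "0 < Re (cdot s r)" using rs cnj_cdot[of s r] by (metis complex_cnj(1) cnj.sel(1))
  then show ?thesis by (simp add: s_def)
qed

lemma trace_P_pos: "0 < Re (trace P)"
proof -
  have "P $ i $ i = cdot (axis i 1 v* P) (axis i 1)" for i
    by (simp add: cdot_def axis_def vector_matrix_mult_def if_distrib[of cnj] if_distrib[of "(*) _"]
        if_distrib[of "\<lambda>x. x * _"] cong: if_cong)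
  moreover have "axis i 1 \<noteq> (0 :: complex^'n)" for i by (simp add: axis_eq_0_iff)
  ultimately have "0 < Re (P $ i $ i)" for i using P_pos by simp
  then show ?thesis unfolding trace_def by (auto intro!: sum_pos)
qed

lemma increasing_sigma0: "increasing_mat (sigma0 B1)"
  unfolding increasing_mat_def
proof (intro conjI allI impI)
  have adj_scaleR: "adj (c *\<^sub>R P) = c *\<^sub>R P" for c
    using adj_P by (simp add: adj_def vec_eq_iff)
  show "adj (sigma0 B1 l) = sigma0 B1 l" for l by (simp add: sigma0_def adj_scaleR)
  show "nonneg_mat (sigma0 B1 l - sigma0 B1 m)" if "m < l" for l m
  proof -
    define k where "k = (l - m) / (2 * pi)"
    have k: "0 \<le> k" using that by (simp add: k_def)
    have e: "sigma0 B1 l - sigma0 B1 m = k *\<^sub>R P"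
      by (simp add: sigma0_def k_def diff_divide_distrib scaleR_diff_left)
    have "0 \<le> Re (qform (k *\<^sub>R P) v)" for v
    proof -
      have "0 \<le> Re (cdot (r v* P) r)" for r
        using P_pos[of r] by (cases "r = 0") (auto simp: cdot.zero_right)
      then show ?thesis using k by (simp add: qform_eq_cdot vmult.scaleR_right cdot.scaleR_left)
    qed
    then show ?thesis unfolding e nonneg_mat_def by (simp add: adj_scaleR)
  qed
  show "continuous (at_right l) (sigma0 B1)" for l
    unfolding sigma0_def by (intro continuous_intros) auto
  show "sigma0 B1 0 = 0" by (simp add: sigma0_def)
qed

definition free_density :: real where
  "free_density = Re (trace P) / (2 * pi)"

lemma free_density_pos: "0 < free_density"
  using trace_P_pos by (simp add: free_density_def)

lemma trace_measure_sigma0: "trace_measure (sigma0 B1) = density lborel (\<lambda>_. ennreal free_density)"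
  unfolding trace_measure_def
proof (rule interval_measure_unique[OF trace_increasing[OF increasing_sigma0]])
  fix a b :: real assume "a \<le> b"
  have "Re (trace (sigma0 B1 l)) = free_density * l" for l
    by (simp add: sigma0_def trace_def free_density_def sum_distrib_left sum_divide_distrib)
       (simp add: field_simps sum_distrib_left)
  then show "emeasure (density lborel (\<lambda>_. ennreal free_density)) {a<..b}
      = ennreal (Re (trace (sigma0 B1 b)) - Re (trace (sigma0 B1 a)))"
    using \<open>a \<le> b\<close> free_density_pos
    by (simp add: emeasure_density_const ennreal_mult[symmetric] right_diff_distrib)
next
  show "sets (density lborel (\<lambda>_. ennreal free_density)) = sets (borel :: real measure)"
    by (rule trans[OF sets_density sets_lborel])
qed

lemma matrix_density_sigma0:
  "matrix_density (sigma0 B1) (\<lambda>_. (1 / (2 * pi * free_density)) *\<^sub>R P)"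
  unfolding matrix_density_def
proof (intro conjI allI impI)
  define k where "k = 1 / (2 * pi * free_density)"
  have k: "0 < 2 * pi * k" using free_density_pos by (simp add: k_def)
  have "sigma0 B1 (2 * pi * k) - sigma0 B1 0 = k *\<^sub>R P" by (simp add: sigma0_def)
  moreover have "nonneg_mat (sigma0 B1 (2 * pi * k) - sigma0 B1 0)"
    using increasing_sigma0 k unfolding increasing_mat_def by blast
  ultimately show "nonneg_mat ((1 / (2 * pi * free_density)) *\<^sub>R P)" by (simp add: k_def)
  fix a b :: real assume ab: "a < b"
  let ?M = "trace_measure (sigma0 B1)"
  have em: "emeasure ?M {a<..b} = ennreal (free_density * (b - a))"
    using ab free_density_pos
    by (simp add: trace_measure_sigma0 emeasure_density_const ennreal_mult)
  then have m: "measure ?M {a<..b} = free_density * (b - a)"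
    using ab free_density_pos by (simp add: measure_def)
  have "has_bochner_integral ?M (\<lambda>l. indicator {a<..b} l *\<^sub>R (k *\<^sub>R P)) (measure ?M {a<..b} *\<^sub>R (k *\<^sub>R P))"
    by (intro has_bochner_integral_scaleR_left has_bochner_integral_real_indicator)
       (simp_all add: em, simp add: trace_measure_def)
  moreover have "measure ?M {a<..b} *\<^sub>R (k *\<^sub>R P) = sigma0 B1 b - sigma0 B1 a"
    using free_density_pos
    by (simp add: m k_def sigma0_def scaleR_diff_left[symmetric] diff_divide_distrib[symmetric])
  ultimately show "set_integrable ?M {a<..b} (\<lambda>_. (1 / (2 * pi * free_density)) *\<^sub>R P)"
    "(LINT l:{a<..b}|?M. (1 / (2 * pi * free_density)) *\<^sub>R P) = sigma0 B1 b - sigma0 B1 a"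
    unfolding set_integrable_def set_lebesgue_integral_def k_def has_bochner_integral_iff by auto
qed simp

lemma bounded_linear_cdot_vmult: "bounded_linear (\<lambda>M :: complex^'b^'a. cdot (r v* M) s)"
  by (rule bounded_linear_compose[OF cdot.bounded_linear_left vmult.bounded_linear_right])

lemma has_bochner_integral_cdot_sandwich:
  assumes "has_bochner_integral M (\<lambda>l. U l ** \<Phi> l ** adj (V l)) J"
  shows "has_bochner_integral M (\<lambda>l. cdot ((r v* U l) v* \<Phi> l) (s v* V l)) (cdot (r v* J) s)"
  using has_bochner_integral_bounded_linear[OF bounded_linear_cdot_vmult assms, of r s]
  by (simp add: cdot_sandwich)

lemma free_integral:
  assumes J: "has_matrix_integral (sigma0 B1) (te0 B H x) (\<lambda>l. adj (te0 B H t l)) J"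
    and x: "0 \<le> x" and t: "0 \<le> t"
  shows "J = min x t *\<^sub>R mat 1"
proof (rule cdot_ext)
  fix r s
  let ?M = "trace_measure (sigma0 B1)"
  define k where "k = 1 / (2 * pi * free_density)"
  define f where "f l = cdot ((r v* te0 B H x l) v* P) (s v* te0 B H t l)" for l
  obtain \<Phi> where \<Phi>: "matrix_density (sigma0 B1) \<Phi>"
    "has_bochner_integral ?M (\<lambda>l. te0 B H x l ** \<Phi> l ** adj (te0 B H t l)) J"
    using J unfolding has_matrix_integral_def by blast
  have 1: "has_bochner_integral ?M (\<lambda>l. cdot ((r v* te0 B H x l) v* \<Phi> l) (s v* te0 B H t l)) (cdot (r v* J) s)"
    by (rule has_bochner_integral_cdot_sandwich[OF \<Phi>(2)])
  have fp: "has_bochner_integral lborel f (of_real (2 * pi * min x t) * cdot r s)"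
    unfolding f_def by (rule free_parseval[OF x t])
  then have fm: "f \<in> borel_measurable borel" using borel_measurable_has_bochner_integral by fastforce
  have "has_bochner_integral lborel (\<lambda>l. free_density *\<^sub>R (k *\<^sub>R f l))
      (free_density *\<^sub>R (k *\<^sub>R (of_real (2 * pi * min x t) * cdot r s)))"
    by (intro has_bochner_integral_scaleR_right fp)
  moreover have "free_density *\<^sub>R (k *\<^sub>R (of_real (2 * pi * min x t) * cdot r s)) = of_real (min x t) * cdot r s"
    using free_density_pos by (simp add: k_def scaleR_conv_of_real)
  ultimately have 2: "has_bochner_integral ?M (\<lambda>l. k *\<^sub>R f l) (of_real (min x t) * cdot r s)"
    unfolding trace_measure_sigma0
    by (intro has_bochner_integral_density) (use free_density_pos fm in auto)
  have "AE l in ?M. \<Phi> l = (1 / (2 * pi * free_density)) *\<^sub>R P"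
    by (rule matrix_density_unique[OF increasing_sigma0 \<Phi>(1) matrix_density_sigma0])
  then have ae: "AE l in ?M. cdot ((r v* te0 B H x l) v* \<Phi> l) (s v* te0 B H t l) = k *\<^sub>R f l"
    by eventually_elim (simp add: f_def k_def vmult.scaleR_right cdot.scaleR_left)
  have "has_bochner_integral ?M (\<lambda>l. k *\<^sub>R f l) (cdot (r v* J) s)"
    by (subst has_bochner_integral_cong_AE[OF _ _ ae, symmetric])
       (use 1 2 in \<open>auto simp: has_bochner_integral_iff\<close>)
  then have "cdot (r v* J) s = of_real (min x t) * cdot r s"
    using has_bochner_integral_eq[OF _ 2] by blast
  then show "cdot (r v* J) s = cdot (r v* (min x t *\<^sub>R mat 1)) s"
    by (simp only: vmult.scaleR_right cdot.scaleR_left vector_matrix_mul_rid) (simp add: scaleR_conv_of_real)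
qed

lemma quadratic_form:
  assumes incr: "increasing_mat \<sigma>"
    and Ft: "\<And>x t. 0 \<le> x \<Longrightarrow> 0 \<le> t \<Longrightarrow>
           has_matrix_integral_diff \<sigma> (sigma0 B1) (\<lambda>l. te0 B H x l)
             (\<lambda>l. adj (te0 B H t l)) (Ft x t)"
  obtains \<Phi> where "matrix_density \<sigma> \<Phi>"
    "\<And>x t r s. 0 \<le> x \<Longrightarrow> 0 \<le> t \<Longrightarrow> has_bochner_integral (trace_measure \<sigma>)
       (\<lambda>l. cdot ((r v* te0 B H x l) v* \<Phi> l) (s v* te0 B H t l))
       (of_real (min x t) * cdot r s + cdot (r v* Ft x t) s)"
proof -
  define Q where "Q x t \<Phi> \<longleftrightarrow> matrix_density \<sigma> \<Phi> \<and> has_bochner_integral (trace_measure \<sigma>)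
     (\<lambda>l. te0 B H x l ** \<Phi> l ** adj (te0 B H t l)) (min x t *\<^sub>R mat 1 + Ft x t)" for x t \<Phi>
  have "\<exists>\<Phi>. Q x t \<Phi>"
    if xt: "0 \<le> x" "0 \<le> t" for x t
  proof -
    obtain J1 J2 where J: "has_matrix_integral \<sigma> (te0 B H x) (\<lambda>l. adj (te0 B H t l)) J1"
      "has_matrix_integral (sigma0 B1) (te0 B H x) (\<lambda>l. adj (te0 B H t l)) J2" "Ft x t = J1 - J2"
      using Ft[OF xt] unfolding has_matrix_integral_diff_def by blast
    have "J1 = min x t *\<^sub>R mat 1 + Ft x t" using free_integral[OF J(2) xt] J(3) by simp
    then show ?thesis using J(1) unfolding has_matrix_integral_def Q_def by blast
  qed
  then obtain \<Phi>' where "\<And>x t. 0 \<le> x \<Longrightarrow> 0 \<le> t \<Longrightarrow> Q x t (\<Phi>' x t)" by metis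
  then have \<Phi>': "\<And>x t. 0 \<le> x \<Longrightarrow> 0 \<le> t \<Longrightarrow> matrix_density \<sigma> (\<Phi>' x t)"
    "\<And>x t. 0 \<le> x \<Longrightarrow> 0 \<le> t \<Longrightarrow> has_bochner_integral (trace_measure \<sigma>)
     (\<lambda>l. te0 B H x l ** \<Phi>' x t l ** adj (te0 B H t l)) (min x t *\<^sub>R mat 1 + Ft x t)"
    unfolding Q_def by blast+
  define \<Phi> where "\<Phi> = \<Phi>' 0 0"
  have d: "matrix_density \<sigma> \<Phi>" using \<Phi>'(1) by (simp add: \<Phi>_def)
  then have m: "\<Phi> \<in> borel_measurable borel" by (simp add: matrix_density_def)
  show ?thesis
  proof (rule that[OF d])
    fix x t :: real and r s assume xt: "0 \<le> x" "0 \<le> t"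
    have mt: "(\<lambda>l. r v* te0 B H x l) \<in> borel_measurable borel" for r x
      by (intro borel_measurable_continuous_onI vmult.continuous_on continuous_te0 continuous_intros)
    have "AE l in trace_measure \<sigma>. \<Phi>' x t l = \<Phi> l"
      by (rule matrix_density_unique[OF incr \<Phi>'(1)[OF xt] d])
    then have ae: "AE l in trace_measure \<sigma>. cdot ((r v* te0 B H x l) v* \<Phi>' x t l) (s v* te0 B H t l)
        = cdot ((r v* te0 B H x l) v* \<Phi> l) (s v* te0 B H t l)"
      by eventually_elim simp
    have I: "has_bochner_integral (trace_measure \<sigma>) (\<lambda>l. cdot ((r v* te0 B H x l) v* \<Phi>' x t l) (s v* te0 B H t l))
       (cdot (r v* (min x t *\<^sub>R mat 1 + Ft x t)) s)"
      by (rule has_bochner_integral_cdot_sandwich[OF \<Phi>'(2)[OF xt]])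
    have "(\<lambda>l. (r v* te0 B H x l) v* \<Phi> l) \<in> borel_measurable borel"
      by (rule borel_measurable_continuous_Pair[OF mt m]) (intro vmult.continuous_on continuous_intros)
    then have "(\<lambda>l. cdot ((r v* te0 B H x l) v* \<Phi> l) (s v* te0 B H t l)) \<in> borel_measurable borel"
      by (rule borel_measurable_continuous_Pair[OF _ mt]) (intro cdot.continuous_on continuous_intros)
    then have "(\<lambda>l. cdot ((r v* te0 B H x l) v* \<Phi> l) (s v* te0 B H t l)) \<in> borel_measurable (trace_measure \<sigma>)"
      by (simp add: trace_measure_def)
    then have "has_bochner_integral (trace_measure \<sigma>) (\<lambda>l. cdot ((r v* te0 B H x l) v* \<Phi> l) (s v* te0 B H t l))
       (cdot (r v* (min x t *\<^sub>R mat 1 + Ft x t)) s)"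
      by (subst has_bochner_integral_cong_AE[OF _ _ ae, symmetric])
         (use I in \<open>auto simp: has_bochner_integral_iff\<close>)
    then show "has_bochner_integral (trace_measure \<sigma>)
       (\<lambda>l. cdot ((r v* te0 B H x l) v* \<Phi> l) (s v* te0 B H t l))
       (of_real (min x t) * cdot r s + cdot (r v* Ft x t) s)"
      by (simp only: vmult.add_right vmult.scaleR_right cdot.add_left cdot.scaleR_left vector_matrix_mul_rid)
         (simp add: scaleR_conv_of_real)
  qed
qed

end

section \<open>Positivity of the Gelfand--Levitan kernel\<close>

lemma riemann_sum_bound:
  fixes mul :: "'a::real_normed_vector \<Rightarrow> 'b::banach \<Rightarrow> 'c::banach" and \<tau> :: "nat \<Rightarrow> real"
  assumes bil: "bounded_bilinear mul" and K: "\<And>a b. norm (mul a b) \<le> norm a * norm b * K" "0 < K"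
    and \<tau>: "mono \<tau>" "\<tau> 0 = 0"
    and \<rho>: "continuous_on {0..\<tau> n} \<rho>" and \<psi>: "continuous_on {0..\<tau> n} \<psi>"
    and M: "\<And>s. s \<in> {0..\<tau> n} \<Longrightarrow> norm (\<psi> s) \<le> M"
    and \<omega>: "\<And>k s. k < n \<Longrightarrow> s \<in> {\<tau> k..\<tau> (Suc k)} \<Longrightarrow> norm (\<rho> (\<tau> k) - \<rho> s) \<le> \<omega>"
  shows "norm ((\<Sum>k<n. mul (\<rho> (\<tau> k)) (integral {\<tau> k..\<tau> (Suc k)} \<psi>)) - integral {0..\<tau> n} (\<lambda>s. mul (\<rho> s) (\<psi> s)))
    \<le> K * \<omega> * M * \<tau> n"
  using \<rho> \<psi> M \<omega>
proof (induction n)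
  case 0
  then show ?case by (simp add: \<tau>)
next
  case (Suc n)
  interpret bounded_bilinear mul by (rule bil)
  have t: "0 \<le> \<tau> n" "\<tau> n \<le> \<tau> (Suc n)" using \<tau> by (metis monoD zero_le le_SucI order_refl)+
  have sub: "{0..\<tau> n} \<subseteq> {0..\<tau> (Suc n)}" "{\<tau> n..\<tau> (Suc n)} \<subseteq> {0..\<tau> (Suc n)}" using t by auto
  have c\<rho>: "continuous_on {\<tau> n..\<tau> (Suc n)} \<rho>" and c\<psi>: "continuous_on {\<tau> n..\<tau> (Suc n)} \<psi>"
    using continuous_on_subset Suc.prems(1,2) sub(2) by blast+
  have IH: "norm ((\<Sum>k<n. mul (\<rho> (\<tau> k)) (integral {\<tau> k..\<tau> (Suc k)} \<psi>)) - integral {0..\<tau> n} (\<lambda>s. mul (\<rho> s) (\<psi> s)))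
    \<le> K * \<omega> * M * \<tau> n"
    using Suc.prems sub(1) by (intro Suc.IH) (auto elim: continuous_on_subset)
  have "integral {0..\<tau> n} (\<lambda>s. mul (\<rho> s) (\<psi> s)) + integral {\<tau> n..\<tau> (Suc n)} (\<lambda>s. mul (\<rho> s) (\<psi> s))
     = integral {0..\<tau> (Suc n)} (\<lambda>s. mul (\<rho> s) (\<psi> s))"
    using t Suc.prems(1,2)
    by (intro Henstock_Kurzweil_Integration.integral_combine integrable_continuous_real continuous_on)
  moreover have "mul (\<rho> (\<tau> n)) (integral {\<tau> n..\<tau> (Suc n)} \<psi>) - integral {\<tau> n..\<tau> (Suc n)} (\<lambda>s. mul (\<rho> s) (\<psi> s))
     = integral {\<tau> n..\<tau> (Suc n)} (\<lambda>s. mul (\<rho> (\<tau> n) - \<rho> s) (\<psi> s))"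
  proof -
    have "mul (\<rho> (\<tau> n)) (integral {\<tau> n..\<tau> (Suc n)} \<psi>) = integral {\<tau> n..\<tau> (Suc n)} (\<lambda>s. mul (\<rho> (\<tau> n)) (\<psi> s))"
      using integral_linear[OF integrable_continuous_real[OF c\<psi>] bounded_linear_right, of "\<rho> (\<tau> n)"]
      by (simp add: o_def)
    then show ?thesis unfolding diff_left
      by (subst integral_diff) (auto intro!: integrable_continuous_real continuous_on continuous_intros c\<rho> c\<psi>)
  qed
  ultimately have eq: "(\<Sum>k<Suc n. mul (\<rho> (\<tau> k)) (integral {\<tau> k..\<tau> (Suc k)} \<psi>)) - integral {0..\<tau> (Suc n)} (\<lambda>s. mul (\<rho> s) (\<psi> s))
    = ((\<Sum>k<n. mul (\<rho> (\<tau> k)) (integral {\<tau> k..\<tau> (Suc k)} \<psi>)) - integral {0..\<tau> n} (\<lambda>s. mul (\<rho> s) (\<psi> s)))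
     + integral {\<tau> n..\<tau> (Suc n)} (\<lambda>s. mul (\<rho> (\<tau> n) - \<rho> s) (\<psi> s))"
    by (simp add: algebra_simps)
  have "norm (integral {\<tau> n..\<tau> (Suc n)} (\<lambda>s. mul (\<rho> (\<tau> n) - \<rho> s) (\<psi> s))) \<le> (\<omega> * M * K) * (\<tau> (Suc n) - \<tau> n)"
  proof (rule integral_bound[OF t(2)])
    show "continuous_on {\<tau> n..\<tau> (Suc n)} (\<lambda>s. mul (\<rho> (\<tau> n) - \<rho> s) (\<psi> s))"
      by (intro continuous_on continuous_intros c\<rho> c\<psi>)
    fix s assume s: "s \<in> {\<tau> n..\<tau> (Suc n)}"
    have "norm (mul (\<rho> (\<tau> n) - \<rho> s) (\<psi> s)) \<le> norm (\<rho> (\<tau> n) - \<rho> s) * norm (\<psi> s) * K" by (rule K)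
    also have "\<dots> \<le> \<omega> * M * K"
      using Suc.prems(4)[of n s] Suc.prems(3)[of s] s t K(2)
      by (intro mult_right_mono mult_mono) (auto intro: order_trans[OF norm_ge_zero])
    finally show "norm (mul (\<rho> (\<tau> n) - \<rho> s) (\<psi> s)) \<le> \<omega> * M * K" .
  qed
  then show ?case unfolding eq
    using IH by (intro norm_triangle_le) (simp add: algebra_simps)
qed

lemma mixed_deriv_rectangle:
  fixes f F :: "real \<Rightarrow> real \<Rightarrow> 'a::banach"
  assumes mixed: "mixed_deriv_on_quadrant f F"
    and ab: "0 \<le> a" "a \<le> b" and cd: "0 \<le> c" "c \<le> d"
  shows "f b d - f a d - f b c + f a c = integral {c..d} (\<lambda>t. integral {a..b} (\<lambda>x. F x t))"
proof -
  obtain ft where ft: "\<And>x t. 0 \<le> x \<Longrightarrow> 0 \<le> t \<Longrightarrow> ((\<lambda>t. f x t) has_vector_derivative ft x t) (at t within {0..})"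
    "\<And>x t. 0 \<le> x \<Longrightarrow> 0 \<le> t \<Longrightarrow> ((\<lambda>x. ft x t) has_vector_derivative F x t) (at x within {0..})"
    using mixed unfolding mixed_deriv_on_quadrant_def by blast
  have inner: "integral {a..b} (\<lambda>x. F x t) = ft b t - ft a t" if "0 \<le> t" for t
    by (rule integral_unique, rule fundamental_theorem_of_calculus[OF ab(2)],
        rule has_vector_derivative_within_subset[OF ft(2)]) (use ab that in auto)
  have "((\<lambda>t. ft b t - ft a t) has_integral ((f b d - f a d) - (f b c - f a c))) {c..d}"
  proof (rule fundamental_theorem_of_calculus[OF cd(2)])
    fix t assume "t \<in> {c..d}"
    then show "((\<lambda>t. f b t - f a t) has_vector_derivative ft b t - ft a t) (at t within {c..d})"
      using ab cd by (intro derivative_intros has_vector_derivative_within_subset[OF ft(1)]) auto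
  qed
  then have "integral {c..d} (\<lambda>t. ft b t - ft a t) = (f b d - f a d) - (f b c - f a c)" by (rule integral_unique)
  moreover have "integral {c..d} (\<lambda>t. integral {a..b} (\<lambda>x. F x t)) = integral {c..d} (\<lambda>t. ft b t - ft a t)"
    by (rule integral_cong) (use inner cd in auto)
  ultimately show ?thesis by simp
qed

lemma min_increment:
  fixes \<tau> :: "nat \<Rightarrow> real"
  assumes "mono \<tau>"
  shows "min (\<tau> (Suc k)) (\<tau> (Suc j)) - min (\<tau> k) (\<tau> (Suc j)) - min (\<tau> (Suc k)) (\<tau> j) + min (\<tau> k) (\<tau> j)
    = (if j = k then \<tau> (Suc k) - \<tau> k else 0)"
proof -
  have s: "\<tau> k \<le> \<tau> (Suc k)" "\<tau> j \<le> \<tau> (Suc j)" using assms by (auto simp: mono_def)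
  consider "j = k" | "Suc j \<le> k" | "Suc k \<le> j" by linarith
  then show ?thesis
  proof cases
    case 2
    then have "\<tau> (Suc j) \<le> \<tau> k" using assms by (auto simp: mono_def)
    then show ?thesis using s 2 by (auto simp: min_def)
  next
    case 3
    then have "\<tau> (Suc k) \<le> \<tau> j" using assms by (auto simp: mono_def)
    then show ?thesis using s 3 by (auto simp: min_def)
  qed (use s in \<open>auto simp: min_def\<close>)
qed

context gl_coefficients
begin

lemma step_function_form:
  fixes \<tau> :: "nat \<Rightarrow> real" and n :: nat and \<rho> :: "nat \<Rightarrow> complex^('n + 'n)"
  assumes form: "\<And>x t r s. 0 \<le> x \<Longrightarrow> 0 \<le> t \<Longrightarrow> has_bochner_integral M
       (\<lambda>l. cdot ((r v* te0 B H x l) v* \<Phi> l) (s v* te0 B H t l))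
       (of_real (min x t) * cdot r s + cdot (r v* Ft x t) s)"
    and mixed: "mixed_deriv_on_quadrant Ft F"
    and \<tau>: "mono \<tau>" "\<tau> 0 = 0"
  defines "G \<equiv> \<lambda>l. \<Sum>k<n. \<rho> k v* (te0 B H (\<tau> (Suc k)) l - te0 B H (\<tau> k) l)"
  shows "has_bochner_integral M (\<lambda>l. cdot (G l v* \<Phi> l) (G l))
    (\<Sum>j<n. cdot ((\<tau> (Suc j) - \<tau> j) *\<^sub>R \<rho> j
       + (\<Sum>k<n. \<rho> k v* integral {\<tau> j..\<tau> (Suc j)} (\<lambda>t. integral {\<tau> k..\<tau> (Suc k)} (\<lambda>x. F x t)))) (\<rho> j))"
proof -
  have \<tau>0: "0 \<le> \<tau> k" for k using \<tau> by (metis monoD zero_le)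
  have \<tau>S: "\<tau> k \<le> \<tau> (Suc k)" for k using \<tau>(1) by (simp add: mono_def)
  define c where "c k j = integral {\<tau> j..\<tau> (Suc j)} (\<lambda>t. integral {\<tau> k..\<tau> (Suc k)} (\<lambda>x. F x t))" for k j
  define D where "D k l = te0 B H (\<tau> (Suc k)) l - te0 B H (\<tau> k) l" for k l
  have cell: "has_bochner_integral M (\<lambda>l. cdot ((\<rho> k v* D k l) v* \<Phi> l) (\<rho> j v* D j l))
     ((if j = k then (\<tau> (Suc k) - \<tau> k) *\<^sub>R cdot (\<rho> j) (\<rho> j) else 0) + cdot (\<rho> k v* c k j) (\<rho> j))" for k j
  proof -
    define T where "T x t l = cdot ((\<rho> k v* te0 B H x l) v* \<Phi> l) (\<rho> j v* te0 B H t l)" for x t l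
    define I where "I x t = of_real (min x t) * cdot (\<rho> k) (\<rho> j) + cdot (\<rho> k v* Ft x t) (\<rho> j)" for x t
    have T: "has_bochner_integral M (T x t) (I x t)" if "0 \<le> x" "0 \<le> t" for x t
      using form[OF that] unfolding T_def I_def .
    have "has_bochner_integral M
       (\<lambda>l. T (\<tau> (Suc k)) (\<tau> (Suc j)) l - T (\<tau> k) (\<tau> (Suc j)) l - T (\<tau> (Suc k)) (\<tau> j) l + T (\<tau> k) (\<tau> j) l)
       (I (\<tau> (Suc k)) (\<tau> (Suc j)) - I (\<tau> k) (\<tau> (Suc j)) - I (\<tau> (Suc k)) (\<tau> j) + I (\<tau> k) (\<tau> j))"
      by (intro has_bochner_integral_add has_bochner_integral_diff T \<tau>0)
    moreover have "T (\<tau> (Suc k)) (\<tau> (Suc j)) l - T (\<tau> k) (\<tau> (Suc j)) l - T (\<tau> (Suc k)) (\<tau> j) l + T (\<tau> k) (\<tau> j) l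
       = cdot ((\<rho> k v* D k l) v* \<Phi> l) (\<rho> j v* D j l)" for l
      by (simp add: T_def D_def vmult.diff_right vmult.diff_left cdot.diff_left cdot.diff_right)
    moreover have "I (\<tau> (Suc k)) (\<tau> (Suc j)) - I (\<tau> k) (\<tau> (Suc j)) - I (\<tau> (Suc k)) (\<tau> j) + I (\<tau> k) (\<tau> j)
      = (if j = k then (\<tau> (Suc k) - \<tau> k) *\<^sub>R cdot (\<rho> j) (\<rho> j) else 0) + cdot (\<rho> k v* c k j) (\<rho> j)"
    proof -
      have "I (\<tau> (Suc k)) (\<tau> (Suc j)) - I (\<tau> k) (\<tau> (Suc j)) - I (\<tau> (Suc k)) (\<tau> j) + I (\<tau> k) (\<tau> j)
        = of_real (min (\<tau> (Suc k)) (\<tau> (Suc j)) - min (\<tau> k) (\<tau> (Suc j)) - min (\<tau> (Suc k)) (\<tau> j) + min (\<tau> k) (\<tau> j))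
           * cdot (\<rho> k) (\<rho> j)
          + cdot (\<rho> k v* (Ft (\<tau> (Suc k)) (\<tau> (Suc j)) - Ft (\<tau> k) (\<tau> (Suc j)) - Ft (\<tau> (Suc k)) (\<tau> j) + Ft (\<tau> k) (\<tau> j))) (\<rho> j)"
        unfolding I_def by (simp add: vmult.diff_right vmult.add_right cdot.diff_left cdot.add_left left_diff_distrib distrib_right)
      then show ?thesis
        unfolding min_increment[OF \<tau>(1)] mixed_deriv_rectangle[OF mixed \<tau>0 \<tau>S \<tau>0 \<tau>S] c_def
        by (auto simp: scaleR_conv_of_real)
    qed
    ultimately show ?thesis by (simp only:)
  qed
  have "has_bochner_integral M (\<lambda>l. \<Sum>j<n. \<Sum>k<n. cdot ((\<rho> k v* D k l) v* \<Phi> l) (\<rho> j v* D j l))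
    (\<Sum>j<n. \<Sum>k<n. (if j = k then (\<tau> (Suc k) - \<tau> k) *\<^sub>R cdot (\<rho> j) (\<rho> j) else 0) + cdot (\<rho> k v* c k j) (\<rho> j))"
    by (intro has_bochner_integral_sum cell)
  moreover have "(\<Sum>j<n. \<Sum>k<n. cdot ((\<rho> k v* D k l) v* \<Phi> l) (\<rho> j v* D j l)) = cdot (G l v* \<Phi> l) (G l)" for l
    unfolding G_def D_def[symmetric] by (simp add: vmult.sum_left cdot.sum_left cdot.sum_right)
  moreover have "(\<Sum>k<n. (if j = k then (\<tau> (Suc k) - \<tau> k) *\<^sub>R cdot (\<rho> j) (\<rho> j) else 0) + cdot (\<rho> k v* c k j) (\<rho> j))
     = cdot ((\<tau> (Suc j) - \<tau> j) *\<^sub>R \<rho> j + (\<Sum>k<n. \<rho> k v* c k j)) (\<rho> j)" if "j < n" for j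
    using that by (simp add: sum.distrib cdot.add_left cdot.scaleR_left cdot.sum_left)
  ultimately show ?thesis by (simp add: c_def)
qed

lemma transform_continuous:
  assumes "continuous_on {0..R} \<rho>"
  shows "continuous_on UNIV (\<lambda>l. integral {0..R} (\<lambda>s. \<rho> s v* e0 B H s l))"
  unfolding cbox_interval[symmetric]
  by (rule integral_continuous_on_param)
     (auto simp: case_prod_unfold intro!: vmult.continuous_on continuous_e0_comp continuous_intros continuous_on_compose2[OF assms])

lemma te0_increment:
  assumes "0 \<le> a" "a \<le> b"
  shows "te0 B H b l - te0 B H a l = integral {a..b} (\<lambda>s. e0 B H s l)"
proof -
  have "integral {0..a} (\<lambda>s. e0 B H s l) + integral {a..b} (\<lambda>s. e0 B H s l) = integral {0..b} (\<lambda>s. e0 B H s l)"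
    using assms by (intro Henstock_Kurzweil_Integration.integral_combine integrable_continuous_real
        continuous_e0_comp continuous_intros)
  then show ?thesis unfolding te0_def by (metis add_diff_cancel_left')
qed

text \<open>
  \<open>g i\<close> is the transform of a step function approximating \<open>\<rho>\<close>, and \<open>Y i j\<close> is the integral over the \<open>j\<close>-th cell of
  an approximation to the left-hand side of the homogeneous equation, hence small.
\<close>

lemma transform_null:
  fixes \<rho> :: "real \<Rightarrow> complex^('n + 'n)" and R :: real
  assumes form: "\<And>x t r s. 0 \<le> x \<Longrightarrow> 0 \<le> t \<Longrightarrow> has_bochner_integral M
       (\<lambda>l. cdot ((r v* te0 B H x l) v* \<Phi> l) (s v* te0 B H t l))
       (of_real (min x t) * cdot r s + cdot (r v* Ft x t) s)"
    and M: "sets M = sets borel" and \<Phi>: "\<Phi> \<in> borel_measurable borel" "\<And>l. nonneg_mat (\<Phi> l)"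
    and mixed: "mixed_deriv_on_quadrant Ft F"
    and F: "continuous_on quadrant (\<lambda>(x, t). F x t)"
    and R: "0 < R" and \<rho>: "continuous_on {0..R} \<rho>"
    and eq: "\<And>t. t \<in> {0..R} \<Longrightarrow> \<rho> t + integral {0..R} (\<lambda>s. \<rho> s v* F s t) = 0"
  defines "G \<equiv> \<lambda>l. integral {0..R} (\<lambda>s. \<rho> s v* e0 B H s l)"
  shows "has_bochner_integral M (\<lambda>l. cdot (G l v* \<Phi> l) (G l)) 0"
proof -
  obtain K where K: "0 < K" "\<And>(a::complex^('n+'n)) (b::complex^('n+'n)^('n+'n)). norm (a v* b) \<le> norm a * norm b * K"
    using bounded_bilinear.pos_bounded[OF bounded_bilinear_vector_matrix_mult] by blast
  obtain K' where K': "0 < K'" "\<And>(a::complex^('n+'n)) (b::complex^'n^('n+'n)). norm (a v* b) \<le> norm a * norm b * K'"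
    using bounded_bilinear.pos_bounded[OF bounded_bilinear_vector_matrix_mult] by blast
  obtain L where L: "0 < L" "\<And>(a::complex^('n+'n)) b. norm (cdot a b) \<le> norm a * norm b * L"
    using cdot.pos_bounded by blast
  have Fsq: "continuous_on ({0..R} \<times> {0..R}) (\<lambda>(x, t). F x t)"
    by (rule continuous_on_subset[OF F]) (auto simp: quadrant_def)
  then have "bounded ((\<lambda>(x, t). F x t) ` ({0..R} \<times> {0..R}))"
    by (intro compact_imp_bounded compact_continuous_image compact_Times) auto
  then obtain mF where mF: "0 < mF" "\<And>x t. x \<in> {0..R} \<Longrightarrow> t \<in> {0..R} \<Longrightarrow> norm (F x t) \<le> mF"
    unfolding bounded_pos by fastforce
  have Fc: "continuous_on S (\<lambda>p. F (a p) (b p))"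
    if "continuous_on S a" "continuous_on S b" "\<And>p. p \<in> S \<Longrightarrow> 0 \<le> a p \<and> 0 \<le> b p"
    for S :: "'z::topological_space set" and a b
    using continuous_on_compose2[OF F continuous_on_Pair[OF that(1,2)]] that(3) by (auto simp: quadrant_def)
  have Fx: "continuous_on {0..R} (\<lambda>x. F x t)" if "t \<in> {0..R}" for t
    using that by (intro Fc continuous_intros) auto
  have "bounded (\<rho> ` {0..R})" using \<rho> by (intro compact_imp_bounded compact_continuous_image) auto
  then obtain m where m: "0 < m" "\<And>s. s \<in> {0..R} \<Longrightarrow> norm (\<rho> s) \<le> m" unfolding bounded_pos by auto
  have uc: "uniformly_continuous_on {0..R} \<rho>" by (intro compact_uniformly_continuous \<rho>) auto
  define \<omega> where "\<omega> i = 1 / real (Suc i)" for i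
  have \<omega>: "0 < \<omega> i" for i by (simp add: \<omega>_def)
  have \<omega>0: "\<omega> \<longlonglongrightarrow> 0" unfolding \<omega>_def using LIMSEQ_inverse_real_of_nat by (simp add: inverse_eq_divide)
  have "\<exists>N>0. \<forall>s s'. s \<in> {0..R} \<longrightarrow> s' \<in> {0..R} \<longrightarrow> \<bar>s - s'\<bar> \<le> R / real N \<longrightarrow> norm (\<rho> s - \<rho> s') \<le> \<omega> i" for i
  proof -
    obtain d where d: "d > 0" "\<And>s s'. s \<in> {0..R} \<Longrightarrow> s' \<in> {0..R} \<Longrightarrow> dist s' s < d \<Longrightarrow> dist (\<rho> s') (\<rho> s) < \<omega> i"
      using uc \<omega>[of i] unfolding uniformly_continuous_on_def by metis
    obtain N where N: "R / d < real N" using reals_Archimedean2 by blast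
    have "0 < R / d" using R d(1) by simp
    then have "N > 0" using N by (cases N) auto
    moreover have "R / real N < d" using N d(1) \<open>N > 0\<close> by (simp add: field_simps)
    ultimately show ?thesis
      using d(2) by (intro exI[of _ N]) (force simp: dist_norm intro: less_imp_le)
  qed
  then obtain N where N: "\<And>i. N i > (0::nat)"
    "\<And>i s s'. s \<in> {0..R} \<Longrightarrow> s' \<in> {0..R} \<Longrightarrow> \<bar>s - s'\<bar> \<le> R / real (N i) \<Longrightarrow> norm (\<rho> s - \<rho> s') \<le> \<omega> i"
    by metis
  define \<tau> where "\<tau> i k = R / real (N i) * real k" for i k
  have \<tau>: "mono (\<tau> i)" "\<tau> i 0 = 0" "\<tau> i (N i) = R" for i
    using R N(1)[of i] by (auto simp: \<tau>_def mono_def intro!: divide_right_mono mult_left_mono)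
  have \<tau>in: "\<tau> i k \<in> {0..R}" if "k \<le> N i" for i k
    using monoD[OF \<tau>(1)[of i] that] monoD[OF \<tau>(1)[of i], of 0 k] \<tau>(2,3)[of i] by auto
  have \<tau>S: "\<tau> i k \<le> \<tau> i (Suc k)" for i k using \<tau>(1)[of i] by (simp add: mono_def)
  have cell: "s \<in> {0..R}" "norm (\<rho> (\<tau> i k) - \<rho> s) \<le> \<omega> i" if "k < N i" "s \<in> {\<tau> i k..\<tau> i (Suc k)}" for i k s
  proof -
    show s: "s \<in> {0..R}" using that \<tau>in[of k i] \<tau>in[of "Suc k" i] by auto
    show "norm (\<rho> (\<tau> i k) - \<rho> s) \<le> \<omega> i"
      by (rule N(2)[OF \<tau>in s]) (use that in \<open>auto simp: \<tau>_def algebra_simps add_divide_distrib\<close>)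
  qed
  define g where "g i l = (\<Sum>k<N i. \<rho> (\<tau> i k) v* (te0 B H (\<tau> i (Suc k)) l - te0 B H (\<tau> i k) l))" for i l
  define Y where "Y i j = (\<tau> i (Suc j) - \<tau> i j) *\<^sub>R \<rho> (\<tau> i j)
       + (\<Sum>k<N i. \<rho> (\<tau> i k) v* integral {\<tau> i j..\<tau> i (Suc j)} (\<lambda>t. integral {\<tau> i k..\<tau> i (Suc k)} (\<lambda>x. F x t)))" for i j
  define q where "q i = (\<Sum>j<N i. cdot (Y i j) (\<rho> (\<tau> i j)))" for i
  have gq: "has_bochner_integral M (\<lambda>l. cdot (g i l v* \<Phi> l) (g i l)) (q i)" for i
    unfolding g_def q_def Y_def by (rule step_function_form[OF form mixed \<tau>(1,2)])
  define A where "A = 1 + K * mF * R"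
  have A: "0 < A" using K(1) mF(1) R by (simp add: A_def add_pos_nonneg)
  have Yb: "norm (Y i j) \<le> \<omega> i * A * (\<tau> i (Suc j) - \<tau> i j)" if j: "j < N i" for i j
  proof -
    define S where "S t = (\<Sum>k<N i. \<rho> (\<tau> i k) v* integral {\<tau> i k..\<tau> i (Suc k)} (\<lambda>x. F x t))" for t
    have Ic: "continuous_on {\<tau> i j..\<tau> i (Suc j)} (\<lambda>t. integral {\<tau> i k..\<tau> i (Suc k)} (\<lambda>x. F x t))" if "k < N i" for k
      unfolding cbox_interval[symmetric]
    proof (rule integral_continuous_on_param)
      show "continuous_on (cbox (\<tau> i j) (\<tau> i (Suc j)) \<times> cbox (\<tau> i k) (\<tau> i (Suc k))) (\<lambda>(t, x). F x t)"
        using cell(1)[OF that] cell(1)[OF j] unfolding case_prod_unfold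
        by (intro Fc continuous_intros) auto
    qed
    have Sc: "continuous_on {\<tau> i j..\<tau> i (Suc j)} S"
      unfolding S_def by (intro continuous_intros vmult.continuous_on Ic) auto
    have "integral {\<tau> i j..\<tau> i (Suc j)} (\<lambda>t. \<rho> (\<tau> i j) + S t)
      = (\<tau> i (Suc j) - \<tau> i j) *\<^sub>R \<rho> (\<tau> i j) + integral {\<tau> i j..\<tau> i (Suc j)} S"
      using \<tau>S[of i j] by (subst integral_add) (auto intro: integrable_continuous_real Sc)
    also have "integral {\<tau> i j..\<tau> i (Suc j)} S
      = (\<Sum>k<N i. integral {\<tau> i j..\<tau> i (Suc j)} (\<lambda>t. \<rho> (\<tau> i k) v* integral {\<tau> i k..\<tau> i (Suc k)} (\<lambda>x. F x t)))"
      unfolding S_def by (intro integral_sum integrable_continuous_real vmult.continuous_on Ic continuous_intros) auto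
    also have "\<dots> = (\<Sum>k<N i. \<rho> (\<tau> i k) v* integral {\<tau> i j..\<tau> i (Suc j)} (\<lambda>t. integral {\<tau> i k..\<tau> i (Suc k)} (\<lambda>x. F x t)))"
      using integral_linear[OF integrable_continuous_real[OF Ic] vmult.bounded_linear_right]
      by (intro sum.cong refl) (auto simp: o_def)
    finally have Yi: "Y i j = integral {\<tau> i j..\<tau> i (Suc j)} (\<lambda>t. \<rho> (\<tau> i j) + S t)" by (simp add: Y_def)
    show ?thesis unfolding Yi
    proof (rule integral_bound[OF \<tau>S])
      show "continuous_on {\<tau> i j..\<tau> i (Suc j)} (\<lambda>t. \<rho> (\<tau> i j) + S t)" by (intro continuous_intros Sc)
      fix t assume t: "t \<in> {\<tau> i j..\<tau> i (Suc j)}"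
      have tR: "t \<in> {0..R}" by (rule cell(1)[OF j t])
      have "norm (S t - integral {0..\<tau> i (N i)} (\<lambda>s. \<rho> s v* F s t)) \<le> K * \<omega> i * mF * \<tau> i (N i)"
        unfolding S_def
        by (rule riemann_sum_bound[OF bounded_bilinear_vector_matrix_mult K(2,1) \<tau>(1,2)])
           (use \<tau>(3) \<rho> Fx[OF tR] mF(2) tR cell(2) in auto)
      moreover have "integral {0..R} (\<lambda>s. \<rho> s v* F s t) = - \<rho> t" using eq[OF tR] by (simp add: eq_neg_iff_add_eq_0 add.commute)
      ultimately have "norm (S t + \<rho> t) \<le> K * \<omega> i * mF * R" by (simp add: \<tau>(3))
      moreover have "norm (\<rho> (\<tau> i j) - \<rho> t) \<le> \<omega> i" by (rule cell(2)[OF j t])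
      moreover have "\<rho> (\<tau> i j) + S t = (\<rho> (\<tau> i j) - \<rho> t) + (S t + \<rho> t)" by simp
      ultimately have "norm (\<rho> (\<tau> i j) + S t) \<le> \<omega> i + K * \<omega> i * mF * R" by (metis add_mono norm_triangle_le)
      then show "norm (\<rho> (\<tau> i j) + S t) \<le> \<omega> i * A" by (simp add: A_def algebra_simps)
    qed
  qed
  have q_le: "norm (q i) \<le> L * m * A * R * \<omega> i" for i
  proof -
    have "norm (q i) \<le> (\<Sum>j<N i. L * m * A * \<omega> i * (\<tau> i (Suc j) - \<tau> i j))"
      unfolding q_def
    proof (rule sum_norm_le)
      fix j assume "j \<in> {..<N i}"
      then have j: "j < N i" by simp
      have "norm (cdot (Y i j) (\<rho> (\<tau> i j))) \<le> norm (Y i j) * norm (\<rho> (\<tau> i j)) * L" by (rule L)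
      also have "\<dots> \<le> (\<omega> i * A * (\<tau> i (Suc j) - \<tau> i j)) * m * L"
        using Yb[OF j] m(2)[OF \<tau>in[of j i]] j L(1) \<omega>[of i] A \<tau>S[of i j]
        by (intro mult_right_mono mult_mono) auto
      finally show "norm (cdot (Y i j) (\<rho> (\<tau> i j))) \<le> L * m * A * \<omega> i * (\<tau> i (Suc j) - \<tau> i j)" by (simp add: mult_ac)
    qed
    also have "\<dots> = L * m * A * \<omega> i * R"
      by (simp add: sum_distrib_left[symmetric] sum_lessThan_telescope \<tau>)
    finally show ?thesis by (simp add: mult_ac)
  qed
  have q0: "q \<longlonglongrightarrow> 0"
    by (rule Lim_null_comparison[OF always_eventually[OF allI[OF q_le]]])
       (use tendsto_mult_left[OF \<omega>0, of "L * m * A * R"] in simp)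
  have glim: "(\<lambda>i. g i l) \<longlonglongrightarrow> G l" for l
  proof -
    have ec: "continuous_on {0..R} (\<lambda>s. e0 B H s l)" by (intro continuous_e0_comp continuous_intros)
    then have "bounded ((\<lambda>s. e0 B H s l) ` {0..R})" by (intro compact_imp_bounded compact_continuous_image) auto
    then obtain me where me: "\<And>s. s \<in> {0..R} \<Longrightarrow> norm (e0 B H s l) \<le> me" unfolding bounded_iff by blast
    have gG: "norm (g i l - G l) \<le> K' * me * R * \<omega> i" for i
    proof -
      have "g i l = (\<Sum>k<N i. \<rho> (\<tau> i k) v* integral {\<tau> i k..\<tau> i (Suc k)} (\<lambda>s. e0 B H s l))"
        unfolding g_def
      proof (intro sum.cong refl)
        fix k assume "k \<in> {..<N i}"
        then have "0 \<le> \<tau> i k" using \<tau>in[of k i] by auto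
        then show "\<rho> (\<tau> i k) v* (te0 B H (\<tau> i (Suc k)) l - te0 B H (\<tau> i k) l)
            = \<rho> (\<tau> i k) v* integral {\<tau> i k..\<tau> i (Suc k)} (\<lambda>s. e0 B H s l)"
          by (simp add: te0_increment \<tau>S)
      qed
      moreover have "norm ((\<Sum>k<N i. \<rho> (\<tau> i k) v* integral {\<tau> i k..\<tau> i (Suc k)} (\<lambda>s. e0 B H s l))
         - integral {0..\<tau> i (N i)} (\<lambda>s. \<rho> s v* e0 B H s l)) \<le> K' * \<omega> i * me * \<tau> i (N i)"
        by (rule riemann_sum_bound[OF bounded_bilinear_vector_matrix_mult K'(2,1) \<tau>(1,2)])
           (use \<tau>(3) \<rho> ec me cell(2) in auto)
      ultimately show ?thesis by (simp add: \<tau>(3) G_def mult_ac)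
    qed
    have "(\<lambda>i. K' * me * R * \<omega> i) \<longlonglongrightarrow> 0"
      using tendsto_mult_left[OF \<omega>0, of "K' * me * R"] by simp
    then have "(\<lambda>i. g i l - G l) \<longlonglongrightarrow> 0"
      by (rule Lim_null_comparison[OF always_eventually[OF allI[OF gG]]])
    then show ?thesis by (simp add: LIM_zero_iff)
  qed
  define h where "h v l = Re (cdot (v v* \<Phi> l) v)" for v l
  have h0: "0 \<le> h v l" for v l unfolding h_def by (rule nonneg_cdot[OF \<Phi>(2)])
  have Gm: "G \<in> borel_measurable borel"
    unfolding G_def by (intro borel_measurable_continuous_onI transform_continuous \<rho>)
  have "(\<lambda>l. G l v* \<Phi> l) \<in> borel_measurable borel"
    by (rule borel_measurable_continuous_Pair[OF Gm \<Phi>(1)]) (intro vmult.continuous_on continuous_intros)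
  then have Qm: "(\<lambda>l. cdot (G l v* \<Phi> l) (G l)) \<in> borel_measurable borel"
    by (rule borel_measurable_continuous_Pair[OF _ Gm]) (intro cdot.continuous_on continuous_intros)
  have hm: "(\<lambda>l. h (G l) l) \<in> borel_measurable M"
    using Qm unfolding h_def measurable_cong_sets[OF M refl] by simp
  have hg: "has_bochner_integral M (\<lambda>l. h (g i l) l) (Re (q i))" for i
    unfolding h_def by (rule has_bochner_integral_bounded_linear[OF bounded_linear_Re gq])
  have hq: "(\<integral>\<^sup>+l. ennreal (h (g i l) l) \<partial>M) = ennreal (Re (q i))" for i
    using nn_integral_eq_integral[of M "\<lambda>l. h (g i l) l"] hg[of i] h0 by (simp add: has_bochner_integral_iff)
  have "(\<integral>\<^sup>+l. ennreal (h (G l) l) \<partial>M) = (\<integral>\<^sup>+l. liminf (\<lambda>i. ennreal (h (g i l) l)) \<partial>M)"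
  proof (rule nn_integral_cong)
    fix l
    have "(\<lambda>i. h (g i l) l) \<longlonglongrightarrow> h (G l) l"
      unfolding h_def by (intro tendsto_Re cdot.tendsto vmult.tendsto glim tendsto_const)
    then have "(\<lambda>i. ennreal (h (g i l) l)) \<longlonglongrightarrow> ennreal (h (G l) l)" by (rule tendsto_ennrealI)
    then show "ennreal (h (G l) l) = liminf (\<lambda>i. ennreal (h (g i l) l))"
      by (rule lim_imp_Liminf[OF sequentially_bot, symmetric])
  qed
  also have "\<dots> \<le> liminf (\<lambda>i. \<integral>\<^sup>+l. ennreal (h (g i l) l) \<partial>M)"
    by (rule nn_integral_liminf) (use borel_measurable_has_bochner_integral[OF hg] in simp)
  also have "\<dots> = liminf (\<lambda>i. ennreal (Re (q i)))"
    by (simp only: hq)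
  also have "\<dots> = 0"
    using lim_imp_Liminf[OF sequentially_bot tendsto_ennrealI[OF tendsto_Re[OF q0]]] by simp
  finally have "(\<integral>\<^sup>+l. ennreal (h (G l) l) \<partial>M) = 0" by simp
  then have "AE l in M. ennreal (h (G l) l) = 0"
    by (subst (asm) nn_integral_0_iff_AE) (use hm in auto)
  then have ae: "AE l in M. cdot (G l v* \<Phi> l) (G l) = 0"
  proof eventually_elim
    case (elim l)
    then have "h (G l) l = 0" using h0[of "G l" l] by (simp add: ennreal_eq_0_iff)
    then show ?case using cdot_real[of "\<Phi> l" "G l"] \<Phi>(2)[of l] by (simp add: h_def nonneg_mat_def)
  qed
  have "has_bochner_integral M (\<lambda>l. 0 :: complex) 0" by (rule has_bochner_integral_zero)
  then show ?thesis
    by (subst has_bochner_integral_cong_AE[OF _ _ ae]) (use Qm measurable_cong_sets[OF M refl] in auto)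
qed

end

definition cnj_row :: "complex^'m \<Rightarrow> complex^'m" where
  "cnj_row v = (\<chi> i. cnj (v $ i))"

lemma bounded_linear_cnj_row: "bounded_linear cnj_row"
  unfolding linear_conv_bounded_linear[symmetric] cnj_row_def
  by (rule linearI) (auto simp: vec_eq_iff)

lemma adj_mult_cnj_row: "adj M *v cnj_row r = cnj_row (r v* M)"
  by (simp add: cnj_row_def adj_def matrix_vector_mult_def vector_matrix_mult_def mult_ac)

lemma row_matrix_mult: "(A ** M) $ i = A $ i v* M"
  by (simp add: vec_eq_iff matrix_matrix_mult_def vector_matrix_mult_def mult.commute)

lemma sandwich_columnvector: "adj (columnvector v) ** M ** columnvector v = (\<chi> i j. qform M v)"
proof -
  have "adj (columnvector v) ** (M ** columnvector v) = (\<chi> i j. qform M v)"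
    by (simp add: vec_eq_iff matrix_matrix_mult_def adj_def columnvector_def qform_def matrix_vector_mult_def)
  then show ?thesis by (simp only: matrix_mul_assoc)
qed

lemma L2_comp_truncation:
  fixes \<rho> :: "real \<Rightarrow> complex^'m"
  assumes "continuous_on {0..R} \<rho>"
  shows "L2_comp (\<lambda>x. if x \<in> {0..R} then \<rho> x else 0)"
  unfolding L2_comp_def
proof (intro conjI)
  have "(\<lambda>x. if x \<in> {0..R} then \<rho> x else 0) \<in> borel_measurable lebesgue"
    by (intro borel_measurable_if_I continuous_imp_measurable_on_sets_lebesgue assms) auto
  then show "(\<lambda>x. if x \<in> {0..R} then \<rho> x else 0) \<in> borel_measurable (lebesgue_on {0..})"
    by (rule measurable_restrict_space1)
  have "integrable (lebesgue_on {0..R}) (\<lambda>x. (norm (\<rho> x))\<^sup>2)"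
    by (intro continuous_imp_integrable_real continuous_intros assms)
  then have i: "integrable lebesgue (\<lambda>x. indicator {0..R} x *\<^sub>R (norm (\<rho> x))\<^sup>2)"
    by (subst (asm) integrable_restrict_space) auto
  have e: "(\<lambda>x. indicator {0..R} x *\<^sub>R (norm (\<rho> x))\<^sup>2)
      = (\<lambda>x. indicator {0..} x *\<^sub>R (norm (if x \<in> {0..R} then \<rho> x else 0))\<^sup>2)"
    by (auto simp: indicator_def)
  from i show "integrable (lebesgue_on {0..}) (\<lambda>x. (norm (if x \<in> {0..R} then \<rho> x else 0))\<^sup>2)"
    unfolding e by (subst integrable_restrict_space) auto
  show "\<exists>R'. AE x in lebesgue_on {0..}. R' < x \<longrightarrow> (if x \<in> {0..R} then \<rho> x else 0) = 0"
    by (intro exI[of _ R] AE_I2) auto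
qed

lemma AE_truncation_zero:
  fixes \<rho> :: "real \<Rightarrow> 'a::euclidean_space"
  assumes \<rho>: "continuous_on {0..R} \<rho>" and R: "0 < R"
    and ae: "AE x in lebesgue_on {0..}. (if x \<in> {0..R} then \<rho> x else 0) = 0"
    and t: "t \<in> {0..R}"
  shows "\<rho> t = 0"
proof -
  have "AE x in lebesgue. x \<in> {0..} \<longrightarrow> (if x \<in> {0..R} then \<rho> x else 0) = 0"
    using ae by (subst (asm) AE_restrict_space_iff) auto
  then have "AE x in lebesgue. x \<notin> {x \<in> {0..R}. \<rho> x \<noteq> 0}"
    by eventually_elim (auto split: if_splits)
  then obtain N where N: "N \<in> null_sets lebesgue" "{x \<in> {0..R}. \<rho> x \<noteq> 0} \<subseteq> N"
    unfolding eventually_ae_filter by auto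
  then have "negligible N" by (simp add: negligible_iff_null_sets)
  then have "integral {0..R} (\<lambda>x. norm (\<rho> x)) = integral {0..R} (\<lambda>x. 0 :: real)"
    by (rule integral_spike) (use N in auto)
  then have "\<forall>x\<in>{0..R}. norm (\<rho> x) = 0"
    using integral_eq_0_iff[OF continuous_on_norm[OF \<rho>] R] by simp
  then show ?thesis using t by simp
qed

context gl_coefficients
begin

lemma G0_truncation:
  assumes \<rho>: "continuous_on {0..R} \<rho>" and R: "0 \<le> R"
  shows "G0 B H (\<lambda>x. if x \<in> {0..R} then cnj_row (\<rho> x) else 0) l
    = cnj_row (integral {0..R} (\<lambda>s. \<rho> s v* e0 B H s l))"
proof -
  have c: "continuous_on {0..R} (\<lambda>s. \<rho> s v* e0 B H s l)"
    by (intro vmult.continuous_on \<rho> continuous_e0_comp continuous_intros)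
  have c': "continuous_on {0..R} (\<lambda>s. cnj_row (\<rho> s v* e0 B H s l))"
    by (rule bounded_linear.continuous_on[OF bounded_linear_cnj_row c])
  have "G0 B H (\<lambda>x. if x \<in> {0..R} then cnj_row (\<rho> x) else 0) l
    = (LINT x|lebesgue_on {0..}. (if x \<in> {0..R} then cnj_row (\<rho> x v* e0 B H x l) else 0))"
    unfolding G0_def by (intro Bochner_Integration.integral_cong refl) (auto simp: adj_mult_cnj_row)
  also have "\<dots> = (LINT x|lebesgue. indicator {0..} x *\<^sub>R (if x \<in> {0..R} then cnj_row (\<rho> x v* e0 B H x l) else 0))"
    by (rule integral_restrict_space) auto
  also have "\<dots> = (LINT x|lebesgue. indicator {0..R} x *\<^sub>R cnj_row (\<rho> x v* e0 B H x l))"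
    by (intro Bochner_Integration.integral_cong refl) (auto simp: indicator_def)
  also have "\<dots> = (LINT x|lebesgue_on {0..R}. cnj_row (\<rho> x v* e0 B H x l))"
    by (rule integral_restrict_space[symmetric]) auto
  also have "\<dots> = integral {0..R} (\<lambda>x. cnj_row (\<rho> x v* e0 B H x l))"
    by (rule lebesgue_integral_eq_integral[OF continuous_imp_integrable_real[OF c']]) auto
  also have "\<dots> = cnj_row (integral {0..R} (\<lambda>s. \<rho> s v* e0 B H s l))"
    using integral_linear[OF integrable_continuous_real[OF c] bounded_linear_cnj_row] by (simp add: o_def)
  finally show ?thesis .
qed

lemma kernel_injective:
  fixes k :: "real \<Rightarrow> complex^('n + 'n)^('n + 'n)"
  assumes incr: "increasing_mat \<sigma>"
    and uniq: "\<And>g. L2_comp g \<Longrightarrow>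
           has_matrix_integral \<sigma> (\<lambda>l. adj (columnvector (G0 B H g l)))
             (\<lambda>l. columnvector (G0 B H g l)) (0 :: complex^1^1) \<Longrightarrow>
           AE x in lebesgue_on {0..}. g x = 0"
    and Ft: "\<And>x t. 0 \<le> x \<Longrightarrow> 0 \<le> t \<Longrightarrow>
           has_matrix_integral_diff \<sigma> (sigma0 B1) (\<lambda>l. te0 B H x l)
             (\<lambda>l. adj (te0 B H t l)) (Ft x t)"
    and mixed: "mixed_deriv_on_quadrant Ft F"
    and F: "continuous_on quadrant (\<lambda>(x, t). F x t)"
    and R: "0 \<le> R" and k: "continuous_on {0..R} k"
    and eq: "\<And>t. t \<in> {0..R} \<Longrightarrow> k t + integral {0..R} (\<lambda>s. k s ** F s t) = 0"
    and t: "t \<in> {0..R}"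
  shows "k t = 0"
proof (cases "R = 0")
  case True
  then show ?thesis using eq[of t] t by simp
next
  case False
  then have R0: "0 < R" using R by simp
  have "k t $ i = 0" for i
  proof -
    define \<rho> where "\<rho> t = k t $ i" for t
    have \<rho>: "continuous_on {0..R} \<rho>" unfolding \<rho>_def by (intro continuous_intros k)
    have Fc: "continuous_on {0..R} (\<lambda>s. F s t)" if "0 \<le> t" for t
    proof -
      have "continuous_on {0..R} (\<lambda>s. (\<lambda>(x, t). F x t) (s, t))"
        by (rule continuous_on_compose2[OF F]) (use that in \<open>auto simp: quadrant_def intro!: continuous_intros\<close>)
      then show ?thesis by simp
    qed
    have \<rho>eq: "\<rho> t + integral {0..R} (\<lambda>s. \<rho> s v* F s t) = 0" if t: "t \<in> {0..R}" for t
    proof -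
      have "integral {0..R} (\<lambda>s. (k s ** F s t) $ i) = integral {0..R} (\<lambda>s. k s ** F s t) $ i"
        using integral_linear[OF integrable_continuous_real bounded_linear_vec_nth, of 0 R "\<lambda>s. k s ** F s t" i]
          mmult.continuous_on[OF k Fc] t by (simp add: o_def)
      then have "integral {0..R} (\<lambda>s. \<rho> s v* F s t) = integral {0..R} (\<lambda>s. k s ** F s t) $ i"
        by (simp add: row_matrix_mult \<rho>_def)
      then show ?thesis using arg_cong[OF eq[OF t], of "\<lambda>M. M $ i"] by (simp add: \<rho>_def)
    qed
    obtain \<Phi> where \<Phi>: "matrix_density \<sigma> \<Phi>"
      "\<And>x t r s. 0 \<le> x \<Longrightarrow> 0 \<le> t \<Longrightarrow> has_bochner_integral (trace_measure \<sigma>)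
       (\<lambda>l. cdot ((r v* te0 B H x l) v* \<Phi> l) (s v* te0 B H t l))
       (of_real (min x t) * cdot r s + cdot (r v* Ft x t) s)"
      using quadratic_form[OF incr Ft] by blast
    define G where "G l = integral {0..R} (\<lambda>s. \<rho> s v* e0 B H s l)" for l
    define g where "g x = (if x \<in> {0..R} then cnj_row (\<rho> x) else 0)" for x
    have cg: "continuous_on {0..R} (\<lambda>x. cnj_row (\<rho> x))"
      by (rule bounded_linear.continuous_on[OF bounded_linear_cnj_row \<rho>])
    have G0: "G0 B H g l = cnj_row (G l)" for l
      unfolding g_def[abs_def] G_def by (rule G0_truncation[OF \<rho> R])
    have null: "has_bochner_integral (trace_measure \<sigma>) (\<lambda>l. cdot (G l v* \<Phi> l) (G l)) 0"
      unfolding G_def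
      by (rule transform_null[OF \<Phi>(2) _ _ _ mixed F R0 \<rho> \<rho>eq])
         (use \<Phi>(1) in \<open>auto simp: trace_measure_def matrix_density_def\<close>)
    have "bounded_linear (\<lambda>c :: complex. (\<chi> i j. c) :: complex^1^1)"
      unfolding linear_conv_bounded_linear[symmetric] by (rule linearI) (auto simp: vec_eq_iff)
    from has_bochner_integral_bounded_linear[OF this null]
    have "has_bochner_integral (trace_measure \<sigma>)
        (\<lambda>l. adj (columnvector (G0 B H g l)) ** \<Phi> l ** columnvector (G0 B H g l)) (0 :: complex^1^1)"
      unfolding sandwich_columnvector G0 by (simp add: cdot_eq_qform cnj_row_def zero_vec_def)
    then have "AE x in lebesgue_on {0..}. g x = 0"
      using \<Phi>(1) L2_comp_truncation[OF cg] unfolding g_def[abs_def]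
      by (intro uniq) (auto simp: has_matrix_integral_def)
    then have "cnj_row (\<rho> t) = 0"
      unfolding g_def by (rule AE_truncation_zero[OF cg R0 _ t])
    then show ?thesis by (simp add: cnj_row_def \<rho>_def vec_eq_iff)
  qed
  then show ?thesis by (simp add: vec_eq_iff)
qed

end

lemma C1_on_uminus:
  assumes "C1_on D f"
  shows "C1_on D (\<lambda>x t. - f x t)"
proof -
  obtain f' where f': "continuous_on D f'"
    "\<And>p. p \<in> D \<Longrightarrow> ((\<lambda>(x, t). f x t) has_derivative blinfun_apply (f' p)) (at p within D)"
    using assms unfolding C1_on_def by blast
  show ?thesis unfolding C1_on_def
  proof (intro exI conjI ballI)
    show "continuous_on D (\<lambda>p. - f' p)" by (intro continuous_intros f')
    show "((\<lambda>(x, t). - f x t) has_derivative blinfun_apply (- f' p)) (at p within D)" if "p \<in> D" for p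
      using has_derivative_minus[OF f'(2)[OF that]] by (simp add: case_prod_unfold uminus_blinfun.rep_eq)
  qed
qed

theorem proposition5p1:
  fixes B1 B2 H :: "complex^'n^'n"
    and B :: "complex^('n + 'n)^('n + 'n)"
    and \<sigma> :: "real \<Rightarrow> complex^'n^'n"
    and Ft F :: "real \<Rightarrow> real \<Rightarrow> complex^('n + 'n)^('n + 'n)"
  assumes "posdef_mat B1" and "posdef_mat B2"
    and "B = block_diag B1 (- B2)"
    and "B1 = adj H ** B2 ** H"
    and "increasing_mat \<sigma>"
    and "\<And>g. L2_comp g \<Longrightarrow>
           has_matrix_integral \<sigma> (\<lambda>l. adj (columnvector (G0 B H g l)))
             (\<lambda>l. columnvector (G0 B H g l)) (0 :: complex^1^1) \<Longrightarrow>
           AE x in lebesgue_on {0..}. g x = 0"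
    and "\<And>x t. 0 \<le> x \<Longrightarrow> 0 \<le> t \<Longrightarrow>
           has_matrix_integral_diff \<sigma> (sigma0 B1) (\<lambda>l. te0 B H x l)
             (\<lambda>l. adj (te0 B H t l)) (Ft x t)"
    and "mixed_deriv_on_quadrant Ft F"
    and "continuous_on quadrant (\<lambda>(x, t). F x t)"
  shows "\<exists>K. GL_solution F K \<and>
           (\<forall>K'. GL_solution F K' \<longrightarrow> (\<forall>(x, t)\<in>lower_triangle. K' x t = K x t)) \<and>
           (C1_on quadrant F \<longrightarrow> C1_on lower_triangle K)"
proof -
  interpret gl_coefficients B1 B2 H B by unfold_locales fact+
  have inj: "k t = 0"
    if "0 \<le> x" "continuous_on {0..x} k" "\<And>t. t \<in> {0..x} \<Longrightarrow> k t + integral {0..x} (\<lambda>s. k s ** F s t) = 0"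
      "t \<in> {0..x}" for x t :: real and k :: "real \<Rightarrow> complex^('n + 'n)^('n + 'n)"
    by (rule kernel_injective[where \<sigma> = \<sigma> and Ft = Ft and F = F and R = x]) (fact assms that)+
  interpret injective_kernel "(**) :: complex^('n + 'n)^('n + 'n) \<Rightarrow> _" F
  proof (rule injective_kernel.intro[OF bounded_bilinear_matrix_matrix_mult injective_kernel_axioms.intro])
    show "continuous_on quadrant (\<lambda>(x, t). F x t)" by fact
  qed (fact inj)
  have mF: "continuous_on quadrant (\<lambda>(x, t). - F x t)"
    using continuous_on_minus[OF assms(9)] by (simp add: case_prod_unfold)
  have eq: "a + b + c = 0 \<longleftrightarrow> b + c = - a" for a b c :: "complex^('n + 'n)^('n + 'n)"
  proof -
    have "a + b + c = (b + c) - (- a)" by (simp add: algebra_simps)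
    then show ?thesis by (simp only: right_minus_eq)
  qed
  have GL: "GL_solution F K \<longleftrightarrow> continuous_on lower_triangle (\<lambda>(x, t). K x t) \<and>
     (\<forall>x t. 0 \<le> t \<and> t < x \<longrightarrow> K x t + integral {0..x} (\<lambda>s. K x s ** F s t) = - F x t)" for K
    unfolding GL_solution_def eq ..
  show ?thesis
  proof (rule triangle_solution[OF mF])
    fix K :: "real \<Rightarrow> real \<Rightarrow> complex^('n + 'n)^('n + 'n)"
    assume K: "continuous_on lower_triangle (\<lambda>(x, t). K x t)"
      "\<And>x t. 0 \<le> t \<Longrightarrow> t < x \<Longrightarrow> K x t + integral {0..x} (\<lambda>s. K x s ** F s t) = - F x t"
    assume unique: "\<And>K' x t. continuous_on lower_triangle (\<lambda>(x, t). K' x t) \<Longrightarrow>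
        (\<And>x t. 0 \<le> t \<Longrightarrow> t < x \<Longrightarrow> K' x t + integral {0..x} (\<lambda>s. K' x s ** F s t) = - F x t) \<Longrightarrow>
        (x, t) \<in> lower_triangle \<Longrightarrow> K' x t = K x t"
      and C1: "C1_on quadrant F \<Longrightarrow> C1_on quadrant (\<lambda>x t. - F x t) \<Longrightarrow> C1_on lower_triangle K"
    show ?thesis
    proof (intro exI conjI allI impI)
      show "GL_solution F K" using K unfolding GL by blast
      show "\<forall>(x, t)\<in>lower_triangle. K' x t = K x t" if "GL_solution F K'" for K'
      proof clarify
        fix x t :: real assume "(x, t) \<in> lower_triangle"
        then show "K' x t = K x t" using that unfolding GL by (intro unique) blast+
      qed
      show "C1_on lower_triangle K" if "C1_on quadrant F" by (rule C1[OF that C1_on_uminus[OF that]])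
    qed
  qed
qed

end
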